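(* Let $d\ge3$, $\lambda>2$, $\psi\in C_0^\infty(\mathbb{R}^d)$, $S$ real-valued real analytic on a neighborhood of the support of $\psi$, and $\Lambda_d(f_1,\dots,f_d)=\int_{\mathbb{R}^d}e^{i\lambda S(x)}\psi(x)\prod_{j=1}^d f_j(\pi_j(x))\,dx$. Suppose $\Lambda_d$ satisfies the local estimate hypotheses in each of $x_1,\dots,x_d$ with parameter $\mu>0$ and constants $C_1,C_2$. Then $$|\Lambda_d(f_1,\dots,f_d)|\le C(\lambda\mu)^{-2^{1-d}}\prod_{j=1}^d\|f_j\|_{L^{p(d)}},\qquad p(d)=(d-1)\frac{2^{d-1}}{2^{d-1}-1},$$ where $C$ depends only on $d$, $C_1$, $C_2$.
   Context: $\pi_j(x)=(x_1,\dots,x_{j-1},x_{j+1},\dots,x_d)$, $D_d=\partial_1\cdots\partial_d$. $\Lambda_d$ satisfies the local estimate hypotheses in $x_j$ with parameter $\mu>0$ if: (1) $\psi$ is supported in a rectangle of width $b_j$ in the $x_j$-direction; (2) there is $C_1>0$ with $|\partial_{x_j}^n\psi|\le C_1b_j^{-n}$ for $n=0,1,2$; (3) there is $C_2>0$ with $|D_dS|\ge\mu$, $|\partial_{x_j}D_dS|\le C_2\mu b_j^{-1}$, $|\partial_{x_j}^2D_dS|\le C_2\mu b_j^{-2}$ on the support of $\psi$. *)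

theory Defs
  imports "HOL-Analysis.Analysis"
begin

text \<open>Points of R^d are vectors of type real^'n, d = CARD('n).
  R^(d-1) after deleting coordinate j is modelled as functions on the index
  set UNIV - {j}, with product Lebesgue measure.\<close>

definition partial :: "'n::finite \<Rightarrow> (real^'n \<Rightarrow> 'b::real_normed_vector) \<Rightarrow> real^'n \<Rightarrow> 'b" where
  "partial j f x = vector_derivative (\<lambda>t. f (x + t *\<^sub>R axis j 1)) (at 0)"

fun iter_partial :: "'n::finite list \<Rightarrow> (real^'n \<Rightarrow> 'b::real_normed_vector) \<Rightarrow> real^'n \<Rightarrow> 'b" where
  "iter_partial [] f = f"
| "iter_partial (j # js) f = partial j (iter_partial js f)"

definition partial_pow :: "'n::finite \<Rightarrow> nat \<Rightarrow> (real^'n \<Rightarrow> 'b::real_normed_vector) \<Rightarrow> real^'n \<Rightarrow> 'b" where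
  "partial_pow j n f = iter_partial (replicate n j) f"

text \<open>D_d = partial_1 ... partial_d (mixed partials of smooth functions commute,
  so the enumeration order of the coordinates is immaterial)\<close>
definition Dd :: "(real^'n::finite \<Rightarrow> 'b::real_normed_vector) \<Rightarrow> real^'n \<Rightarrow> 'b" where
  "Dd f = iter_partial (SOME js. distinct js \<and> set js = (UNIV :: 'n set)) f"

definition smooth_on :: "(real^'n::finite) set \<Rightarrow> (real^'n \<Rightarrow> 'b::real_normed_vector) \<Rightarrow> bool" where
  "smooth_on U f \<longleftrightarrow>
     (\<forall>js. continuous_on U (iter_partial js f) \<and>
       (\<forall>j. \<forall>x\<in>U. (\<lambda>t. iter_partial js f (x + t *\<^sub>R axis j 1)) differentiable (at 0)))"

definition tsupport :: "(real^'n::finite \<Rightarrow> 'b::zero) \<Rightarrow> (real^'n) set" where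
  "tsupport f = closure {x. f x \<noteq> 0}"

definition C0_inf :: "(real^'n::finite \<Rightarrow> 'b::real_normed_vector) \<Rightarrow> bool" where
  "C0_inf f \<longleftrightarrow> smooth_on UNIV f \<and> compact (tsupport f)"

definition real_analytic_on :: "(real^'n::finite) set \<Rightarrow> (real^'n \<Rightarrow> real) \<Rightarrow> bool" where
  "real_analytic_on U S \<longleftrightarrow> open U \<and>
     (\<forall>x0\<in>U. \<exists>r>0. \<exists>c :: ('n \<Rightarrow> nat) \<Rightarrow> real.
        \<forall>x\<in>ball x0 r. ((\<lambda>\<alpha>. c \<alpha> * (\<Prod>i\<in>UNIV. (x$i - x0$i) ^ \<alpha> i)) has_sum S x) UNIV)"

definition proj_del :: "'n::finite \<Rightarrow> real^'n \<Rightarrow> ('n \<Rightarrow> real)" where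
  "proj_del j x = restrict (\<lambda>i. x$i) (UNIV - {j})"

definition hyperplane_measure :: "'n::finite \<Rightarrow> ('n \<Rightarrow> real) measure" where
  "hyperplane_measure j = PiM (UNIV - {j}) (\<lambda>_. lborel)"

definition Lp_norm :: "('a \<Rightarrow> real) measure \<Rightarrow> real \<Rightarrow> (('a \<Rightarrow> real) \<Rightarrow> complex) \<Rightarrow> real" where
  "Lp_norm M p g = (\<integral>y. norm (g y) powr p \<partial>M) powr (1 / p)"

definition Lambda_d :: "real \<Rightarrow> (real^'n::finite \<Rightarrow> real) \<Rightarrow> (real^'n \<Rightarrow> complex)
     \<Rightarrow> ('n \<Rightarrow> ('n \<Rightarrow> real) \<Rightarrow> complex) \<Rightarrow> complex" where
  "Lambda_d lam S \<psi> f = (\<integral>x. exp (\<i> * complex_of_real (lam * S x)) * \<psi> x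
        * (\<Prod>j\<in>UNIV. f j (proj_del j x)) \<partial>lborel)"

definition local_estimate_hyp :: "(real^'n::finite \<Rightarrow> real) \<Rightarrow> (real^'n \<Rightarrow> complex)
     \<Rightarrow> 'n \<Rightarrow> real \<Rightarrow> real \<Rightarrow> real \<Rightarrow> real \<Rightarrow> bool" where
  "local_estimate_hyp S \<psi> j \<mu> b C1 C2 \<longleftrightarrow>
     b > 0 \<and> C1 > 0 \<and> C2 > 0 \<and>
     (\<exists>a. \<forall>x\<in>tsupport \<psi>. a \<le> x$j \<and> x$j \<le> a + b) \<and>
     (\<forall>n\<in>{0,1,2::nat}. \<forall>x. norm (partial_pow j n \<psi> x) \<le> C1 * b powr (- real n)) \<and>
     (\<forall>x\<in>tsupport \<psi>. \<bar>Dd S x\<bar> \<ge> \<mu> \<and>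
        \<bar>partial j (Dd S) x\<bar> \<le> C2 * \<mu> / b \<and>
        \<bar>partial_pow j 2 (Dd S) x\<bar> \<le> C2 * \<mu> / b^2)"

definition p_exp :: "nat \<Rightarrow> real" where
  "p_exp d = real (d - 1) * 2 ^ (d - 1) / (2 ^ (d - 1) - 1)"

end

theory Submission imports Defs begin

text \<open>By repeated Cauchy-Schwarz one variable after the other is removed from the form, each step replacing
  the phase by a difference. After \<open>d - 1\<close> steps only the integral in one last variable \<open>x\<^sub>t\<close> remains,
  whose phase has \<open>x\<^sub>t\<close>-derivative at least \<open>\<mu> \<Prod>\<bar>x\<^sub>j - y\<^sub>j\<bar>\<close>, and integration by parts twice gives
  the factor \<open>min 1 (\<lambda>\<mu> \<Prod>\<bar>x\<^sub>j - y\<^sub>j\<bar>)\<^sup>-\<^sup>2\<close>. Instead of interpolating, the functions \<open>f\<^sub>j\<close> are distributed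
  over the two factors of each Cauchy-Schwarz step by weights which make the \<open>L\<^sup>p\<close> exponents come out
  right; the differences \<open>\<bar>x\<^sub>j - y\<^sub>j\<bar>\<close> are absorbed by Hardy-Littlewood-Sobolev and the remaining functions by
  Loomis-Whitney.

  The mean value theorem behind the lower bound needs \<open>D\<^sub>dS\<close> to be bounded below on a product set, whereas it
  is so only on the support of \<open>\<psi>\<close>. Hence the support is cut into dyadic Whitney cells. A cell of generation
  \<open>k\<close> is within \<open>O(2\<^sup>-\<^sup>k)\<close> of a zero of \<open>\<psi>\<close>, so \<open>\<psi>\<close> is \<open>O(2\<^sup>-\<^sup>k)\<close> there, which beats the loss
  \<open>2 powr (3k/4)\<close> from adding up the cells of one generation with the discrete Loomis-Whitney inequality.\<close>

section \<open>Products of finite measures\<close>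

text \<open>Every Cauchy-Schwarz step squares the amplitude bound c, so the box kernel carries it to
  the power 2^(d-1); the root 2^(1-d) taken in the end restores c to the first power, and the
  smallness 2^-k of \<psi> on a cell of generation k survives in full. The length of the cell in
  direction t and the inverse frequency scale alike, so that b and the cell size cancel, and one
  cell costs (\<lambda>\<mu>)^(-2^(1-d)) times its amplitude. Adding the cells of one generation
  costs 2^(k d 2^(1-d)), and d 2^(1-d) is at most 3/4 once d is at least 3; at d = 2 the loss would
  be 2^k and consume the whole gain. Two integrations by parts are made because a single one would
  leave the kernel 1/|x - y| for the last difference, the endpoint excluded from the
  Hardy-Littlewood-Sobolev inequality; quadratic decay is integrable. The weights occur with
  negative powers. The functions are therefore carried along with majorants bounded away from zero,
  over finite measures of positive mass, and the general case is reached by limits.\<close>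

lemma weighted_am_gm:
  fixes x \<theta> :: "'k \<Rightarrow> real"
  assumes "finite I" "I \<noteq> {}" "\<And>i. i \<in> I \<Longrightarrow> \<theta> i > 0" "(\<Sum>i\<in>I. \<theta> i) = 1" "\<And>i. i \<in> I \<Longrightarrow> x i \<ge> 0"
  shows "(\<Prod>i\<in>I. x i powr \<theta> i) \<le> (\<Sum>i\<in>I. \<theta> i * x i)"
proof (cases "\<exists>i\<in>I. x i = 0")
  case True
  then have "(\<Prod>i\<in>I. x i powr \<theta> i) = 0"
    using assms(1) by (auto intro!: prod_zero)
  moreover have "(\<Sum>i\<in>I. \<theta> i * x i) \<ge> 0"
    using assms by (intro sum_nonneg mult_nonneg_nonneg) (auto simp: less_imp_le)
  ultimately show ?thesis by linarith
next
  case False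
  then have pos: "x i > 0" if "i \<in> I" for i using assms(5)[OF that] that by force
  have cvx: "convex_on UNIV (exp :: real \<Rightarrow> real)" by (rule exp_convex)
  have "(\<Prod>i\<in>I. x i powr \<theta> i) = exp (\<Sum>i\<in>I. \<theta> i *\<^sub>R ln (x i))"
    using assms(1) by (simp add: exp_sum powr_def less_imp_neq[OF pos, symmetric] cong: prod.cong)
  also have "\<dots> \<le> (\<Sum>i\<in>I. \<theta> i * exp (ln (x i)))"
    using assms by (intro convex_on_sum[OF _ _ cvx]) (auto intro: less_imp_le)
  also have "\<dots> = (\<Sum>i\<in>I. \<theta> i * x i)" using pos by auto
  finally show ?thesis .
qed

text \<open>Apply \<open>weighted_am_gm\<close> pointwise to the functions divided by their
  integrals; the sum on the right then integrates to the sum of the exponents, which is 1. Without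
  the normalisation the same inequality dominates the product by an integrable function. A vanishing
  integral cannot be normalised, but then that function, and with it the product, is zero almost
  everywhere.\<close>

lemma Holder_prod:
  fixes h :: "'k \<Rightarrow> 'a \<Rightarrow> real" and \<theta> :: "'k \<Rightarrow> real"
  assumes I: "finite I" "I \<noteq> {}" and \<theta>: "\<And>i. i \<in> I \<Longrightarrow> \<theta> i > 0" "(\<Sum>i\<in>I. \<theta> i) = 1"
    and int: "\<And>i. i \<in> I \<Longrightarrow> integrable M (h i)" and nn: "\<And>i x. i \<in> I \<Longrightarrow> h i x \<ge> 0"
  shows "integrable M (\<lambda>x. \<Prod>i\<in>I. h i x powr \<theta> i)"
    and "(\<integral>x. (\<Prod>i\<in>I. h i x powr \<theta> i) \<partial>M) \<le> (\<Prod>i\<in>I. (\<integral>x. h i x \<partial>M) powr \<theta> i)"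
proof -
  have meas [measurable]: "h i \<in> borel_measurable M" if "i \<in> I" for i using int[OF that] by auto
  have m: "(\<lambda>x. \<Prod>i\<in>I. h i x powr \<theta> i) \<in> borel_measurable M"
    by (intro borel_measurable_prod powr_real_measurable) auto
  have pn: "(\<Prod>i\<in>I. h i x powr \<theta> i) \<ge> 0" for x by (intro prod_nonneg) auto
  show ii: "integrable M (\<lambda>x. \<Prod>i\<in>I. h i x powr \<theta> i)"
  proof (rule Bochner_Integration.integrable_bound[where f = "\<lambda>x. \<Sum>i\<in>I. \<theta> i * h i x"])
    show "integrable M (\<lambda>x. \<Sum>i\<in>I. \<theta> i * h i x)" using int by auto
    show "AE x in M. norm (\<Prod>i\<in>I. h i x powr \<theta> i) \<le> norm (\<Sum>i\<in>I. \<theta> i * h i x)"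
    proof (rule AE_I2)
      fix x
      have "(\<Prod>i\<in>I. h i x powr \<theta> i) \<le> (\<Sum>i\<in>I. \<theta> i * h i x)"
        using assms by (intro weighted_am_gm) auto
      then show "norm (\<Prod>i\<in>I. h i x powr \<theta> i) \<le> norm (\<Sum>i\<in>I. \<theta> i * h i x)"
        using pn[of x] by auto
    qed
  qed (rule m)
  show "(\<integral>x. (\<Prod>i\<in>I. h i x powr \<theta> i) \<partial>M) \<le> (\<Prod>i\<in>I. (\<integral>x. h i x \<partial>M) powr \<theta> i)"
  proof (cases "\<exists>i\<in>I. (\<integral>x. h i x \<partial>M) = 0")
    case True
    then obtain i where i: "i \<in> I" "(\<integral>x. h i x \<partial>M) = 0" by auto
    then have "AE x in M. h i x = 0"
      using integral_nonneg_eq_0_iff_AE[OF int[OF i(1)]] nn by auto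
    then have "AE x in M. (\<Prod>i\<in>I. h i x powr \<theta> i) = 0"
      by eventually_elim (use i I in \<open>auto intro!: prod_zero\<close>)
    then have "(\<integral>x. (\<Prod>i\<in>I. h i x powr \<theta> i) \<partial>M) = 0"
      by (subst integral_cong_AE[where g = "\<lambda>_. 0"]) (use m in auto)
    moreover have "(\<Prod>i\<in>I. (\<integral>x. h i x \<partial>M) powr \<theta> i) \<ge> 0" by (intro prod_nonneg) auto
    ultimately show ?thesis by simp
  next
    case False
    define c where "c i = (\<integral>x. h i x \<partial>M)" for i
    have c: "c i > 0" if "i \<in> I" for i
    proof -
      have "c i \<ge> 0" unfolding c_def using nn that by auto
      moreover have "c i \<noteq> 0" unfolding c_def using that False by auto
      ultimately show ?thesis by simp
    qed
    have "(\<integral>x. (\<Prod>i\<in>I. h i x powr \<theta> i) \<partial>M) \<le>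
        (\<integral>x. (\<Prod>i\<in>I. c i powr \<theta> i) * (\<Sum>i\<in>I. \<theta> i * (h i x / c i)) \<partial>M)"
    proof (rule integral_mono[OF ii])
      show "integrable M (\<lambda>x. (\<Prod>i\<in>I. c i powr \<theta> i) * (\<Sum>i\<in>I. \<theta> i * (h i x / c i)))"
        using int by auto
      fix x
      have "(\<Prod>i\<in>I. h i x powr \<theta> i) = (\<Prod>i\<in>I. c i powr \<theta> i * (h i x / c i) powr \<theta> i)"
        using c nn by (intro prod.cong refl) (simp add: powr_mult[symmetric] less_imp_le less_imp_neq[symmetric])
      also have "\<dots> = (\<Prod>i\<in>I. c i powr \<theta> i) * (\<Prod>i\<in>I. (h i x / c i) powr \<theta> i)"
        by (rule prod.distrib)
      also have "\<dots> \<le> (\<Prod>i\<in>I. c i powr \<theta> i) * (\<Sum>i\<in>I. \<theta> i * (h i x / c i))"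
        using c nn assms by (intro mult_left_mono weighted_am_gm prod_nonneg) (auto simp: less_imp_le)
      finally show "(\<Prod>i\<in>I. h i x powr \<theta> i) \<le> \<dots>" .
    qed
    also have "\<dots> = (\<Prod>i\<in>I. c i powr \<theta> i) * (\<Sum>i\<in>I. \<theta> i * (c i / c i))"
    proof -
      have "(\<integral>x. (\<Sum>i\<in>I. \<theta> i * (h i x / c i)) \<partial>M) = (\<Sum>i\<in>I. (\<integral>x. \<theta> i * (h i x / c i) \<partial>M))"
        using int by (intro Bochner_Integration.integral_sum) auto
      also have "\<dots> = (\<Sum>i\<in>I. \<theta> i * (c i / c i))"
        by (intro sum.cong refl) (simp only: integral_mult_right_zero integral_divide_zero c_def)
      finally show ?thesis by (simp only: integral_mult_right_zero)
    qed
    also have "(\<Sum>i\<in>I. \<theta> i * (c i / c i)) = (\<Sum>i\<in>I. \<theta> i)"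
      using c by (intro sum.cong) (auto simp: less_imp_neq[symmetric])
    finally show ?thesis using \<theta>(2) by (simp add: c_def)
  qed
qed

lemma Holder_2:
  fixes f g :: "'a \<Rightarrow> real"
  assumes "0 < \<theta>" "\<theta> < 1" "integrable M f" "integrable M g" "\<And>x. f x \<ge> 0" "\<And>x. g x \<ge> 0"
  shows "integrable M (\<lambda>x. f x powr \<theta> * g x powr (1 - \<theta>))"
    and "(\<integral>x. f x powr \<theta> * g x powr (1 - \<theta>) \<partial>M) \<le> (\<integral>x. f x \<partial>M) powr \<theta> * (\<integral>x. g x \<partial>M) powr (1 - \<theta>)"
proof -
  let ?h = "\<lambda>b::bool. if b then f else g" and ?t = "\<lambda>b::bool. if b then \<theta> else 1 - \<theta>"
  have "integrable M (\<lambda>x. \<Prod>b\<in>UNIV. ?h b x powr ?t b)"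
    by (rule Holder_prod) (use assms in \<open>auto simp: UNIV_bool\<close>)
  then show "integrable M (\<lambda>x. f x powr \<theta> * g x powr (1 - \<theta>))"
    by (simp add: UNIV_bool mult.commute)
  have "(\<integral>x. (\<Prod>b\<in>UNIV. ?h b x powr ?t b) \<partial>M) \<le> (\<Prod>b\<in>UNIV. (\<integral>x. ?h b x \<partial>M) powr ?t b)"
    by (rule Holder_prod) (use assms in \<open>auto simp: UNIV_bool\<close>)
  then show "(\<integral>x. f x powr \<theta> * g x powr (1 - \<theta>) \<partial>M) \<le> (\<integral>x. f x \<partial>M) powr \<theta> * (\<integral>x. g x \<partial>M) powr (1 - \<theta>)"
    by (simp add: UNIV_bool mult.commute)
qed

text \<open>With finite factors, integrability on a finite product follows from measurability and a
  uniform bound. Lebesgue measure on the full space enters only at the end, after everything has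
  been confined to a bounded box.\<close>

locale finite_measures =
  fixes M :: "'i \<Rightarrow> 'a measure"
  assumes finite_measures: "\<And>i. finite_measure (M i)"
begin

sublocale product_sigma_finite M
  using finite_measures by (intro product_sigma_finite.intro) (simp add: finite_measure_def)

lemma finite_PiM:
  assumes "finite I" shows "finite_measure (PiM I M)"
proof
  have "emeasure (PiM I M) (space (PiM I M)) = (\<Prod>i\<in>I. emeasure (M i) (space (M i)))"
    using assms unfolding space_PiM by (intro emeasure_PiM) auto
  also have "\<dots> < \<infinity>"
    using finite_measures finite_measure.finite_emeasure_space
    by (auto simp: less_top[symmetric] ennreal_prod_eq_top)
  finally show "emeasure (PiM I M) (space (PiM I M)) \<noteq> \<infinity>" by simp
qed

lemma integrable_PiM_bounded:
  fixes f :: "_ \<Rightarrow> _::{banach, second_countable_topology}"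
  assumes "finite I" "f \<in> borel_measurable (PiM I M)" "\<And>z. norm (f z) \<le> B"
  shows "integrable (PiM I M) f"
  using finite_measure.integrable_const_bound[OF finite_PiM[OF assms(1)], of f B] assms by auto

lemma integrable_bounded:
  fixes f :: "_ \<Rightarrow> _::{banach, second_countable_topology}"
  assumes "f \<in> borel_measurable (M i)" "\<And>z. norm (f z) \<le> B"
  shows "integrable (M i) f"
  using finite_measure.integrable_const_bound[OF finite_measures[of i], of f B] assms by auto

end

section \<open>The Loomis-Whitney inequality\<close>

definition bounded_fun :: "('a \<Rightarrow> 'b::real_normed_vector) \<Rightarrow> bool" where
  "bounded_fun f \<longleftrightarrow> (\<exists>B. \<forall>x. norm (f x) \<le> B)"

lemma restrict_upd_insert:
  assumes "i \<notin> J" "k \<noteq> i"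
  shows "restrict (z(i := y)) (insert i J - {k}) = (restrict z (J - {k}))(i := y)"
  using assms by (auto simp: fun_eq_iff)

lemma (in finite_measures) measurable_upd_PiM:
  assumes "f \<in> borel_measurable (PiM (insert i J) M)" "i \<notin> J"
  shows "(\<lambda>(z, y). f (z(i := y))) \<in> borel_measurable (PiM J M \<Otimes>\<^sub>M M i)"
proof -
  have "(\<lambda>(z, y). z(i := y)) \<in> PiM J M \<Otimes>\<^sub>M M i \<rightarrow>\<^sub>M PiM (insert i J) M"
    by (rule measurable_add_dim)
  from measurable_compose[OF this assms(1)] show ?thesis by (simp add: case_prod_beta')
qed

text \<open>Induction on the number of variables, removing \<open>i\<close>. The factor
  \<open>g i\<close> does not see this variable; the other n factors are integrated over it by
  Hoelder with equal exponents 1/n, which replaces each \<open>g k\<close> by its partial integral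
  \<open>G k\<close>. Hoelder in the remaining variables separates \<open>g i\<close> from the
  product of the \<open>G k\<close>, and the induction hypothesis takes care of the latter.\<close>

lemma (in finite_measures) Loomis_Whitney:
  fixes g :: "'i \<Rightarrow> ('i \<Rightarrow> 'a) \<Rightarrow> real"
  assumes "finite J" "card J \<ge> 2"
    "\<And>j. j \<in> J \<Longrightarrow> g j \<in> borel_measurable (PiM (J - {j}) M)"
    "\<And>j. j \<in> J \<Longrightarrow> bounded_fun (g j)" "\<And>j z. j \<in> J \<Longrightarrow> g j z \<ge> 0"
  shows "(\<integral>z. (\<Prod>j\<in>J. g j (restrict z (J - {j})) powr (1 / real (card J - 1))) \<partial>PiM J M)
     \<le> (\<Prod>j\<in>J. (\<integral>z. g j z \<partial>PiM (J - {j}) M) powr (1 / real (card J - 1)))"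
  using assms
proof (induction "card J" arbitrary: J g rule: less_induct)
  case less
  note [simp] = less.prems(1)
  obtain i where i: "i \<in> J" using less.prems(2) by fastforce
  define J' where "J' = J - {i}"
  have J: "J = insert i J'" "i \<notin> J'" and [simp]: "finite J'" using i by (auto simp: J'_def)
  have J'J: "J' \<subseteq> J" by (auto simp: J'_def)
  define n where "n = card J'"
  have cJ: "card J = Suc n" and n1: "n \<ge> 1" using J less.prems(2) by (auto simp: n_def)
  have J'ne: "J' \<noteq> {}" using n1 n_def by auto
  obtain B0 where B0: "\<And>j z. j \<in> J \<Longrightarrow> norm (g j z) \<le> B0 j"
    using less.prems(4) unfolding bounded_fun_def by metis
  have B0p: "B0 j \<ge> 0" if "j \<in> J" for j using B0[OF that, of undefined] norm_ge_zero[of "g j undefined"] by linarith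
  have gB: "g j z \<le> B0 j" "0 \<le> g j z" if "j \<in> J" for j z using B0[OF that, of z] less.prems(5)[OF that] by auto
  define t where "t = 1 / real n"
  have t: "t > 0" using n1 by (simp add: t_def)
  have gi [measurable]: "g i \<in> borel_measurable (PiM J' M)" using less.prems(3)[OF i] by (simp add: J'_def)
  have gk: "g k \<in> borel_measurable (PiM (insert i (J' - {k})) M)" if "k \<in> J'" for k
  proof -
    have "J - {k} = insert i (J' - {k})" "k \<in> J" using J that by auto
    then show ?thesis using less.prems(3)[of k] by simp
  qed
  define G where "G k v = (\<integral>x. g k (v(i := x)) \<partial>M i)" for k v
  have gk2 [measurable]: "(\<lambda>(v, x). g k (v(i := x))) \<in> borel_measurable (PiM (J' - {k}) M \<Otimes>\<^sub>M M i)" if "k \<in> J'" for k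
    using measurable_upd_PiM[OF gk[OF that]] J by auto
  have Gm [measurable]: "G k \<in> borel_measurable (PiM (J' - {k}) M)" if "k \<in> J'" for k
    unfolding G_def using gk2[OF that] by measurable
  interpret Mi: finite_measure "M i" by (rule finite_measures)
  have Gbd: "norm (G k v) \<le> B0 k * measure (M i) (space (M i))" and Gnn: "G k v \<ge> 0" if "k \<in> J'" for k v
  proof -
    have k: "k \<in> J" using that J by auto
    show 0: "G k v \<ge> 0" unfolding G_def using gB[OF k] by (intro integral_nonneg_AE) auto
    show "norm (G k v) \<le> B0 k * measure (M i) (space (M i))"
    proof (cases "integrable (M i) (\<lambda>x. g k (v(i := x)))")
      case True
      have "G k v \<le> (\<integral>x. B0 k \<partial>M i)" unfolding G_def
        by (rule integral_mono[OF True]) (use gB[OF k] in auto)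
      then show ?thesis using 0 by (simp add: mult.commute)
    next
      case False
      then have "G k v = 0" unfolding G_def by (rule not_integrable_integral_eq)
      then show ?thesis using B0p[OF k] by simp
    qed
  qed
  have Gint: "(\<integral>v. G k v \<partial>PiM (J' - {k}) M) = (\<integral>z. g k z \<partial>PiM (J - {k}) M)" if "k \<in> J'" for k
  proof -
    have eq: "J - {k} = insert i (J' - {k})" using J that by auto
    show ?thesis unfolding G_def eq
      using that J gk[OF that] gB
      by (intro product_integral_insert[symmetric] integrable_PiM_bounded[where B = "B0 k"]) auto
  qed
  define A where "A z = (\<Prod>k\<in>J'. G k (restrict z (J' - {k})) powr t)" for z
  have meas_res: "(\<lambda>z. restrict z (J' - {k})) \<in> PiM J' M \<rightarrow>\<^sub>M PiM (J' - {k}) M" for k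
    by (rule measurable_restrict_subset) auto
  have GR [measurable]: "(\<lambda>z. G k (restrict z (J' - {k}))) \<in> borel_measurable (PiM J' M)" if "k \<in> J'" for k
    using measurable_compose[OF meas_res Gm[OF that]] .
  have Am [measurable]: "A \<in> borel_measurable (PiM J' M)" unfolding A_def
    by (intro borel_measurable_prod powr_real_measurable) auto
  define BG where "BG k = B0 k * measure (M i) (space (M i))" for k
  have BGp: "BG k \<ge> 0" if "k \<in> J'" for k using that J B0p by (auto simp: BG_def)
  have Ann: "A z \<ge> 0" for z unfolding A_def by (intro prod_nonneg) auto
  have Abd: "A z \<le> (\<Prod>k\<in>J'. BG k powr t)" for z
    unfolding A_def using Gbd Gnn t by (intro prod_mono conjI powr_mono2) (auto simp: BG_def)
  have step1: "(\<integral>x. (\<Prod>k\<in>J'. g k ((restrict z (J' - {k}))(i := x)) powr t) \<partial>M i) \<le> A z"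
    if z: "z \<in> space (PiM J' M)" for z
    unfolding A_def G_def
  proof (rule Holder_prod)
    show "(\<Sum>k\<in>J'. t) = 1" using n1 J'ne by (simp add: t_def n_def)
    show "0 \<le> g k ((restrict z (J' - {k}))(i := x))" if "k \<in> J'" for k x
      using gB(2) J'J that by blast
    show "finite J'" "J' \<noteq> {}" "0 < t" using J'ne t by auto
    fix k assume k: "k \<in> J'"
    have "restrict z (J' - {k}) \<in> space (PiM (J' - {k}) M)" using z by (auto simp: space_PiM)
    then show "integrable (M i) (\<lambda>x. g k ((restrict z (J' - {k}))(i := x)))"
      using measurable_compose[OF measurable_Pair1' gk2[OF k], of "restrict z (J' - {k})"] B0 k J'J
      by (intro integrable_bounded[where B = "B0 k"]) (auto simp: space_pair_measure)
  qed
  define F where "F z = (\<Prod>j\<in>J. g j (restrict z (J - {j})) powr t)" for z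
  have Fm: "F \<in> borel_measurable (PiM J M)" unfolding F_def
  proof (intro borel_measurable_prod powr_real_measurable)
    fix j assume "j \<in> J"
    have "(\<lambda>z. restrict z (J - {j})) \<in> PiM J M \<rightarrow>\<^sub>M PiM (J - {j}) M"
      by (rule measurable_restrict_subset) auto
    from measurable_compose[OF this less.prems(3)[OF \<open>j \<in> J\<close>]]
    show "(\<lambda>x. g j (restrict x (J - {j}))) \<in> borel_measurable (PiM J M)" .
  qed auto
  have Fnn: "F z \<ge> 0" for z unfolding F_def by (intro prod_nonneg) auto
  have Fbd: "F z \<le> (\<Prod>j\<in>J. B0 j powr t)" for z
    unfolding F_def using gB t by (intro prod_mono conjI powr_mono2) auto
  have "(\<integral>z. F z \<partial>PiM J M) = (\<integral>z. (\<integral>x. F (z(i := x)) \<partial>M i) \<partial>PiM J' M)"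
    unfolding J(1)
    using Fm Fbd Fnn J by (intro product_integral_insert integrable_PiM_bounded[where B = "\<Prod>j\<in>J. B0 j powr t"]) auto
  also have "\<dots> \<le> (\<integral>z. g i z powr t * A z \<partial>PiM J' M)"
  proof (rule integral_mono')
    show "integrable (PiM J' M) (\<lambda>z. g i z powr t * A z)"
      using gB[OF i] Ann Abd t
      by (intro integrable_PiM_bounded[where B = "B0 i powr t * (\<Prod>k\<in>J'. BG k powr t)"])
         (auto simp: abs_mult intro!: mult_mono powr_mono2)
    fix z assume z: "z \<in> space (PiM J' M)"
    have rz: "restrict z J' = z" using z by (auto simp: space_PiM)
    have "F (z(i := x)) = g i z powr t * (\<Prod>k\<in>J'. g k ((restrict z (J' - {k}))(i := x)) powr t)" for x
    proof -
      have "restrict (z(i := x)) (J - {i}) = z"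
      proof -
        have "restrict (z(i := x)) (J - {i}) = restrict (z(i := x)) J'" by (simp add: J'_def)
        also have "\<dots> = restrict z J'" using J(2) by (auto simp: fun_eq_iff)
        finally show ?thesis using rz by simp
      qed
      moreover have "restrict (z(i := x)) (J - {k}) = (restrict z (J' - {k}))(i := x)" if "k \<in> J'" for k
      proof -
        have "k \<noteq> i" using that J(2) by auto
        from restrict_upd_insert[OF J(2) this, of z x] show ?thesis by (simp only: J(1))
      qed
      ultimately show ?thesis
        unfolding F_def J(1) by (subst prod.insert) (use J(2) in \<open>auto simp: J(1) [symmetric]\<close>)
    qed
    then show "(\<integral>x. F (z(i := x)) \<partial>M i) \<le> g i z powr t * A z"
      using step1[OF z] by (simp add: mult_left_mono)
    show "0 \<le> g i z powr t * A z" using Ann by auto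
  qed
  also have "\<dots> \<le> (\<integral>z. g i z \<partial>PiM J' M) powr t * (\<Prod>k\<in>J'. (\<integral>z. g k z \<partial>PiM (J - {k}) M) powr t)"
  \<comment> \<open>With two variables \<open>A\<close> is a constant, namely \<open>G k\<close> at
    the empty argument, and there is nothing to separate; the exponent \<open>1 / (n - 1)\<close> of
    the induction hypothesis would be meaningless.\<close>
  proof (cases "n = 1")
    case True
    then obtain k where k: "J' = {k}" using n_def card_1_singletonE by metis
    have t1: "t = 1" using True by (simp add: t_def)
    have ps: "A z = G k (\<lambda>_. undefined)" for z
      by (simp add: A_def k t1 Gnn powr_one restrict_def)
    have "(\<integral>v. G k v \<partial>PiM (J' - {k}) M) = G k (\<lambda>_. undefined)"
      by (simp add: k PiM_empty lebesgue_integral_count_space_finite)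
    then have gg: "(\<integral>z. g k z \<partial>PiM (J - {k}) M) = G k (\<lambda>_. undefined)" using Gint[of k] k by simp
    have "(\<integral>z. g i z powr t * A z \<partial>PiM J' M) = (\<integral>z. g i z \<partial>PiM J' M) * G k (\<lambda>_. undefined)"
      using gB[OF i] by (simp add: ps t1)
    also have "\<dots> = (\<integral>z. g i z \<partial>PiM J' M) powr t * (\<Prod>k\<in>J'. (\<integral>z. g k z \<partial>PiM (J - {k}) M) powr t)"
      using gB[OF i] Gnn by (simp add: k gg t1)
    finally show ?thesis by simp
  next
    case False
    then have n2: "n \<ge> 2" using n1 by simp
    define s where "s = 1 / real (n - 1)"
    have s: "s > 0" using n2 by (simp add: s_def)
    \<comment> \<open>\<open>s\<close> is the Loomis-Whitney exponent for one variable less; the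
      Hoelder exponent \<open>1 - t\<close> turns it into the exponent \<open>t\<close> that is
      wanted here.\<close>
    have st: "s * (1 - t) = t" using n2 by (simp add: s_def t_def field_simps)
    have t1: "t < 1" using n2 by (simp add: t_def)
    define A' where "A' z = (\<Prod>k\<in>J'. G k (restrict z (J' - {k})) powr s)" for z
    have A'm [measurable]: "A' \<in> borel_measurable (PiM J' M)" unfolding A'_def
      by (intro borel_measurable_prod powr_real_measurable) auto
    have A'nn: "A' z \<ge> 0" for z unfolding A'_def by (intro prod_nonneg) auto
    have A'bd: "A' z \<le> (\<Prod>k\<in>J'. BG k powr s)" for z
      unfolding A'_def using Gbd Gnn s by (intro prod_mono conjI powr_mono2) (auto simp: BG_def)
    have AA': "A z = A' z powr (1 - t)" for z
      unfolding A_def A'_def using st by (simp add: prod_powr_distrib powr_powr)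
    have "(\<integral>z. g i z powr t * A z \<partial>PiM J' M) \<le> (\<integral>z. g i z \<partial>PiM J' M) powr t * (\<integral>z. A' z \<partial>PiM J' M) powr (1 - t)"
      unfolding AA' using gB[OF i] A'nn A'bd t t1
      by (intro Holder_2 integrable_PiM_bounded[where B = "B0 i"] integrable_PiM_bounded[where B = "\<Prod>k\<in>J'. BG k powr s"]) auto
    also have "(\<integral>z. A' z \<partial>PiM J' M) \<le> (\<Prod>k\<in>J'. (\<integral>z. G k z \<partial>PiM (J' - {k}) M) powr s)"
      unfolding A'_def s_def n_def
    proof (rule less.hyps)
      show "bounded_fun (G j)" if "j \<in> J'" for j using Gbd[OF that] unfolding bounded_fun_def by blast
    qed (use n2 cJ n_def Gnn Gm in auto)
    then have "(\<integral>z. A' z \<partial>PiM J' M) powr (1 - t) \<le> (\<Prod>k\<in>J'. (\<integral>z. G k z \<partial>PiM (J' - {k}) M) powr s) powr (1 - t)"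
      using A'nn t1 by (intro powr_mono2) auto
    also have "\<dots> = (\<Prod>k\<in>J'. (\<integral>z. g k z \<partial>PiM (J - {k}) M) powr t)"
      using st Gint by (simp add: prod_powr_distrib powr_powr)
    finally show ?thesis by (simp add: mult_left_mono)
  qed
  also have "\<dots> = (\<Prod>j\<in>J. (\<integral>z. g j z \<partial>PiM (J - {j}) M) powr t)"
  proof -
    have "J - {i} = J'" by (simp add: J'_def)
    moreover have "(\<Prod>j\<in>J. h j) = h i * (\<Prod>j\<in>J'. h j)" for h :: "'i \<Rightarrow> real"
      unfolding J(1) using J(2) by simp
    ultimately show ?thesis by simp
  qed
  finally show ?case by (simp add: F_def t_def cJ)
qed

section \<open>Hardy-Littlewood-Sobolev on the line\<close>

text \<open>The half-lines on the two sides of x are moved to the positive one by a translation and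
  a reflection. The point y = x is counted twice, which the inequality absorbs.\<close>

lemma nn_integral_abs_diff_le:
  fixes h :: "real \<Rightarrow> ennreal"
  assumes [measurable]: "h \<in> borel_measurable borel"
  shows "(\<integral>\<^sup>+y. h \<bar>x - y\<bar> \<partial>lborel) \<le> 2 * (\<integral>\<^sup>+u. h u * indicator {0..} u \<partial>lborel)"
proof -
  have "(\<integral>\<^sup>+y. h \<bar>x - y\<bar> \<partial>lborel) \<le>
      (\<integral>\<^sup>+y. (h (y - x) * indicator {0..} (y - x)) + (h (x - y) * indicator {0..} (x - y)) \<partial>lborel)"
    by (intro nn_integral_mono) (auto simp: indicator_def abs_if)
  also have "\<dots> = (\<integral>\<^sup>+y. (h (y - x) * indicator {0..} (y - x)) \<partial>lborel)
      + (\<integral>\<^sup>+y. (h (x - y) * indicator {0..} (x - y)) \<partial>lborel)"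
    by (rule nn_integral_add) measurable
  also have "(\<integral>\<^sup>+y. (h (y - x) * indicator {0..} (y - x)) \<partial>lborel) = (\<integral>\<^sup>+u. h u * indicator {0..} u \<partial>lborel)"
    by (subst nn_integral_real_affine[where c = 1 and t = "-x" and f = "\<lambda>u. h u * indicator {0..} u"]) auto
  also have "(\<integral>\<^sup>+y. (h (x - y) * indicator {0..} (x - y)) \<partial>lborel) = (\<integral>\<^sup>+u. h u * indicator {0..} u \<partial>lborel)"
    by (subst nn_integral_real_affine[where c = "-1" and t = "x" and f = "\<lambda>u. h u * indicator {0..} u"]) auto
  finally show ?thesis by (simp add: mult_2)
qed

lemma nn_integral_near:
  fixes R a :: real
  assumes "0 < a" "a < 1" "R > 0"
  shows "(\<integral>\<^sup>+y. ennreal (\<bar>x - y\<bar> powr (-a)) * indicator {..<R} \<bar>x - y\<bar> \<partial>lborel)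
    \<le> ennreal (2 / (1 - a) * R powr (1 - a))"
proof -
  have "(\<integral>\<^sup>+y. ennreal (\<bar>x - y\<bar> powr (-a)) * indicator {..<R} \<bar>x - y\<bar> \<partial>lborel)
    \<le> 2 * (\<integral>\<^sup>+u. (ennreal (u powr (-a)) * indicator {..<R} u) * indicator {0..} u \<partial>lborel)"
    by (rule nn_integral_abs_diff_le) measurable
  also have "\<dots> \<le> 2 * (\<integral>\<^sup>+u. ennreal (u powr (-a)) * indicator {0..R} u \<partial>lborel)"
    by (intro mult_left_mono nn_integral_mono) (auto simp: indicator_def)
  also have "(\<integral>\<^sup>+u. ennreal (u powr (-a)) * indicator {0..R} u \<partial>lborel) = ennreal (R powr (-a+1) / (-a+1))"
    using assms by (intro nn_integral_has_integral_lebesgue' has_integral_powr_from_0) auto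
  also have "2 * \<dots> = ennreal (2 * (R powr (-a+1) / (-a+1)))"
    using assms by (subst ennreal_mult) auto
  finally show ?thesis by (simp add: add.commute)
qed

lemma nn_integral_far:
  fixes R :: real
  assumes "R > 0"
  shows "(\<integral>\<^sup>+y. ennreal (\<bar>x - y\<bar> powr (-2)) * indicator {R..} \<bar>x - y\<bar> \<partial>lborel) \<le> ennreal (2 / R)"
proof -
  have "(\<integral>\<^sup>+y. ennreal (\<bar>x - y\<bar> powr (-2)) * indicator {R..} \<bar>x - y\<bar> \<partial>lborel)
    \<le> 2 * (\<integral>\<^sup>+u. (ennreal (u powr (-2)) * indicator {R..} u) * indicator {0..} u \<partial>lborel)"
    by (rule nn_integral_abs_diff_le) measurable
  also have "\<dots> \<le> 2 * (\<integral>\<^sup>+u. ennreal (u powr (-2)) * indicator {R..} u \<partial>lborel)"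
    by (intro mult_left_mono nn_integral_mono) (auto simp: indicator_def)
  also have "(\<integral>\<^sup>+u. ennreal (u powr (-2)) * indicator {R..} u \<partial>lborel) = ennreal (-(R powr (-2+1)) / (-2+1))"
    using assms by (intro nn_integral_has_integral_lebesgue' has_integral_powr_to_inf) auto
  also have "2 * \<dots> = ennreal (2 * (-(R powr (-2+1)) / (-2+1)))"
    using assms by (subst ennreal_mult) auto
  finally show ?thesis using assms by (simp add: powr_minus_divide)
qed

lemma powr_mult_powr_le_add:
  fixes A B \<theta> :: real
  assumes "A \<ge> 0" "B \<ge> 0" "0 < \<theta>" "\<theta> < 1"
  shows "A powr \<theta> * B powr (1 - \<theta>) \<le> A + B"
proof -
  have "A powr \<theta> * B powr (1 - \<theta>) \<le> (A + B) powr \<theta> * (A + B) powr (1 - \<theta>)"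
    using assms by (intro mult_mono powr_mono2) auto
  also have "\<dots> = A + B" using assms by (simp add: powr_add[symmetric])
  finally show ?thesis .
qed

text \<open>Domination of integrals admits Lebesgue measure cut down to an interval, and still
  allows the potentials to be computed on the whole line.\<close>

locale dominated_by_lborel = finite_measure M for M :: "real measure" +
  assumes sets_eq [measurable_cong]: "sets M = sets borel"
    and nn_le: "\<And>h. h \<in> borel_measurable borel \<Longrightarrow> (\<integral>\<^sup>+x. h x \<partial>M) \<le> (\<integral>\<^sup>+x. h x \<partial>lborel)"
begin

lemma space_eq [simp]: "space M = UNIV"
  using sets_eq_imp_space_eq[OF sets_eq] by simp

text \<open>Only values of g up to the level t are integrated against the kernel. Near x the bound
  by t is used, far from x the normalisation of g in L^r with r = 2 / (2 - a). All contributions are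
  multiples of t powr (r - 1), the constant being 2 / (1 - a) from the near part and 1 + 2 from the
  far part.\<close>

lemma HLS_inner:
  fixes g :: "real \<Rightarrow> real"
  assumes a: "0 < a" "a < 1" and g [measurable]: "g \<in> borel_measurable borel" and gnn: "\<And>x. g x \<ge> 0"
    and N: "(\<integral>\<^sup>+x. ennreal (g x powr (2 / (2 - a))) \<partial>M) \<le> 1" and t: "t > 0"
  shows "(\<integral>\<^sup>+y. ennreal (g y * \<bar>x - y\<bar> powr (-a)) * indicator {..t} (g y) \<partial>M)
     \<le> ennreal ((2 / (1 - a) + 3) * t powr (2 / (2 - a) - 1))"
proof -
  define r where "r = 2 / (2 - a)"
  have r: "r > 1" using a by (simp add: r_def)
  \<comment> \<open>This radius balances the near part, of size t * R powr (1 - a), against the far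
    part, of size 1 / (t * R); both become t powr (r - 1).\<close>
  define R where "R = t powr (-r)"
  have R: "R > 0" using t by (simp add: R_def)
  have e1: "a * r / 2 = r - 1" using a by (simp add: r_def field_simps)
  have e2: "1 - 1 / r = a / 2" using a by (simp add: r_def field_simps)
  have pw: "ennreal (g y * \<bar>x - y\<bar> powr (-a)) * indicator {..t} (g y) \<le>
     ennreal t * (ennreal (\<bar>x - y\<bar> powr (-a)) * indicator {..<R} \<bar>x - y\<bar>)
     + (ennreal (t powr (r - 1)) * ennreal (g y powr r)
     + ennreal (1 / t) * (ennreal (\<bar>x - y\<bar> powr (-2)) * indicator {R..} \<bar>x - y\<bar>))" (is "?L \<le> ?R") for y
  proof (cases "g y \<le> t")
    case False then show ?thesis by simp
  next
    case gt: True
    show ?thesis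
    proof (cases "\<bar>x - y\<bar> < R")
      case True
      have "?L \<le> ennreal t * ennreal (\<bar>x - y\<bar> powr (-a))"
        using gt gnn[of y] by (simp add: ennreal_mult[symmetric] mult_right_mono ennreal_leI)
      also have "\<dots> \<le> ?R" using True by (simp add: indicator_def)
      finally show ?thesis .
    next
      case False
      define u where "u = \<bar>x - y\<bar>"
      have u: "u \<ge> R" "u > 0" using False R by (auto simp: u_def)
      \<comment> \<open>Far from x, the product g y * u powr (-a) is the geometric mean of
        \<open>A\<close> and \<open>B\<close> with weights 1 / r and 1 - 1 / r = a / 2: the powers
        of t cancel, and \<open>A\<close> and \<open>B\<close> are each integrable over the far
        region.\<close>
      define A where "A = t powr (r - 1) * g y powr r"
      define B where "B = 1 / t * u powr (-2)"
      have AB: "A \<ge> 0" "B \<ge> 0" using t by (auto simp: A_def B_def)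
      have "A powr (1/r) = t powr ((r - 1) / r) * g y"
        using r t gnn[of y] by (simp add: A_def powr_mult powr_powr)
      moreover have "(r - 1) / r = a / 2" using e2 r by (simp add: diff_divide_distrib)
      moreover have "B powr (1 - 1/r) = t powr (- (a / 2)) * u powr (-a)"
      proof -
        have "B = t powr (-1) * u powr (-2)" using t by (simp add: B_def powr_minus_divide)
        then have "B powr (a / 2) = (t powr (-1)) powr (a / 2) * (u powr (-2)) powr (a / 2)"
          by (simp only: powr_mult)
        then show ?thesis unfolding e2 powr_powr by simp
      qed
      ultimately have "A powr (1/r) * B powr (1 - 1/r) = g y * u powr (-a) * (t powr (a / 2) * t powr (- (a / 2)))"
        by (simp only: mult_ac)
      also have "t powr (a / 2) * t powr (- (a / 2)) = 1" using t by (simp add: powr_add[symmetric])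
      finally have "g y * u powr (-a) = A powr (1/r) * B powr (1 - 1/r)" by simp
      also have "\<dots> \<le> A + B" using AB r by (intro powr_mult_powr_le_add) auto
      finally have le: "g y * u powr (-a) \<le> A + B" .
      have "?L \<le> ennreal (A + B)" using gt le by (simp add: ennreal_leI u_def)
      also have "\<dots> = ennreal (t powr (r - 1)) * ennreal (g y powr r) + ennreal (1 / t) * ennreal (u powr (-2))"
        using AB t by (simp add: A_def B_def ennreal_mult[symmetric] ennreal_plus[symmetric] del: ennreal_plus)
      also have "\<dots> \<le> ?R" using u by (simp add: u_def indicator_def)
      finally show ?thesis .
    qed
  qed
  have "(\<integral>\<^sup>+y. ennreal (g y * \<bar>x - y\<bar> powr (-a)) * indicator {..t} (g y) \<partial>M) \<le>
     (\<integral>\<^sup>+y. ennreal t * (ennreal (\<bar>x - y\<bar> powr (-a)) * indicator {..<R} \<bar>x - y\<bar>)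
     + (ennreal (t powr (r - 1)) * ennreal (g y powr r)
     + ennreal (1 / t) * (ennreal (\<bar>x - y\<bar> powr (-2)) * indicator {R..} \<bar>x - y\<bar>)) \<partial>M)"
    by (intro nn_integral_mono pw)
  also have "\<dots> = ennreal t * (\<integral>\<^sup>+y. ennreal (\<bar>x - y\<bar> powr (-a)) * indicator {..<R} \<bar>x - y\<bar> \<partial>M)
     + (ennreal (t powr (r - 1)) * (\<integral>\<^sup>+y. ennreal (g y powr r) \<partial>M)
     + ennreal (1 / t) * (\<integral>\<^sup>+y. ennreal (\<bar>x - y\<bar> powr (-2)) * indicator {R..} \<bar>x - y\<bar> \<partial>M))"
    by (subst nn_integral_add, measurable)+ (subst nn_integral_cmult, measurable)+
  also have "\<dots> \<le> ennreal t * ennreal (2 / (1 - a) * R powr (1 - a))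
     + (ennreal (t powr (r - 1)) * 1 + ennreal (1 / t) * ennreal (2 / R))"
  proof (intro add_mono mult_left_mono)
    show "(\<integral>\<^sup>+y. ennreal (\<bar>x - y\<bar> powr (-a)) * indicator {..<R} \<bar>x - y\<bar> \<partial>M) \<le> ennreal (2 / (1 - a) * R powr (1 - a))"
      using a R by (intro order.trans[OF nn_le nn_integral_near]) auto
    show "(\<integral>\<^sup>+y. ennreal (\<bar>x - y\<bar> powr (-2)) * indicator {R..} \<bar>x - y\<bar> \<partial>M) \<le> ennreal (2 / R)"
      using R by (intro order.trans[OF nn_le nn_integral_far]) auto
  qed (use N in \<open>auto simp: r_def\<close>)
  also have "\<dots> = ennreal (t * (2 / (1 - a) * R powr (1 - a)) + (t powr (r - 1) + 1 / t * (2 / R)))"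
    using t R a by (simp add: ennreal_mult[symmetric] ennreal_plus[symmetric] del: ennreal_plus)
  also have "t * (2 / (1 - a) * R powr (1 - a)) + (t powr (r - 1) + 1 / t * (2 / R)) = (2 / (1 - a) + 3) * t powr (r - 1)"
  proof -
    have "t * R powr (1 - a) = t powr (1 + - r * (1 - a))"
      unfolding R_def powr_powr powr_add using t by simp
    also have "1 + - r * (1 - a) = r - 1" using a by (simp add: r_def field_simps)
    finally have 1: "t * R powr (1 - a) = t powr (r - 1)" .
    have 2: "1 / t * (1 / R) = t powr (r - 1)"
      using t by (simp add: R_def powr_minus powr_diff divide_simps)
    have "t * (2 / (1 - a) * R powr (1 - a)) + (t powr (r - 1) + 1 / t * (2 / R))
      = 2 / (1 - a) * (t * R powr (1 - a)) + (t powr (r - 1) + 2 * (1 / t * (1 / R)))" by simp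
    also have "\<dots> = (2 / (1 - a) + 3) * t powr (r - 1)" unfolding 1 2 by (simp add: distrib_right)
    finally show ?thesis .
  qed
  finally show ?thesis by (simp add: r_def)
qed

text \<open>By symmetry it is enough to integrate over g y \<le> g x, at the price of a factor 2.
  There \<open>HLS_inner\<close> with the level t = g x bounds the inner integral, and g x * g x
  powr (r - 1) = g x powr r has integral at most 1.\<close>

lemma HLS_nn:
  fixes g :: "real \<Rightarrow> real"
  assumes a: "0 < a" "a < 1" and g [measurable]: "g \<in> borel_measurable borel" and gnn: "\<And>x. g x \<ge> 0"
    and N: "(\<integral>\<^sup>+x. ennreal (g x powr (2 / (2 - a))) \<partial>M) \<le> 1"
  shows "(\<integral>\<^sup>+x. (\<integral>\<^sup>+y. ennreal (g x * g y * \<bar>x - y\<bar> powr (-a)) \<partial>M) \<partial>M) \<le> ennreal (2 * (2 / (1 - a) + 3))"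
proof -
  define r where "r = 2 / (2 - a)"
  define C where "C = 2 / (1 - a) + 3"
  have C: "C > 0" using a by (simp add: C_def add_pos_pos)
  define k where "k x y = (if g y \<le> g x then ennreal (g x * g y * \<bar>x - y\<bar> powr (-a)) else 0)" for x y
  have [measurable]: "(\<lambda>(x, y). k x y) \<in> borel_measurable (M \<Otimes>\<^sub>M M)" unfolding k_def by measurable
  have inner: "(\<integral>\<^sup>+y. k x y \<partial>M) \<le> ennreal C * ennreal (g x powr r)" for x
  proof (cases "g x = 0")
    case True
    then have "k x y = 0" for y by (simp add: k_def)
    then show ?thesis by simp
  next
    case False
    then have gx: "g x > 0" using gnn[of x] by simp
    have "(\<integral>\<^sup>+y. k x y \<partial>M) = ennreal (g x) * (\<integral>\<^sup>+y. ennreal (g y * \<bar>x - y\<bar> powr (-a)) * indicator {..g x} (g y) \<partial>M)"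
      by (subst nn_integral_cmult[symmetric]) (use gnn in \<open>auto simp: k_def ennreal_mult[symmetric] mult_ac indicator_def intro!: nn_integral_cong\<close>)
    also have "\<dots> \<le> ennreal (g x) * ennreal (C * g x powr (r - 1))"
      unfolding C_def r_def by (intro mult_left_mono HLS_inner a g gnn N gx) auto
    also have "\<dots> = ennreal C * ennreal (g x * g x powr (r - 1))"
      using gx C by (simp add: ennreal_mult[symmetric] mult_ac)
    also have "g x * g x powr (r - 1) = g x powr r" using gx by (simp add: powr_diff)
    finally show ?thesis .
  qed
  have half: "(\<integral>\<^sup>+x. (\<integral>\<^sup>+y. k x y \<partial>M) \<partial>M) \<le> ennreal C"
  proof -
    have "(\<integral>\<^sup>+x. (\<integral>\<^sup>+y. k x y \<partial>M) \<partial>M) \<le> (\<integral>\<^sup>+x. ennreal C * ennreal (g x powr r) \<partial>M)"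
      by (intro nn_integral_mono inner)
    also have "\<dots> = ennreal C * (\<integral>\<^sup>+x. ennreal (g x powr r) \<partial>M)" by (rule nn_integral_cmult) measurable
    also have "\<dots> \<le> ennreal C * 1" using N by (intro mult_left_mono) (auto simp: r_def)
    finally show ?thesis by simp
  qed
  interpret pair_sigma_finite M M ..
  have "(\<integral>\<^sup>+x. (\<integral>\<^sup>+y. ennreal (g x * g y * \<bar>x - y\<bar> powr (-a)) \<partial>M) \<partial>M) \<le> (\<integral>\<^sup>+x. (\<integral>\<^sup>+y. k x y + k y x \<partial>M) \<partial>M)"
    by (intro nn_integral_mono) (auto simp: k_def indicator_def abs_minus_commute mult_ac)
  also have "\<dots> = (\<integral>\<^sup>+x. (\<integral>\<^sup>+y. k x y \<partial>M) + (\<integral>\<^sup>+y. k y x \<partial>M) \<partial>M)"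
    by (intro nn_integral_cong nn_integral_add) measurable
  also have "\<dots> = (\<integral>\<^sup>+x. (\<integral>\<^sup>+y. k x y \<partial>M) \<partial>M) + (\<integral>\<^sup>+x. (\<integral>\<^sup>+y. k y x \<partial>M) \<partial>M)"
    by (rule nn_integral_add) measurable
  also have "(\<integral>\<^sup>+x. (\<integral>\<^sup>+y. k y x \<partial>M) \<partial>M) = (\<integral>\<^sup>+x. (\<integral>\<^sup>+y. k x y \<partial>M) \<partial>M)"
    by (subst Fubini') auto
  also have "(\<integral>\<^sup>+x. (\<integral>\<^sup>+y. k x y \<partial>M) \<partial>M) + (\<integral>\<^sup>+x. (\<integral>\<^sup>+y. k x y \<partial>M) \<partial>M) \<le> ennreal C + ennreal C"
    by (intro add_mono half)
  also have "\<dots> = ennreal (2 * C)" using C by (simp add: ennreal_plus[symmetric] del: ennreal_plus)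
  finally show ?thesis by (simp add: C_def)
qed

text \<open>The Riesz kernel is made part of a measure on pairs, so that the generalised Hoelder
  inequality can be applied with the kernel built in. The measure turns out to be finite, which
  again reduces integrability to boundedness. Since \<open>0 powr (-a) = 0\<close>, the density
  vanishes on the diagonal.\<close>

definition riesz :: "real \<Rightarrow> (real \<times> real) measure" where
  "riesz a = density (M \<Otimes>\<^sub>M M) (\<lambda>(x, y). ennreal (\<bar>x - y\<bar> powr (-a)))"

lemma sets_riesz [measurable_cong, simp]: "sets (riesz a) = sets (borel \<Otimes>\<^sub>M borel)"
  unfolding riesz_def by (simp cong: sets_pair_measure_cong add: sets_eq)

lemma nn_integral_riesz:
  assumes [measurable]: "h \<in> borel_measurable (borel \<Otimes>\<^sub>M borel)"
  shows "(\<integral>\<^sup>+p. h p \<partial>riesz a) = (\<integral>\<^sup>+x. (\<integral>\<^sup>+y. ennreal (\<bar>x - y\<bar> powr (-a)) * h (x, y) \<partial>M) \<partial>M)"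
proof -
  define F where "F p = ennreal (\<bar>fst p - snd p\<bar> powr (-a)) * h p" for p
  have "(\<integral>\<^sup>+p. h p \<partial>riesz a) = (\<integral>\<^sup>+p. F p \<partial>(M \<Otimes>\<^sub>M M))"
    unfolding riesz_def F_def by (subst nn_integral_density) (auto simp: case_prod_beta')
  also have "\<dots> = (\<integral>\<^sup>+x. (\<integral>\<^sup>+y. F (x, y) \<partial>M) \<partial>M)"
  proof -
    have "F \<in> borel_measurable (M \<Otimes>\<^sub>M M)" unfolding F_def by measurable
    from nn_integral_fst[OF this] show ?thesis by simp
  qed
  finally show ?thesis by (simp add: F_def)
qed

text \<open>Homogeneity reduces this to the normalised case: with r = 2 / (2 - a) and N the integral
  of g powr r, dividing g by N powr (1 / r) costs a factor N powr (2 / r), and 2 / r = 2 - a. For N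
  = 0 the function vanishes almost everywhere.\<close>

lemma HLS:
  fixes g :: "real \<Rightarrow> real"
  assumes a: "0 < a" "a < 1" and g [measurable]: "g \<in> borel_measurable borel"
    and gnn: "\<And>x. 0 \<le> g x" and gB: "\<And>x. g x \<le> B"
  shows "(\<integral>\<^sup>+p. ennreal (g (fst p) * g (snd p)) \<partial>riesz a)
    \<le> ennreal (2 * (2 / (1 - a) + 3) * (\<integral>x. g x powr (2 / (2 - a)) \<partial>M) powr (2 - a))"
proof -
  define r where "r = 2 / (2 - a)"
  have r: "r > 1" using a by (simp add: r_def)
  define N where "N = (\<integral>x. g x powr r \<partial>M)"
  have int: "integrable M (\<lambda>x. g x powr r)"
    using gnn gB r by (intro integrable_const_bound[of _ "B powr r"]) (auto intro!: AE_I2 powr_mono2)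
  have Nnn: "N \<ge> 0" unfolding N_def by auto
  have lhs: "(\<integral>\<^sup>+p. ennreal (g (fst p) * g (snd p)) \<partial>riesz a) =
     (\<integral>\<^sup>+x. (\<integral>\<^sup>+y. ennreal (g x * g y * \<bar>x - y\<bar> powr (-a)) \<partial>M) \<partial>M)"
    using gnn by (subst nn_integral_riesz) (auto simp: ennreal_mult[symmetric] mult_ac)
  show ?thesis
  proof (cases "N = 0")
    case True
    then have "AE x in M. g x powr r = 0"
      unfolding N_def using integral_nonneg_eq_0_iff_AE[OF int] by auto
    then have ae: "AE x in M. g x = 0" by eventually_elim auto
    have "(\<integral>\<^sup>+x. (\<integral>\<^sup>+y. ennreal (g x * g y * \<bar>x - y\<bar> powr (-a)) \<partial>M) \<partial>M) = (\<integral>\<^sup>+x. 0 \<partial>M)"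
      by (intro nn_integral_cong_AE) (use ae in \<open>eventually_elim, simp\<close>)
    then show ?thesis unfolding lhs by simp
  next
    case False
    then have N: "N > 0" using Nnn by simp
    define c where "c = N powr (1 / r)"
    have c: "c > 0" using N by (simp add: c_def)
    have cr: "c powr r = N" using N r by (simp add: c_def powr_powr)
    have c2: "c * c = N powr (2 - a)"
    proof -
      have "c * c = N powr (1 / r + 1 / r)" unfolding c_def by (simp only: powr_add)
      also have "1 / r + 1 / r = 2 - a" using a by (simp add: r_def field_simps)
      finally show ?thesis .
    qed
    define g' where "g' x = g x / c" for x
    have [measurable]: "g' \<in> borel_measurable borel" unfolding g'_def by measurable
    have g'nn: "g' x \<ge> 0" for x using gnn c by (simp add: g'_def)
    have "(\<integral>\<^sup>+x. ennreal (g' x powr r) \<partial>M) = ennreal (\<integral>x. g' x powr r \<partial>M)"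
      using int c gnn Nnn by (intro nn_integral_eq_integral) (auto simp: g'_def powr_divide cr)
    also have "(\<integral>x. g' x powr r \<partial>M) = 1"
      using c gnn N by (simp add: g'_def powr_divide cr N_def[symmetric])
    finally have "(\<integral>\<^sup>+x. (\<integral>\<^sup>+y. ennreal (g' x * g' y * \<bar>x - y\<bar> powr (-a)) \<partial>M) \<partial>M) \<le> ennreal (2 * (2 / (1 - a) + 3))"
      using a g'nn by (intro HLS_nn) (auto simp: r_def)
    moreover have "(\<integral>\<^sup>+x. (\<integral>\<^sup>+y. ennreal (g x * g y * \<bar>x - y\<bar> powr (-a)) \<partial>M) \<partial>M) =
       ennreal (c * c) * (\<integral>\<^sup>+x. (\<integral>\<^sup>+y. ennreal (g' x * g' y * \<bar>x - y\<bar> powr (-a)) \<partial>M) \<partial>M)"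
    proof -
      have "(\<integral>\<^sup>+y. ennreal (g x * g y * \<bar>x - y\<bar> powr (-a)) \<partial>M) = ennreal (c * c) * (\<integral>\<^sup>+y. ennreal (g' x * g' y * \<bar>x - y\<bar> powr (-a)) \<partial>M)" for x
        using c by (subst nn_integral_cmult[symmetric])
          (auto simp: g'_def ennreal_mult''[symmetric] field_simps gnn ennreal_mult'[symmetric] intro!: nn_integral_cong)
      then show ?thesis by (simp add: nn_integral_cmult)
    qed
    ultimately have "(\<integral>\<^sup>+x. (\<integral>\<^sup>+y. ennreal (g x * g y * \<bar>x - y\<bar> powr (-a)) \<partial>M) \<partial>M)
      \<le> ennreal (c * c) * ennreal (2 * (2 / (1 - a) + 3))"
      by (simp add: mult_left_mono)
    also have "\<dots> = ennreal (2 * (2 / (1 - a) + 3) * N powr (2 - a))"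
      using a c by (subst ennreal_mult[symmetric]) (auto simp: c2 mult_ac)
    finally show ?thesis unfolding lhs N_def r_def .
  qed
qed

lemma finite_riesz:
  assumes "0 < a" "a < 1"
  shows "finite_measure (riesz a)"
proof
  have "emeasure (riesz a) (space (riesz a)) = (\<integral>\<^sup>+p. ennreal (1 * 1) \<partial>riesz a)"
    by simp
  also have "\<dots> \<le> ennreal (2 * (2 / (1 - a) + 3) * (\<integral>x. 1 powr (2 / (2 - a)) \<partial>M) powr (2 - a))"
    using HLS[of a "\<lambda>_. 1" 1] assms by simp
  also have "\<dots> < \<infinity>" by simp
  finally show "emeasure (riesz a) (space (riesz a)) \<noteq> \<infinity>" by simp
qed

text \<open>The bound 1 within distance 1/\<eta> of x and the inverse square beyond it contribute
  2/\<eta> each. This takes the place of \<open>HLS\<close> when only two variables are left, where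
  the exponent would be a = 1.\<close>

lemma nn_integral_decay:
  assumes "\<eta> > 0"
  shows "(\<integral>\<^sup>+y. ennreal (min 1 (1 / (\<eta> * \<bar>x - y\<bar>)\<^sup>2)) \<partial>M) \<le> ennreal (4 / \<eta>)"
proof -
  have "(\<integral>\<^sup>+y. ennreal (min 1 (1 / (\<eta> * \<bar>x - y\<bar>)\<^sup>2)) \<partial>M) \<le> (\<integral>\<^sup>+y. ennreal (min 1 (1 / (\<eta> * \<bar>x - y\<bar>)\<^sup>2)) \<partial>lborel)"
    by (rule nn_le) measurable
  also have "\<dots> \<le> (\<integral>\<^sup>+y. indicator {x - 1/\<eta>..x + 1/\<eta>} y
     + ennreal (1 / \<eta>\<^sup>2) * (ennreal (\<bar>x - y\<bar> powr (-2)) * indicator {1/\<eta>..} \<bar>x - y\<bar>) \<partial>lborel)"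
  proof (rule nn_integral_mono)
    fix y
    show "ennreal (min 1 (1 / (\<eta> * \<bar>x - y\<bar>)\<^sup>2)) \<le> indicator {x - 1/\<eta>..x + 1/\<eta>} y
     + ennreal (1 / \<eta>\<^sup>2) * (ennreal (\<bar>x - y\<bar> powr (-2)) * indicator {1/\<eta>..} \<bar>x - y\<bar>)"
    proof (cases "\<bar>x - y\<bar> \<le> 1/\<eta>")
      case True
      then have "indicator {x - 1/\<eta>..x + 1/\<eta>} y = (1::ennreal)" by (auto simp: indicator_def)
      moreover have "ennreal (min 1 (1 / (\<eta> * \<bar>x - y\<bar>)\<^sup>2)) \<le> 1" by (auto simp: min_def intro: ennreal_leI)
      ultimately show ?thesis by (simp add: add_increasing2)
    next
      case False
      then have p: "\<bar>x - y\<bar> > 0" "\<bar>x - y\<bar> \<ge> 1/\<eta>" using assms by (auto intro: less_trans[rotated])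
      have "1 / (\<eta> * \<bar>x - y\<bar>)\<^sup>2 = 1 / \<eta>\<^sup>2 * \<bar>x - y\<bar> powr (-2)"
        using p(1) by (simp add: power_mult_distrib powr_minus powr_realpow[symmetric] divide_inverse)
      then have "ennreal (min 1 (1 / (\<eta> * \<bar>x - y\<bar>)\<^sup>2)) \<le> ennreal (1 / \<eta>\<^sup>2 * \<bar>x - y\<bar> powr (-2))"
        by (intro ennreal_leI) auto
      also have "\<dots> = ennreal (1 / \<eta>\<^sup>2) * ennreal (\<bar>x - y\<bar> powr (-2))" by (rule ennreal_mult) auto
      finally show ?thesis using p by (simp add: add_increasing)
    qed
  qed
  also have "\<dots> = (\<integral>\<^sup>+y. indicator {x - 1/\<eta>..x + 1/\<eta>} y \<partial>lborel)
     + ennreal (1 / \<eta>\<^sup>2) * (\<integral>\<^sup>+y. ennreal (\<bar>x - y\<bar> powr (-2)) * indicator {1/\<eta>..} \<bar>x - y\<bar> \<partial>lborel)"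
    by (subst nn_integral_add, measurable) (subst nn_integral_cmult, measurable)
  also have "\<dots> \<le> ennreal (2 / \<eta>) + ennreal (1 / \<eta>\<^sup>2) * ennreal (2 / (1/\<eta>))"
    using assms by (intro add_mono mult_left_mono nn_integral_far) auto
  also have "\<dots> = ennreal (4 / \<eta>)"
    using assms by (simp add: ennreal_mult[symmetric] ennreal_plus[symmetric] power2_eq_square del: ennreal_plus)
  finally show ?thesis .
qed

end

section \<open>The multilinear estimate\<close>

text \<open>A function that is not integrable has Bochner integral 0, so no integrability has to be
  known before an estimate by a possibly infinite integral is made.\<close>

lemma ennreal_norm_integral_le:
  fixes f :: "'a \<Rightarrow> 'b::{banach, second_countable_topology}"
  shows "ennreal (norm (integral\<^sup>L M f)) \<le> (\<integral>\<^sup>+x. ennreal (norm (f x)) \<partial>M)"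
proof (cases "integrable M f")
  case True then show ?thesis by (rule integral_norm_bound_ennreal)
next
  case False then show ?thesis by (simp add: not_integrable_integral_eq)
qed

lemma borel_measurable_cnj [measurable]: "cnj \<in> borel_measurable borel"
  by (intro borel_measurable_continuous_onI continuous_intros)

lemma measurable_case_prod_compose:
  assumes "(\<lambda>(v, x). g v x) \<in> borel_measurable (N \<Otimes>\<^sub>M M)" "f \<in> K \<rightarrow>\<^sub>M N" "h \<in> K \<rightarrow>\<^sub>M M"
  shows "(\<lambda>z. g (f z) (h z)) \<in> borel_measurable K"
  using measurable_compose[OF measurable_Pair[OF assms(2,3)] assms(1)] by simp

text \<open>The squared modulus is a double integral of H against its conjugate; two applications of
  Fubini move the integration over z to the innermost place.\<close>

lemma norm_sq_integral:
  fixes H :: "'b \<Rightarrow> 'c \<Rightarrow> complex"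
  assumes N: "finite_measure N" and M: "finite_measure M"
    and Hm: "(\<lambda>(z, x). H z x) \<in> borel_measurable (N \<Otimes>\<^sub>M M)"
    and HB: "\<And>z x. norm (H z x) \<le> B"
  shows "of_real (\<integral>z. (norm (\<integral>x. H z x \<partial>M))\<^sup>2 \<partial>N) = (\<integral>x. (\<integral>y. (\<integral>z. H z x * cnj (H z y) \<partial>N) \<partial>M) \<partial>M)"
proof -
  interpret N: finite_measure N by fact
  interpret M: finite_measure M by fact
  interpret NM: pair_sigma_finite N M ..
  interpret NxM: finite_measure "N \<Otimes>\<^sub>M M" by (rule finite_measure_pair_measure[OF M N])
  note HK [measurable (raw)] = measurable_case_prod_compose[OF Hm]
  have B0: "0 \<le> B" using HB[of undefined undefined] norm_ge_zero order_trans by blast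
  have HHB: "norm (H z x * cnj (H z y)) \<le> B * B" for x y z
    unfolding norm_mult complex_mod_cnj using HB B0 by (intro mult_mono) auto
  have "of_real ((norm (\<integral>x. H z x \<partial>M))\<^sup>2) = (\<integral>x. (\<integral>y. H z x * cnj (H z y) \<partial>M) \<partial>M)" for z
  proof -
    have "(\<integral>x. (\<integral>y. H z x * cnj (H z y) \<partial>M) \<partial>M) = (\<integral>x. H z x * cnj (\<integral>y. H z y \<partial>M) \<partial>M)"
    proof -
      have "(\<integral>y. cnj (H z y) \<partial>M) = cnj (\<integral>y. H z y \<partial>M)" by (simp add: integral_cnj[symmetric])
      then show ?thesis by (simp only: integral_mult_right_zero)
    qed
    also have "\<dots> = (\<integral>x. H z x \<partial>M) * cnj (\<integral>y. H z y \<partial>M)" by (rule integral_mult_left_zero)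
    finally show ?thesis by (simp only: complex_norm_square)
  qed
  then have "of_real (\<integral>z. (norm (\<integral>x. H z x \<partial>M))\<^sup>2 \<partial>N) = (\<integral>z. (\<integral>x. (\<integral>y. H z x * cnj (H z y) \<partial>M) \<partial>M) \<partial>N)"
    by (subst integral_complex_of_real[symmetric]) simp
  also have "\<dots> = (\<integral>x. (\<integral>z. (\<integral>y. H z x * cnj (H z y) \<partial>M) \<partial>N) \<partial>M)"
  proof (rule NM.Fubini_integral[symmetric])
    have m: "(\<lambda>(z, x). \<integral>y. H z x * cnj (H z y) \<partial>M) \<in> borel_measurable (N \<Otimes>\<^sub>M M)" by measurable
    have b: "norm (\<integral>y. H z x * cnj (H z y) \<partial>M) \<le> B * B * measure M (space M)" for z x
    proof -
      have "ennreal (norm (\<integral>y. H z x * cnj (H z y) \<partial>M)) \<le> (\<integral>\<^sup>+y. ennreal (B * B) \<partial>M)"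
        by (rule order.trans[OF ennreal_norm_integral_le]) (intro nn_integral_mono ennreal_leI HHB)
      also have "\<dots> = ennreal (B * B * measure M (space M))"
        using B0 by (simp add: M.emeasure_eq_measure ennreal_mult)
      finally show ?thesis using B0 by (simp add: ennreal_le_iff)
    qed
    show "integrable (N \<Otimes>\<^sub>M M) (\<lambda>(z, x). \<integral>y. H z x * cnj (H z y) \<partial>M)"
      using m b by (intro NxM.integrable_const_bound[where B = "B * B * measure M (space M)"]) auto
  qed
  also have "\<dots> = (\<integral>x. (\<integral>y. (\<integral>z. H z x * cnj (H z y) \<partial>N) \<partial>M) \<partial>M)"
  proof (rule Bochner_Integration.integral_cong[OF refl], rule NM.Fubini_integral[symmetric])
    fix x assume [measurable]: "x \<in> space M"
    have m: "(\<lambda>(z, y). H z x * cnj (H z y)) \<in> borel_measurable (N \<Otimes>\<^sub>M M)" by measurable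
    show "integrable (N \<Otimes>\<^sub>M M) (\<lambda>(z, y). H z x * cnj (H z y))"
      using m HHB by (intro NxM.integrable_const_bound[where B = "B * B"]) auto
  qed
  finally show ?thesis .
qed

text \<open>\<open>u\<close> collects what is independent of the variable x to be removed,
  \<open>H\<close> the rest. The second factor is left as an iterated integral with z innermost,
  because for fixed x and y the inner integral is again a form of the same kind in one variable
  less.\<close>

lemma Cauchy_Schwarz_expand:
  fixes H :: "'b \<Rightarrow> 'c \<Rightarrow> complex" and u :: "'b \<Rightarrow> complex" and w :: "'b \<Rightarrow> real"
  assumes N: "finite_measure N" and M: "finite_measure M"
    and Hm: "(\<lambda>(z, x). H z x) \<in> borel_measurable (N \<Otimes>\<^sub>M M)"
    and HB: "\<And>z x. norm (H z x) \<le> B"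
    and um: "u \<in> borel_measurable N" and uw: "\<And>z. norm (u z) \<le> w z"
    and wm: "w \<in> borel_measurable N" and wB: "\<And>z. w z \<le> L"
  shows "(norm (\<integral>z. u z * (\<integral>x. H z x \<partial>M) \<partial>N))\<^sup>2
    \<le> (\<integral>z. (w z)\<^sup>2 \<partial>N) * norm (\<integral>x. (\<integral>y. (\<integral>z. H z x * cnj (H z y) \<partial>N) \<partial>M) \<partial>M)"
proof -
  interpret N: finite_measure N by fact
  interpret M: finite_measure M by fact
  note HK [measurable (raw)] = measurable_case_prod_compose[OF Hm]
  note um [measurable] wm [measurable]
  have B0: "0 \<le> B" using HB[of undefined undefined] norm_ge_zero order_trans by blast
  have w0: "0 \<le> w z" for z using uw[of z] norm_ge_zero[of "u z"] by linarith
  define T where "T z = (\<integral>x. H z x \<partial>M)" for z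
  have [measurable]: "T \<in> borel_measurable N" unfolding T_def by measurable
  have TB: "norm (T z) \<le> B * measure M (space M)" for z
  proof -
    have "ennreal (norm (T z)) \<le> (\<integral>\<^sup>+y. ennreal B \<partial>M)"
      unfolding T_def by (rule order.trans[OF ennreal_norm_integral_le]) (intro nn_integral_mono ennreal_leI HB)
    also have "\<dots> = ennreal (B * measure M (space M))"
      using B0 by (simp add: M.emeasure_eq_measure ennreal_mult)
    finally show ?thesis using B0 by (simp add: ennreal_le_iff)
  qed
  have i1: "integrable N (\<lambda>z. (w z)\<^sup>2)"
    using w0 wB by (intro N.integrable_const_bound[where B = "L\<^sup>2"]) (auto intro!: AE_I2 power_mono)
  have i2: "integrable N (\<lambda>z. (norm (T z))\<^sup>2)"
    using TB by (intro N.integrable_const_bound[where B = "(B * measure M (space M))\<^sup>2"]) (auto intro!: AE_I2 power_mono)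
  have sq: "((x::real)\<^sup>2) powr (1/2) = x" if "x \<ge> 0" for x using that by (simp add: powr_half_sqrt)
  note H2 = Holder_2[of "1/2" N "\<lambda>z. (w z)\<^sup>2" "\<lambda>z. (norm (T z))\<^sup>2", OF _ _ i1 i2]
  have e: "1 - 1/2 = (1/2::real)" by simp
  have "norm (\<integral>z. u z * T z \<partial>N) \<le> (\<integral>z. ((w z)\<^sup>2) powr (1/2) * ((norm (T z))\<^sup>2) powr (1/2) \<partial>N)"
  proof (rule order.trans[OF integral_norm_bound integral_mono])
    have LT: "norm (u z * T z) \<le> L * (B * measure M (space M))" for z
      unfolding norm_mult using uw[of z] wB[of z] w0[of z] TB by (intro mult_mono) auto
    show "integrable N (\<lambda>z. norm (u z * T z))"
      using LT by (intro N.integrable_const_bound[where B = "L * (B * measure M (space M))"]) auto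
    show "integrable N (\<lambda>z. ((w z)\<^sup>2) powr (1/2) * ((norm (T z))\<^sup>2) powr (1/2))"
      using H2(1) by (simp only: e) auto
    show "norm (u z * T z) \<le> ((w z)\<^sup>2) powr (1/2) * ((norm (T z))\<^sup>2) powr (1/2)" for z
      using uw w0 by (simp add: sq norm_mult mult_right_mono)
  qed
  also have "\<dots> \<le> (\<integral>z. (w z)\<^sup>2 \<partial>N) powr (1/2) * (\<integral>z. (norm (T z))\<^sup>2 \<partial>N) powr (1/2)"
    using H2(2) by (simp only: e) auto
  finally have "(norm (\<integral>z. u z * T z \<partial>N))\<^sup>2 \<le> ((\<integral>z. (w z)\<^sup>2 \<partial>N) powr (1/2) * (\<integral>z. (norm (T z))\<^sup>2 \<partial>N) powr (1/2))\<^sup>2"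
    by (intro power_mono) auto
  also have "\<dots> = (\<integral>z. (w z)\<^sup>2 \<partial>N) * (\<integral>z. (norm (T z))\<^sup>2 \<partial>N)"
    by (simp add: power_mult_distrib powr_half_sqrt)
  also have "(\<integral>z. (norm (T z))\<^sup>2 \<partial>N) = norm (complex_of_real (\<integral>z. (norm (T z))\<^sup>2 \<partial>N))" by simp
  also have "complex_of_real (\<integral>z. (norm (T z))\<^sup>2 \<partial>N) = (\<integral>x. (\<integral>y. (\<integral>z. H z x * cnj (H z y) \<partial>N) \<partial>M) \<partial>M)"
    unfolding T_def by (rule norm_sq_integral[OF N M Hm HB])
  finally show ?thesis by (simp add: T_def)
qed

text \<open>Hoelder with exponents 1/Q and 1 - 1/Q, after splitting h as \<open>(h powr Q * \<rho>
  powr (1 - Q)) powr (1 / Q) * \<rho> powr (1 - 1 / Q)\<close>. The lower bound on \<rho> keeps the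
  power \<open>1 - Q\<close> bounded.\<close>

lemma weighted_Jensen:
  fixes h \<rho> :: "'a \<Rightarrow> real"
  assumes N: "finite_measure N" and Q: "Q \<ge> 1"
    and h [measurable]: "h \<in> borel_measurable N" and hb: "\<And>v. 0 \<le> h v" "\<And>v. h v \<le> L"
    and \<rho> [measurable]: "\<rho> \<in> borel_measurable N" and \<rho>b: "\<And>v. \<epsilon> \<le> \<rho> v" "\<And>v. \<rho> v \<le> L'" "\<epsilon> > 0"
  shows "(\<integral>v. h v \<partial>N) powr Q \<le> (\<integral>v. h v powr Q * \<rho> v powr (1 - Q) \<partial>N) * (\<integral>v. \<rho> v \<partial>N) powr (Q - 1)"
proof -
  interpret N: finite_measure N by fact
  have \<rho>pos: "\<rho> v > 0" for v using \<rho>b(1)[of v] \<rho>b(3) by linarith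
  show ?thesis
  \<comment> \<open>Since \<open>0 powr 0 = 0\<close>, the right-hand side vanishes for Q = 1 if the
    integral of \<rho> does; positivity of \<rho> then forces the integral of h to vanish as
    well.\<close>
  proof (cases "Q = 1")
    case True
    have "(\<integral>v. h v \<partial>N) \<ge> 0" using hb by auto
    moreover have "(\<integral>v. \<rho> v \<partial>N) \<ge> 0" using \<rho>pos by (intro integral_nonneg_AE) (auto simp: less_imp_le)
    moreover have "(\<integral>v. h v \<partial>N) = 0" if "(\<integral>v. \<rho> v \<partial>N) = 0"
    proof -
      have "integrable N \<rho>"
        using \<rho>b(2) \<rho>pos by (intro N.integrable_const_bound[where B = L']) (auto simp: less_imp_le)
      then have "AE v in N. \<rho> v = 0"
        using that \<rho>pos by (subst integral_nonneg_eq_0_iff_AE[symmetric]) (auto simp: less_imp_le)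
      then have "AE v in N. h v = 0"
        using \<rho>pos by (auto elim!: eventually_mono simp: less_imp_neq[symmetric])
      then show ?thesis by (rule integral_eq_zero_AE)
    qed
    ultimately show ?thesis using True hb \<rho>pos by (cases "(\<integral>v. \<rho> v \<partial>N) = 0") (auto simp: less_imp_neq[symmetric])
  next
    case False
    then have Q1: "Q > 1" using Q by simp
    define f where "f v = h v powr Q * \<rho> v powr (1 - Q)" for v
    have fb: "f v \<le> L powr Q * \<epsilon> powr (1 - Q)" for v
      unfolding f_def using hb \<rho>b Q1 by (intro mult_mono powr_mono2 powr_mono2') auto
    have f0: "f v \<ge> 0" for v by (simp add: f_def)
    have if': "integrable N f"
    proof (rule N.integrable_const_bound[where B = "L powr Q * \<epsilon> powr (1 - Q)"])
      show "f \<in> borel_measurable N" unfolding f_def by measurable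
    qed (use fb f0 in auto)
    have ir: "integrable N \<rho>"
      using \<rho>b(2) \<rho>pos by (intro N.integrable_const_bound[where B = L']) (auto simp: less_imp_le)
    have eq: "f v powr (1 / Q) * \<rho> v powr (1 - 1 / Q) = h v" for v
    proof -
      have "f v powr (1 / Q) * \<rho> v powr (1 - 1 / Q) = h v * (\<rho> v powr ((1 - Q) * (1 / Q)) * \<rho> v powr (1 - 1 / Q))"
        using Q1 hb(1)[of v] by (simp add: f_def powr_mult powr_powr)
      also have "\<rho> v powr ((1 - Q) * (1 / Q)) * \<rho> v powr (1 - 1 / Q) = \<rho> v powr ((1 - Q) * (1 / Q) + (1 - 1 / Q))"
        by (simp only: powr_add)
      also have "(1 - Q) * (1 / Q) + (1 - 1 / Q) = 0" using Q1 by (simp add: field_simps)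
      finally show ?thesis using \<rho>pos[of v] by simp
    qed
    have "(\<integral>v. h v \<partial>N) \<le> (\<integral>v. f v \<partial>N) powr (1 / Q) * (\<integral>v. \<rho> v \<partial>N) powr (1 - 1 / Q)"
      using Holder_2(2)[of "1 / Q" N f \<rho>] Q1 if' ir f0 \<rho>pos by (simp add: eq less_imp_le)
    then have "(\<integral>v. h v \<partial>N) powr Q \<le> ((\<integral>v. f v \<partial>N) powr (1 / Q) * (\<integral>v. \<rho> v \<partial>N) powr (1 - 1 / Q)) powr Q"
      using hb Q1 by (intro powr_mono2) auto
    also have "\<dots> = (\<integral>v. f v \<partial>N) * (\<integral>v. \<rho> v \<partial>N) powr ((1 - 1 / Q) * Q)"
      using Q1 f0 by (simp add: powr_mult powr_powr)
    also have "(1 - 1 / Q) * Q = Q - 1" using Q1 by (simp add: field_simps)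
    finally show ?thesis by (simp add: f_def)
  qed
qed

text \<open>A power is monotone in its base, in a direction that depends on the sign of the
  exponent. The sum of both end values spares a discussion of that sign.\<close>

lemma powr_le_endpoints:
  fixes m M x s :: real
  assumes "0 < m" "m \<le> x" "x \<le> M"
  shows "x powr s \<le> m powr s + M powr s"
proof (cases "s \<ge> 0")
  case True
  then have "x powr s \<le> M powr s" using assms by (intro powr_mono2) auto
  then show ?thesis by (simp add: add_increasing)
next
  case False
  then have "x powr s \<le> m powr s" using assms by (intro powr_mono2') auto
  then show ?thesis by (simp add: add_increasing2)
qed

text \<open>The form in which the Hardy-Littlewood-Sobolev inequality enters the induction: Jensen's inequality
  with weight \<open>\<rho>\<close> moves the integration over \<open>v\<close> outside, and the exponent of \<open>\<rho>\<close> is chosen such that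
  only \<open>\<integral>\<rho>\<close> survives.\<close>
lemma (in dominated_by_lborel) pair_bound:
  fixes g :: "'b \<Rightarrow> real \<Rightarrow> real" and n P q a :: real
  assumes N: "finite_measure N"
    and gm: "(\<lambda>(v, x). g v x) \<in> borel_measurable (N \<Otimes>\<^sub>M M)"
    and gb: "\<And>v x. \<epsilon> \<le> g v x" "\<And>v x. g v x \<le> L" "\<epsilon> > 0"
    and pos: "measure M UNIV > 0"
    and a: "0 < a" "a < 1" and n: "n > 0" and P: "P = n * 2 / (2 - a)" and q: "q > 0" "n / q \<ge> 1"
    and \<rho>: "\<And>v. \<rho> v = (\<integral>x. g v x powr P \<partial>M)"
    and A: "\<And>p. A p = (\<integral>v. (g v (fst p) * g v (snd p) * \<rho> v powr (- (2 / P - 1 / q))) powr q \<partial>N)"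
  shows "A \<in> borel_measurable (borel \<Otimes>\<^sub>M borel)"
    and "\<exists>B. \<forall>p. 0 \<le> A p \<and> A p \<le> B"
    and "(\<integral>p. A p powr (n / q) \<partial>riesz a) \<le> 2 * (2 / (1 - a) + 3) * (\<integral>v. \<rho> v \<partial>N) powr (n / q)"
proof -
  interpret N: finite_measure N by fact
  interpret R: finite_measure "riesz a" using a by (rule finite_riesz)
  interpret RN: pair_sigma_finite "riesz a" N ..
  note gK [measurable (raw)] = measurable_case_prod_compose[OF gm]
  define Q where "Q = n / q"
  define \<kappa> where "\<kappa> = 2 / P - 1 / q"
  define H where "H = 2 * (2 / (1 - a) + 3)"
  have H: "H > 0" using a by (simp add: H_def add_pos_pos)
  have P0: "P > 0" using a n P by simp
  have gpos: "g v x > 0" for v x using gb(1)[of v x] gb(3) by linarith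
  have L: "L > 0" using gpos[of undefined undefined] gb(2)[of undefined undefined] by linarith
  define \<rho>0 where "\<rho>0 = \<epsilon> powr P * measure M UNIV"
  define \<rho>1 where "\<rho>1 = L powr P * measure M UNIV"
  have \<rho>m [measurable]: "\<rho> \<in> borel_measurable N" unfolding \<rho> by measurable
  have \<rho>0: "\<rho>0 > 0" using pos gb by (simp add: \<rho>0_def)
  have gint: "integrable M (\<lambda>x. g v x powr P)" if [measurable]: "v \<in> space N" for v
    using gpos gb P0 by (intro integrable_const_bound[where B = "L powr P"]) (auto intro!: AE_I2 powr_mono2 simp: less_imp_le)
  have \<rho>b': "\<rho>0 \<le> \<rho> v" "\<rho> v \<le> \<rho>1" if v: "v \<in> space N" for v
  proof -
    have "(\<integral>x. \<epsilon> powr P \<partial>M) \<le> \<rho> v" unfolding \<rho>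
      using gint[OF v] gb P0 by (intro integral_mono) (auto intro!: powr_mono2)
    then show "\<rho>0 \<le> \<rho> v" by (simp add: \<rho>0_def mult.commute)
    have "\<rho> v \<le> (\<integral>x. L powr P \<partial>M)" unfolding \<rho>
      using gint[OF v] gb P0 gpos by (intro integral_mono) (auto intro!: powr_mono2 simp: less_imp_le)
    then show "\<rho> v \<le> \<rho>1" by (simp add: \<rho>1_def mult.commute)
  qed
  \<comment> \<open>outside \<open>space N\<close> the Bochner integral defining \<open>\<rho>\<close> may be junk, so clamp it\<close>
  define r where "r v = max \<rho>0 (min \<rho>1 (\<rho> v))" for v
  have rm [measurable]: "r \<in> borel_measurable N" unfolding r_def by measurable
  have \<rho>01: "\<rho>0 \<le> \<rho>1" using gb L gpos P0 pos unfolding \<rho>0_def \<rho>1_def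
    by (intro mult_right_mono powr_mono2 order.trans[OF gb(1) gb(2)]) auto
  have rb: "\<rho>0 \<le> r v" "r v \<le> \<rho>1" for v using \<rho>01 by (auto simp: r_def)
  have r_eq: "r v = \<rho> v" if "v \<in> space N" for v using \<rho>b'[OF that] by (simp add: r_def)
  have rpos: "r v > 0" for v using rb(1)[of v] \<rho>0 by linarith
  define G where "G p v = g v (fst p) * g v (snd p) * r v powr (- \<kappa>)" for p v
  have Gm [measurable]: "(\<lambda>(p, v). G p v) \<in> borel_measurable (riesz a \<Otimes>\<^sub>M N)"
    unfolding G_def by measurable
  define GB where "GB = L * L * (\<rho>0 powr (- \<kappa>) + \<rho>1 powr (- \<kappa>))"
  have G0: "G p v > 0" for p v using gpos rpos[of v] by (simp add: G_def)
  have GB: "G p v \<le> GB" for p v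
    unfolding G_def GB_def using gpos gb L rb \<rho>0
    by (intro mult_mono powr_le_endpoints) (auto simp: less_imp_le)
  have GBq: "G p v powr q \<le> GB powr q" for p v
    using GB[of p v] G0[of p v] q by (intro powr_mono2) (auto simp: less_imp_le)
  have Aeq: "A p = (\<integral>v. G p v powr q \<partial>N)" for p
    unfolding A G_def by (intro Bochner_Integration.integral_cong) (auto simp: r_eq \<kappa>_def)
  have Am' [measurable]: "A \<in> borel_measurable (riesz a)"
    unfolding Aeq by measurable
  then show "A \<in> borel_measurable (borel \<Otimes>\<^sub>M borel)" by simp
  define AB where "AB = GB powr q * measure N (space N)"
  have A0: "0 \<le> A p" for p unfolding Aeq by (intro integral_nonneg_AE) auto
  have AB: "A p \<le> AB" for p
  proof -
    have "ennreal (norm (A p)) \<le> (\<integral>\<^sup>+v. ennreal (GB powr q) \<partial>N)"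
      unfolding Aeq using GBq
      by (intro order.trans[OF ennreal_norm_integral_le] nn_integral_mono) (auto intro!: ennreal_leI)
    also have "\<dots> = ennreal AB"
      by (simp add: AB_def N.emeasure_eq_measure ennreal_mult)
    finally show ?thesis using A0[of p] by (simp add: AB_def ennreal_le_iff)
  qed
  show "\<exists>B. \<forall>p. 0 \<le> A p \<and> A p \<le> B" using A0 AB by blast
  define S where "S = (\<integral>v. r v \<partial>N)"
  have S: "S = (\<integral>v. \<rho> v \<partial>N)" unfolding S_def by (intro Bochner_Integration.integral_cong) (auto simp: r_eq)
  have S0: "S \<ge> 0" unfolding S_def using rpos by (intro integral_nonneg_AE) (auto simp: less_imp_le)
  have ir: "integrable N r"
    using rb rpos by (intro N.integrable_const_bound[where B = \<rho>1]) (auto simp: less_imp_le)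
  define k where "k p v = (g v (fst p) powr n * g v (snd p) powr n) * r v powr (a - 1)" for p v
  have km [measurable]: "(\<lambda>(p, v). k p v) \<in> borel_measurable (riesz a \<Otimes>\<^sub>M N)" unfolding k_def by measurable
  have AQ: "A p powr Q \<le> (\<integral>v. k p v \<partial>N) * S powr (Q - 1)" for p
  proof -
    have [measurable]: "(\<lambda>v. G p v) \<in> borel_measurable N" unfolding G_def by measurable
    have "A p powr Q \<le> (\<integral>v. (G p v powr q) powr Q * r v powr (1 - Q) \<partial>N) * S powr (Q - 1)"
      unfolding Aeq S_def
      using q N GBq rb \<rho>0
      by (intro weighted_Jensen[where L = "GB powr q" and L' = \<rho>1 and \<epsilon> = \<rho>0]) (auto simp: Q_def)
    also have "(\<lambda>v. (G p v powr q) powr Q * r v powr (1 - Q)) = k p"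
    proof
      fix v
      have "(G p v powr q) powr Q = G p v powr n" using q by (simp add: powr_powr Q_def)
      also have "\<dots> = g v (fst p) powr n * g v (snd p) powr n * r v powr (- \<kappa> * n)"
        unfolding G_def by (simp add: powr_mult powr_powr)
      finally have "(G p v powr q) powr Q * r v powr (1 - Q)
         = g v (fst p) powr n * g v (snd p) powr n * r v powr (- \<kappa> * n + (1 - Q))"
        by (simp only: powr_add mult.assoc)
      \<comment> \<open>The Hardy-Littlewood-Sobolev inequality below produces r v powr (2 - a). The
        power a - 1 left here is the one that completes it to r v itself, whose integral is
        \<open>S\<close>.\<close>
      also have "- \<kappa> * n + (1 - Q) = a - 1"
        using a n q unfolding \<kappa>_def Q_def P by (simp add: field_simps)
      finally show "(G p v powr q) powr Q * r v powr (1 - Q) = k p v" by (simp add: k_def)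
    qed
    finally show ?thesis .
  qed
  have inner: "(\<integral>\<^sup>+p. ennreal (k p v) \<partial>riesz a) \<le> ennreal (H * r v)" if v [measurable]: "v \<in> space N" for v
  proof -
    have "(\<integral>\<^sup>+p. ennreal (k p v) \<partial>riesz a) =
        ennreal (r v powr (a - 1)) * (\<integral>\<^sup>+p. ennreal (g v (fst p) powr n * g v (snd p) powr n) \<partial>riesz a)"
      by (subst nn_integral_cmult[symmetric]) (auto simp: k_def ennreal_mult[symmetric] mult_ac intro!: nn_integral_cong)
    also have "\<dots> \<le> ennreal (r v powr (a - 1)) * ennreal (H * (\<integral>x. (g v x powr n) powr (2 / (2 - a)) \<partial>M) powr (2 - a))"
    proof (rule mult_left_mono)
      have m: "(\<lambda>x. g v x powr n) \<in> borel_measurable borel"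
        using v by measurable
      show "(\<integral>\<^sup>+p. ennreal (g v (fst p) powr n * g v (snd p) powr n) \<partial>riesz a)
        \<le> ennreal (H * (\<integral>x. (g v x powr n) powr (2 / (2 - a)) \<partial>M) powr (2 - a))"
        unfolding H_def using a gb gpos n
        by (intro HLS[where B = "L powr n" and g = "\<lambda>x. g v x powr n"] m) (auto intro!: powr_mono2 simp: less_imp_le)
    qed simp
    \<comment> \<open>Since P = n * 2 / (2 - a), the norm of g powr n in that inequality is the very
      integral that defines \<rho>.\<close>
    also have "(\<integral>x. (g v x powr n) powr (2 / (2 - a)) \<partial>M) = r v"
      unfolding r_eq[OF v] \<rho> P powr_powr by simp
    also have "ennreal (r v powr (a - 1)) * ennreal (H * r v powr (2 - a)) = ennreal (H * r v)"
    proof -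
      have "r v powr (a - 1) * r v powr (2 - a) = r v" using rpos[of v] by (simp add: powr_add[symmetric])
      then show ?thesis using H by (subst ennreal_mult[symmetric]) (auto simp: mult_ac)
    qed
    finally show ?thesis .
  qed
  have k0: "k p v \<ge> 0" for p v by (simp add: k_def)
  have "ennreal (\<integral>p. A p powr Q \<partial>riesz a) \<le> (\<integral>\<^sup>+p. ennreal (A p powr Q) \<partial>riesz a)"
    using ennreal_norm_integral_le[of "riesz a" "\<lambda>p. A p powr Q"] by simp
  also have "\<dots> \<le> (\<integral>\<^sup>+p. ennreal (S powr (Q - 1)) * (\<integral>\<^sup>+v. ennreal (k p v) \<partial>N) \<partial>riesz a)"
  proof (rule nn_integral_mono)
    fix p
    have nn: "(\<integral>v. k p v \<partial>N) \<ge> 0" using k0 by (intro integral_nonneg_AE) auto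
    have "ennreal (A p powr Q) \<le> ennreal (S powr (Q - 1) * (\<integral>v. k p v \<partial>N))"
      using AQ[of p] by (intro ennreal_leI) (simp add: mult.commute)
    also have "\<dots> = ennreal (S powr (Q - 1)) * ennreal (\<integral>v. k p v \<partial>N)"
      using nn by (intro ennreal_mult) auto
    also have "ennreal (\<integral>v. k p v \<partial>N) \<le> (\<integral>\<^sup>+v. ennreal (k p v) \<partial>N)"
      using ennreal_norm_integral_le[of N "k p"] nn k0 by simp
    finally show "ennreal (A p powr Q) \<le> ennreal (S powr (Q - 1)) * (\<integral>\<^sup>+v. ennreal (k p v) \<partial>N)"
      by (simp add: mult_left_mono)
  qed
  also have "\<dots> = ennreal (S powr (Q - 1)) * (\<integral>\<^sup>+p. (\<integral>\<^sup>+v. ennreal (k p v) \<partial>N) \<partial>riesz a)"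
    by (rule nn_integral_cmult) measurable
  also have "(\<integral>\<^sup>+p. (\<integral>\<^sup>+v. ennreal (k p v) \<partial>N) \<partial>riesz a) = (\<integral>\<^sup>+v. (\<integral>\<^sup>+p. ennreal (k p v) \<partial>riesz a) \<partial>N)"
    by (rule RN.Fubini'[symmetric]) measurable
  also have "\<dots> \<le> (\<integral>\<^sup>+v. ennreal (H * r v) \<partial>N)"
    by (intro nn_integral_mono inner)
  also have "\<dots> = ennreal (H * S)"
    using ir rpos H unfolding S_def
    by (subst nn_integral_eq_integral) (auto simp: less_imp_le)
  finally have "ennreal (\<integral>p. A p powr Q \<partial>riesz a) \<le> ennreal (S powr (Q - 1)) * ennreal (H * S)"
    by (simp add: mult_left_mono)
  also have "\<dots> = ennreal (H * S powr Q)"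
  proof -
    have "S powr (Q - 1) * S = S powr Q"
      using S0 q by (cases "S = 0") (auto simp: powr_diff Q_def)
    then show ?thesis using S0 H by (subst ennreal_mult[symmetric]) (auto simp: mult_ac)
  qed
  finally show "(\<integral>p. A p powr (n / q) \<partial>riesz a) \<le> 2 * (2 / (1 - a) + 3) * (\<integral>v. \<rho> v \<partial>N) powr (n / q)"
    using H by (simp add: ennreal_le_iff S Q_def H_def)
qed

text \<open>Positive mass keeps the partial integrals of a function that is at least \<epsilon> away
  from zero, so that they can serve as weights with negative powers.\<close>

locale lebesgue_measures =
  fixes M :: "'i \<Rightarrow> real measure"
  assumes dominated: "\<And>i. dominated_by_lborel (M i)"
    and pos: "\<And>i. measure (M i) UNIV > 0"
begin

sublocale finite_measures M
  by (rule finite_measures.intro) (rule dominated_by_lborel.axioms(1)[OF dominated])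

lemma sets_M [measurable_cong]: "sets (M i) = sets borel"
  by (rule dominated_by_lborel.sets_eq[OF dominated])

lemma space_M [simp]: "space (M i) = UNIV"
  by (rule dominated_by_lborel.space_eq[OF dominated])

text \<open>Points are null sets under domination by Lebesgue measure. Kernel bounds of the form
  used in \<open>box_decay\<close>, stated for x \<noteq> y only, therefore suffice under the
  integral sign.\<close>

lemma AE_neq: "AE y in M i. x \<noteq> y"
proof -
  have "emeasure (M i) {x} = (\<integral>\<^sup>+y. indicator {x} y \<partial>M i)" by (simp add: sets_M)
  also have "\<dots> \<le> (\<integral>\<^sup>+y. indicator {x} y \<partial>lborel)"
    by (rule dominated_by_lborel.nn_le[OF dominated]) measurable
  also have "\<dots> = 0" by simp
  finally have "emeasure (M i) {x} = 0" by simp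
  then show ?thesis by (intro AE_I[where N = "{x}"]) (auto simp: sets_M)
qed

text \<open>Splitting off the coordinate leaves the product over the empty index set, which is the
  unit mass at the function that is \<open>undefined\<close> everywhere.\<close>

lemma integral_PiM_singleton:
  fixes F :: "('i \<Rightarrow> real) \<Rightarrow> 'b::{banach, second_countable_topology}"
  assumes "F \<in> borel_measurable (PiM {i} M)" "\<And>z. norm (F z) \<le> B"
  shows "(\<integral>z. F z \<partial>PiM {i} M) = (\<integral>x. F ((\<lambda>_. undefined)(i := x)) \<partial>M i)"
proof -
  have "(\<integral>z. F z \<partial>PiM {i} M) = (\<integral>z. (\<integral>x. F (z(i := x)) \<partial>M i) \<partial>PiM {} M)"
    using assms by (intro product_integral_insert integrable_PiM_bounded[where B = B]) auto
  also have "\<dots> = (\<integral>x. F ((\<lambda>_. undefined)(i := x)) \<partial>M i)"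
  proof -
    have "(\<Sum>a\<in>{u}. h a) = h u" for u :: "'i \<Rightarrow> real" and h :: "_ \<Rightarrow> 'b" by simp
    note single = this
    show ?thesis unfolding PiM_empty
      by (subst lebesgue_integral_count_space_finite, simp) (rule single)
  qed
  finally show ?thesis .
qed

lemma measurable_upd_restrict:
  assumes "f \<in> borel_measurable (PiM (insert i J - {k}) M)" "i \<notin> J" "k \<in> J"
  shows "(\<lambda>(v, x). f (v(i := x))) \<in> borel_measurable (PiM (J - {k}) M \<Otimes>\<^sub>M M i)"
    and "(\<lambda>(z, x). f ((restrict z (J - {k}))(i := x))) \<in> borel_measurable (PiM J M \<Otimes>\<^sub>M M i)"
proof -
  have eq: "insert i J - {k} = insert i (J - {k})" using assms(2,3) by auto
  show 1: "(\<lambda>(v, x). f (v(i := x))) \<in> borel_measurable (PiM (J - {k}) M \<Otimes>\<^sub>M M i)"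
    using assms unfolding eq by (intro measurable_upd_PiM) auto
  have "(\<lambda>p. restrict (fst p) (J - {k})) \<in> PiM J M \<Otimes>\<^sub>M M i \<rightarrow>\<^sub>M PiM (J - {k}) M"
    by (rule measurable_compose[OF measurable_fst measurable_restrict_subset]) auto
  from measurable_case_prod_compose[OF 1 this measurable_snd]
  show "(\<lambda>(z, x). f ((restrict z (J - {k}))(i := x))) \<in> borel_measurable (PiM J M \<Otimes>\<^sub>M M i)"
    by (simp add: case_prod_beta')
qed

lemma measurable_restrict_fun:
  assumes "h \<in> borel_measurable (PiM (J - {k}) M)"
  shows "(\<lambda>z. h (restrict z (J - {k}))) \<in> borel_measurable (PiM J M)"
proof -
  have "(\<lambda>z. restrict z (J - {k})) \<in> PiM J M \<rightarrow>\<^sub>M PiM (J - {k}) M"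
    by (rule measurable_restrict_subset) auto
  from measurable_compose[OF this assms] show ?thesis .
qed

text \<open>The Cauchy-Schwarz step. The weights \<open>W k\<close> do not depend on \<open>x\<^sub>k\<close> and \<open>x\<^sub>i\<close>, so
  that they can be absorbed in the factors of the form in one variable less.\<close>
lemma peel:
  fixes K :: "('i \<Rightarrow> real) \<Rightarrow> complex" and f :: "'i \<Rightarrow> ('i \<Rightarrow> real) \<Rightarrow> complex"
    and g W :: "'i \<Rightarrow> ('i \<Rightarrow> real) \<Rightarrow> real"
  assumes J: "finite J" "i \<notin> J" and I: "I = insert i J"
    and K: "K \<in> borel_measurable (PiM I M)" "\<And>z. norm (K z) \<le> BK"
    and f: "\<And>j. j \<in> I \<Longrightarrow> f j \<in> borel_measurable (PiM (I - {j}) M)"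
    and g: "\<And>j. j \<in> I \<Longrightarrow> g j \<in> borel_measurable (PiM (I - {j}) M)"
    and fg: "\<And>j z. j \<in> I \<Longrightarrow> norm (f j z) \<le> g j z" and gL: "\<And>j z. j \<in> I \<Longrightarrow> g j z \<le> L"
    and W: "\<And>k. k \<in> J \<Longrightarrow> W k \<in> borel_measurable (PiM (J - {k}) M)"
    and Wb: "\<And>k v. k \<in> J \<Longrightarrow> \<delta> \<le> W k v" "\<And>k v. k \<in> J \<Longrightarrow> W k v \<le> \<Delta>" "\<delta> > 0"
  shows "(norm (\<integral>z. K z * (\<Prod>j\<in>I. f j (restrict z (I - {j}))) \<partial>PiM I M))\<^sup>2 \<le>
    (\<integral>z. (g i z * (\<Prod>k\<in>J. W k (restrict z (J - {k}))))\<^sup>2 \<partial>PiM J M) *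
    norm (\<integral>x. (\<integral>y. (\<integral>z. (K (z(i := x)) * cnj (K (z(i := y)))) *
       (\<Prod>k\<in>J. (\<lambda>v. f k (v(i := x)) * cnj (f k (v(i := y))) * of_real (1 / (W k v)\<^sup>2)) (restrict z (J - {k})))
         \<partial>PiM J M) \<partial>M i) \<partial>M i)"
proof -
  have JI: "J \<subseteq> I" "i \<in> I" using I by auto
  have finI: "finite I" using J I by simp
  have g0: "0 \<le> g j z" if "j \<in> I" for j z using fg[OF that, of z] norm_ge_zero order_trans by blast
  have L0: "0 \<le> L" using g0[OF JI(2)] gL[OF JI(2)] order_trans by blast
  have fL: "norm (f j z) \<le> L" if "j \<in> I" for j z using fg[OF that, of z] gL[OF that, of z] by linarith
  have BK0: "0 \<le> BK" using K(2)[of undefined] norm_ge_zero order_trans by blast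
  have Wpos: "W k v > 0" if "k \<in> J" for k v using Wb(1)[OF that, of v] Wb(3) by linarith
  define w where "w z = (\<Prod>k\<in>J. W k (restrict z (J - {k})))" for z
  have wm [measurable]: "w \<in> borel_measurable (PiM J M)" unfolding w_def
    by (intro borel_measurable_prod measurable_restrict_fun W)
  have wpos: "w z > 0" for z unfolding w_def using Wpos by (intro prod_pos) auto
  have wB: "w z \<le> (\<Prod>k\<in>J. \<Delta>)" for z unfolding w_def using Wb Wpos
    by (intro prod_mono) (auto simp: less_imp_le)
  have wb: "w z \<ge> (\<Prod>k\<in>J. \<delta>)" for z unfolding w_def using Wb
    by (intro prod_mono) (auto simp: less_imp_le)
  have \<delta>p: "(\<Prod>k\<in>J. \<delta>) > 0" using Wb(3) by (intro prod_pos) auto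
  \<comment> \<open>The weights are divided out of the part that depends on x and multiplied onto
    \<open>f i\<close>, so the integrand stays the same. In \<open>H z x * cnj (H z y)\<close> they
    then occur squared, one factor for every k.\<close>
  define H where "H z x = K (z(i := x)) * (\<Prod>k\<in>J. f k ((restrict z (J - {k}))(i := x))) * of_real (1 / w z)" for z x
  have fim: "f i \<in> borel_measurable (PiM J M)" "g i \<in> borel_measurable (PiM J M)"
    using f[OF JI(2)] g[OF JI(2)] J I by auto
  have Km: "(\<lambda>(z, x). K (z(i := x))) \<in> borel_measurable (PiM J M \<Otimes>\<^sub>M M i)"
    using K(1) J unfolding I by (intro measurable_upd_PiM) auto
  have fm: "(\<lambda>(z, x). f k ((restrict z (J - {k}))(i := x))) \<in> borel_measurable (PiM J M \<Otimes>\<^sub>M M i)" if "k \<in> J" for k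
    using f[of k] that J JI unfolding I by (intro measurable_upd_restrict(2)) auto
  have Hm: "(\<lambda>(z, x). H z x) \<in> borel_measurable (PiM J M \<Otimes>\<^sub>M M i)"
  proof -
    have "(\<lambda>p. K ((fst p)(i := snd p)) * (\<Prod>k\<in>J. f k ((restrict (fst p) (J - {k}))(i := snd p))) * of_real (1 / w (fst p)))
      \<in> borel_measurable (PiM J M \<Otimes>\<^sub>M M i)"
    proof (intro borel_measurable_times borel_measurable_prod)
      show "(\<lambda>p. K ((fst p)(i := snd p))) \<in> borel_measurable (PiM J M \<Otimes>\<^sub>M M i)"
        using Km by (simp add: case_prod_beta')
      show "(\<lambda>p. f k ((restrict (fst p) (J - {k}))(i := snd p))) \<in> borel_measurable (PiM J M \<Otimes>\<^sub>M M i)" if "k \<in> J" for k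
        using fm[OF that] by (simp add: case_prod_beta')
      show "(\<lambda>p. complex_of_real (1 / w (fst p))) \<in> borel_measurable (PiM J M \<Otimes>\<^sub>M M i)" by measurable
    qed
    then show ?thesis by (simp add: H_def case_prod_beta')
  qed
  define HB where "HB = BK * (\<Prod>k\<in>J. L) * (1 / (\<Prod>k\<in>J. \<delta>))"
  have HB: "norm (H z x) \<le> HB" for z x
  proof -
    have "norm (H z x) = norm (K (z(i := x))) * (\<Prod>k\<in>J. norm (f k ((restrict z (J - {k}))(i := x)))) * (1 / w z)"
      using wpos[of z] by (simp add: H_def norm_mult norm_divide prod_norm)
    also have "\<dots> \<le> HB" unfolding HB_def
      using K(2) fL JI wb[of z] wpos[of z] \<delta>p BK0 L0
      by (intro mult_mono prod_mono divide_left_mono mult_nonneg_nonneg prod_nonneg) (auto intro: less_imp_le)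
    finally show ?thesis .
  qed
  have main: "(norm (\<integral>z. (f i z * of_real (w z)) * (\<integral>x. H z x \<partial>M i) \<partial>PiM J M))\<^sup>2
    \<le> (\<integral>z. (g i z * w z)\<^sup>2 \<partial>PiM J M) * norm (\<integral>x. (\<integral>y. (\<integral>z. H z x * cnj (H z y) \<partial>PiM J M) \<partial>M i) \<partial>M i)"
  proof (rule Cauchy_Schwarz_expand[OF finite_PiM[OF J(1)] finite_measures Hm HB])
    show "(\<lambda>z. f i z * of_real (w z)) \<in> borel_measurable (PiM J M)" using fim by measurable
    show "(\<lambda>z. g i z * w z) \<in> borel_measurable (PiM J M)" using fim by measurable
    show "norm (f i z * of_real (w z)) \<le> g i z * w z" for z
      using fg[OF JI(2), of z] wpos[of z] by (simp add: norm_mult mult_right_mono)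
    show "g i z * w z \<le> L * (\<Prod>k\<in>J. \<Delta>)" for z
      using gL[OF JI(2)] wB wpos[of z] L0 by (intro mult_mono) (auto simp: less_imp_le)
  qed
  define F where "F z = K z * (\<Prod>j\<in>I. f j (restrict z (I - {j})))" for z
  have "F \<in> borel_measurable (PiM I M)" unfolding F_def
    by (intro borel_measurable_times K(1) borel_measurable_prod measurable_restrict_fun f)
  moreover have "norm (F z) \<le> BK * (\<Prod>j\<in>I. L)" for z
    unfolding F_def norm_mult prod_norm[symmetric] using K(2) fL BK0
    by (intro mult_mono prod_mono prod_nonneg) auto
  ultimately have "(\<integral>z. F z \<partial>PiM I M) = (\<integral>z. (\<integral>x. F (z(i := x)) \<partial>M i) \<partial>PiM J M)"
    unfolding I using J I by (intro product_integral_insert integrable_PiM_bounded[where B = "BK * (\<Prod>j\<in>I. L)"]) auto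
  also have "\<dots> = (\<integral>z. (f i z * of_real (w z)) * (\<integral>x. H z x \<partial>M i) \<partial>PiM J M)"
  proof (rule Bochner_Integration.integral_cong[OF refl])
    fix z assume z: "z \<in> space (PiM J M)"
    have rz: "restrict z J = z" using z by (auto simp: space_PiM)
    have "F (z(i := x)) = (f i z * of_real (w z)) * H z x" for x
    proof -
      have "restrict (z(i := x)) (I - {i}) = restrict z J" using J I by (auto simp: fun_eq_iff)
      moreover have "restrict (z(i := x)) (I - {k}) = (restrict z (J - {k}))(i := x)" if "k \<in> J" for k
        using that J unfolding I by (intro restrict_upd_insert) auto
      ultimately have "(\<Prod>j\<in>I. f j (restrict (z(i := x)) (I - {j}))) = f i z * (\<Prod>k\<in>J. f k ((restrict z (J - {k}))(i := x)))"
        unfolding I by (subst prod.insert) (use J rz in \<open>auto simp: I[symmetric]\<close>)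
      then show ?thesis using wpos[of z] by (simp add: F_def H_def)
    qed
    then show "(\<integral>x. F (z(i := x)) \<partial>M i) = (f i z * of_real (w z)) * (\<integral>x. H z x \<partial>M i)" by simp
  qed
  finally have F: "(\<integral>z. F z \<partial>PiM I M) = \<dots>" .
  have HH: "H z x * cnj (H z y) = (K (z(i := x)) * cnj (K (z(i := y)))) *
       (\<Prod>k\<in>J. (\<lambda>v. f k (v(i := x)) * cnj (f k (v(i := y))) * of_real (1 / (W k v)\<^sup>2)) (restrict z (J - {k})))" for x y z
  proof -
    have "complex_of_real (1 / w z) * of_real (1 / w z) = (\<Prod>k\<in>J. of_real (1 / (W k (restrict z (J - {k})))\<^sup>2))"
      by (simp add: w_def power2_eq_square prod_dividef prod.distrib of_real_prod[symmetric] del: of_real_prod)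
    then have "(\<Prod>k\<in>J. of_real (1 / (W k (restrict z (J - {k})))\<^sup>2)) = complex_of_real (1 / w z) * of_real (1 / w z)"
      by (rule sym)
    moreover have "cnj (H z y) = cnj (K (z(i := y))) * (\<Prod>k\<in>J. cnj (f k ((restrict z (J - {k}))(i := y)))) * of_real (1 / w z)"
      unfolding H_def by simp
    ultimately show ?thesis unfolding prod.distrib by (simp only: H_def mult_ac)
  qed
  show ?thesis using main unfolding F[symmetric] unfolding F_def w_def HH .
qed

end

text \<open>\<open>\<eta>\<close> collects the frequency and the gaps \<open>\<bar>x\<^sub>j - y\<^sub>j\<bar>\<close> of the differences already taken.\<close>
primrec box_decay :: "('i \<Rightarrow> real measure) \<Rightarrow> 'i \<Rightarrow> real \<Rightarrow> 'i list \<Rightarrow> real \<Rightarrow> (('i \<Rightarrow> real) \<Rightarrow> complex) \<Rightarrow> bool" where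
  "box_decay M t B [] \<eta> K \<longleftrightarrow> (\<forall>z. norm (\<integral>s. K (z(t := s)) \<partial>M t) \<le> B * min 1 (1 / \<eta>\<^sup>2))"
| "box_decay M t B (j # js) \<eta> K \<longleftrightarrow>
    (\<forall>x y. x \<noteq> y \<longrightarrow> box_decay M t B js (\<eta> * \<bar>x - y\<bar>) (\<lambda>z. K (z(j := x)) * cnj (K (z(j := y)))))"

text \<open>The square root undoes the Cauchy-Schwarz square of one step, and the factor beside the
  previous constant is the one in \<open>HLS\<close> for a = 1 / 2 ^ Suc m. The initial value is the
  square root of 4, which comes from the decay integral.\<close>

primrec multilinear_const :: "nat \<Rightarrow> real" where
  "multilinear_const 0 = 2"
| "multilinear_const (Suc m) = sqrt (multilinear_const m * (2 * (2 / (1 - 1 / 2 ^ Suc m) + 3)))"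

lemma multilinear_const_pos: "multilinear_const m > 0"
proof (induction m)
  case (Suc m)
  have "(1::real) < 2 ^ Suc m" by (rule one_less_power) auto
  then have "2 / (1 - 1 / 2 ^ Suc m) > (0::real)" by simp
  then show ?case using Suc by (auto intro!: mult_pos_pos add_pos_pos)
qed simp

section \<open>Induction on the number of variables\<close>

context lebesgue_measures
begin

text \<open>Two variables, where the exponent is 2 and no weights are required. After one
  Cauchy-Schwarz step the kernel decays like min 1 (\<eta> |x - y|)^-2, and a Schur test with its
  integral replaces the Hardy-Littlewood-Sobolev inequality.\<close>

lemma multilinear_bound_base:
  fixes K :: "('i \<Rightarrow> real) \<Rightarrow> complex" and f :: "'i \<Rightarrow> ('i \<Rightarrow> real) \<Rightarrow> complex"
    and g :: "'i \<Rightarrow> ('i \<Rightarrow> real) \<Rightarrow> real"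
  assumes tj: "t \<noteq> j" and I: "I = {t, j}" and B: "B > 0" "\<eta> > 0"
    and K: "K \<in> borel_measurable (PiM I M)" "\<And>z. norm (K z) \<le> BK"
    and f: "\<And>j. j \<in> I \<Longrightarrow> f j \<in> borel_measurable (PiM (I - {j}) M)"
    and g: "\<And>j. j \<in> I \<Longrightarrow> g j \<in> borel_measurable (PiM (I - {j}) M)"
    and fg: "\<And>j z. j \<in> I \<Longrightarrow> norm (f j z) \<le> g j z" and gL: "\<And>j z. j \<in> I \<Longrightarrow> g j z \<le> L"
    and dec: "box_decay M t B [j] \<eta> K"
  shows "norm (\<integral>z. K z * (\<Prod>j\<in>I. f j (restrict z (I - {j}))) \<partial>PiM I M)
    \<le> 2 * (B / \<eta>) powr (1 / 2) * (\<Prod>j\<in>I. (\<integral>z. g j z powr 2 \<partial>PiM (I - {j}) M) powr (1 / 2))"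
proof -
  have Ieq: "I = insert j {t}" "I - {t} = {j}" "I - {j} = {t}" using I tj by auto
  have inI: "t \<in> I" "j \<in> I" using I by auto
  have g0: "0 \<le> g j z" if "j \<in> I" for j z using fg[OF that, of z] norm_ge_zero order_trans by blast
  define o' where "o' = (\<lambda>_::'i. undefined :: real)"
  define h where "h x = g t (o'(j := x))" for x
  define fh where "fh x = f t (o'(j := x))" for x
  have mj: "(\<lambda>x. o'(j := x)) \<in> M j \<rightarrow>\<^sub>M PiM {j} M"
    using measurable_Pair2[OF measurable_add_dim[of j "{}" M], of "o'"] by (simp add: space_PiM o'_def case_prod_beta')
  have hm [measurable]: "h \<in> borel_measurable borel"
  proof -
    have "h \<in> borel_measurable (M j)"
      unfolding h_def using measurable_compose[OF mj] g[OF inI(1)] Ieq by auto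
    then show ?thesis by (simp cong: measurable_cong_sets add: sets_M)
  qed
  have fhh: "norm (fh x) \<le> h x" for x unfolding fh_def h_def by (rule fg[OF inI(1)])
  have h0: "0 \<le> h x" for x unfolding h_def by (rule g0[OF inI(1)])
  have hL: "h x \<le> L" for x unfolding h_def by (rule gL[OF inI(1)])
  have ih: "integrable (M j) (\<lambda>x. (h x)\<^sup>2)"
    using h0 hL by (intro integrable_bounded[where B = "L\<^sup>2"]) (auto intro!: power_mono)
  define w where "w x y = min 1 (1 / (\<eta> * \<bar>x - y\<bar>)\<^sup>2)" for x y :: real
  define T where "T x y = (\<integral>z. (K (z(j := x)) * cnj (K (z(j := y)))) *
       (\<Prod>k\<in>{t}. (\<lambda>v. f k (v(j := x)) * cnj (f k (v(j := y))) * of_real (1 / (1::real)\<^sup>2)) (restrict z ({t} - {k}))) \<partial>PiM {t} M)" for x y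
  have peel: "(norm (\<integral>z. K z * (\<Prod>j\<in>I. f j (restrict z (I - {j}))) \<partial>PiM I M))\<^sup>2 \<le>
    (\<integral>z. (g j z * (\<Prod>k\<in>{t}. 1))\<^sup>2 \<partial>PiM {t} M) * norm (\<integral>x. (\<integral>y. T x y \<partial>M j) \<partial>M j)"
    unfolding T_def
    by (rule peel[where W = "\<lambda>_ _. 1" and \<delta> = 1 and \<Delta> = 1 and L = L and BK = BK and f = f])
      (use tj Ieq(1) K f g fg gL in \<open>simp_all\<close>)
  have Tb: "norm (T x y) \<le> h x * h y * (B * w x y)" if "x \<noteq> y" for x y
  proof -
    have BK0: "0 \<le> BK" using K(2)[of undefined] norm_ge_zero order_trans by blast
    have upd: "(\<lambda>z. K (z(j := x))) \<in> borel_measurable (PiM {t} M)" for x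
    proof -
      have "(\<lambda>(z, x). K (z(j := x))) \<in> borel_measurable (PiM {t} M \<Otimes>\<^sub>M M j)"
        using K(1) tj unfolding Ieq(1) by (intro measurable_upd_PiM) auto
      from measurable_compose[OF measurable_Pair2' this, of x] show ?thesis by simp
    qed
    have "T x y = (\<integral>z. fh x * cnj (fh y) * (K (z(j := x)) * cnj (K (z(j := y)))) \<partial>PiM {t} M)"
    proof -
      \<comment> \<open>The function attached to the last variable \<open>t\<close> has an empty
        argument once x and y are fixed; it is a number and leaves the integral, so that the bare
        box kernel remains.\<close>
      have "restrict z ({t} - {t}) = o'" for z :: "'i \<Rightarrow> real" by (simp add: o'_def fun_eq_iff)
      note res = this
      have single: "(\<Prod>k\<in>{t}. a k) = a t" for a :: "'i \<Rightarrow> complex" by simp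
      show ?thesis unfolding T_def fh_def single res
        by (intro Bochner_Integration.integral_cong refl) simp
    qed
    also have "\<dots> = fh x * cnj (fh y) * (\<integral>z. K (z(j := x)) * cnj (K (z(j := y))) \<partial>PiM {t} M)"
      by (rule integral_mult_right_zero)
    also have "(\<integral>z. K (z(j := x)) * cnj (K (z(j := y))) \<partial>PiM {t} M) =
       (\<integral>s. K ((o'(t := s))(j := x)) * cnj (K ((o'(t := s))(j := y))) \<partial>M t)"
      unfolding o'_def
    proof (rule integral_PiM_singleton)
      show "(\<lambda>z. K (z(j := x)) * cnj (K (z(j := y)))) \<in> borel_measurable (PiM {t} M)"
        using upd[of x] upd[of y] by measurable
      show "norm (K (z(j := x)) * cnj (K (z(j := y)))) \<le> BK * BK" for z
        unfolding norm_mult complex_mod_cnj using K(2) BK0 by (intro mult_mono) auto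
    qed
    finally have "norm (T x y) = norm (fh x) * norm (fh y) * norm (\<integral>s. K ((o'(t := s))(j := x)) * cnj (K ((o'(t := s))(j := y))) \<partial>M t)"
      by (simp add: norm_mult)
    also have "\<dots> \<le> h x * h y * (B * w x y)"
      using dec that fhh h0 unfolding w_def by (intro mult_mono mult_nonneg_nonneg) auto
    finally show ?thesis .
  qed
  have w_sym: "w x y = w y x" for x y by (simp add: w_def abs_minus_commute)
  have w0: "w x y \<ge> 0" for x y by (simp add: w_def)
  interpret Mj: dominated_by_lborel "M j" by (rule dominated)
  interpret Mjj: pair_sigma_finite "M j" "M j" ..
  define k where "k x y = ennreal ((h x)\<^sup>2 * (B / 2 * w x y))" for x y
  have [measurable]: "(\<lambda>(x, y). k x y) \<in> borel_measurable (M j \<Otimes>\<^sub>M M j)" unfolding k_def w_def by measurable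
  have ki: "(\<integral>\<^sup>+x. (\<integral>\<^sup>+y. k x y \<partial>M j) \<partial>M j) \<le> ennreal (2 * B / \<eta> * (\<integral>x. (h x)\<^sup>2 \<partial>M j))"
  proof -
    have "(\<integral>\<^sup>+y. k x y \<partial>M j) \<le> ennreal (2 * B / \<eta> * (h x)\<^sup>2)" for x
    proof -
      have "(\<integral>\<^sup>+y. k x y \<partial>M j) = ennreal ((h x)\<^sup>2 * (B / 2)) * (\<integral>\<^sup>+y. ennreal (w x y) \<partial>M j)"
        unfolding k_def w_def using B
        by (subst nn_integral_cmult[symmetric]) (auto intro!: nn_integral_cong simp: ennreal_mult[symmetric] mult.assoc)
      also have "\<dots> \<le> ennreal ((h x)\<^sup>2 * (B / 2)) * ennreal (4 / \<eta>)"
        unfolding w_def by (intro mult_left_mono Mj.nn_integral_decay B) auto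
      also have "\<dots> = ennreal (2 * B / \<eta> * (h x)\<^sup>2)"
        using B by (simp add: ennreal_mult[symmetric] mult_ac)
      finally show ?thesis .
    qed
    then have "(\<integral>\<^sup>+x. (\<integral>\<^sup>+y. k x y \<partial>M j) \<partial>M j) \<le> (\<integral>\<^sup>+x. ennreal (2 * B / \<eta> * (h x)\<^sup>2) \<partial>M j)"
      by (intro nn_integral_mono)
    also have "\<dots> = ennreal (2 * B / \<eta> * (\<integral>x. (h x)\<^sup>2 \<partial>M j))"
      using ih B by (subst nn_integral_eq_integral) auto
    finally show ?thesis .
  qed
  have "ennreal (norm (\<integral>x. (\<integral>y. T x y \<partial>M j) \<partial>M j)) \<le> (\<integral>\<^sup>+x. (\<integral>\<^sup>+y. k x y + k y x \<partial>M j) \<partial>M j)"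
  proof (rule order.trans[OF ennreal_norm_integral_le nn_integral_mono])
    fix x
    show "ennreal (norm (\<integral>y. T x y \<partial>M j)) \<le> (\<integral>\<^sup>+y. k x y + k y x \<partial>M j)"
    proof (rule order.trans[OF ennreal_norm_integral_le nn_integral_mono_AE])
      show "AE y in M j. ennreal (norm (T x y)) \<le> k x y + k y x"
        using AE_neq[of x j]
      proof eventually_elim
        case (elim y)
        have "norm (T x y) \<le> h x * h y * (B * w x y)" by (rule Tb[OF elim])
        \<comment> \<open>Schur test: each square meets only the integral of \<open>w\<close> over
          the other variable, and \<open>w\<close> is symmetric.\<close>
        also have "\<dots> \<le> ((h x)\<^sup>2 + (h y)\<^sup>2) / 2 * (B * w x y)"
          using w0 B sum_squares_bound[of "h x" "h y"] by (intro mult_right_mono) auto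
        also have "\<dots> = (h x)\<^sup>2 * (B / 2 * w x y) + (h y)\<^sup>2 * (B / 2 * w y x)"
          unfolding w_sym[of y x] by (simp add: field_simps)
        finally have "ennreal (norm (T x y)) \<le> ennreal ((h x)\<^sup>2 * (B / 2 * w x y) + (h y)\<^sup>2 * (B / 2 * w y x))"
          by (rule ennreal_leI)
        also have "\<dots> = k x y + k y x" unfolding k_def using B w0 by (intro ennreal_plus) auto
        finally show ?case .
      qed
    qed
  qed
  also have "\<dots> = (\<integral>\<^sup>+x. (\<integral>\<^sup>+y. k x y \<partial>M j) + (\<integral>\<^sup>+y. k y x \<partial>M j) \<partial>M j)"
    by (intro nn_integral_cong nn_integral_add) measurable
  also have "\<dots> = (\<integral>\<^sup>+x. (\<integral>\<^sup>+y. k x y \<partial>M j) \<partial>M j) + (\<integral>\<^sup>+x. (\<integral>\<^sup>+y. k y x \<partial>M j) \<partial>M j)"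
    by (rule nn_integral_add) measurable
  also have "(\<integral>\<^sup>+x. (\<integral>\<^sup>+y. k y x \<partial>M j) \<partial>M j) = (\<integral>\<^sup>+x. (\<integral>\<^sup>+y. k x y \<partial>M j) \<partial>M j)"
    by (subst Mjj.Fubini') auto
  also have "(\<integral>\<^sup>+x. (\<integral>\<^sup>+y. k x y \<partial>M j) \<partial>M j) + (\<integral>\<^sup>+x. (\<integral>\<^sup>+y. k x y \<partial>M j) \<partial>M j)
    \<le> ennreal (2 * B / \<eta> * (\<integral>x. (h x)\<^sup>2 \<partial>M j)) + ennreal (2 * B / \<eta> * (\<integral>x. (h x)\<^sup>2 \<partial>M j))"
    by (intro add_mono ki)
  also have "\<dots> = ennreal (4 * (B / \<eta>) * (\<integral>x. (h x)\<^sup>2 \<partial>M j))"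
    using B by (subst ennreal_plus[symmetric]) auto
  finally have Tn: "norm (\<integral>x. (\<integral>y. T x y \<partial>M j) \<partial>M j) \<le> 4 * (B / \<eta>) * (\<integral>x. (h x)\<^sup>2 \<partial>M j)"
    using B by (subst (asm) ennreal_le_iff) auto
  have sq: "g k z powr 2 = (g k z)\<^sup>2" if "k \<in> I" for k z using g0[OF that] by simp
  define St where "St = (\<integral>z. g t z powr 2 \<partial>PiM (I - {t}) M)"
  define Sj where "Sj = (\<integral>z. g j z powr 2 \<partial>PiM (I - {j}) M)"
  have "St = (\<integral>z. (g t z)\<^sup>2 \<partial>PiM {j} M)" unfolding St_def Ieq(2) sq[OF inI(1)] ..
  also have "\<dots> = (\<integral>x. (g t ((\<lambda>_. undefined)(j := x)))\<^sup>2 \<partial>M j)"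
    using g[OF inI(1)] gL[OF inI(1)] g0[OF inI(1)] unfolding Ieq(2)
    by (intro integral_PiM_singleton[where B = "L\<^sup>2"]) (auto intro!: power_mono)
  finally have St: "(\<integral>x. (h x)\<^sup>2 \<partial>M j) = St" by (simp add: h_def o'_def)
  have Sj: "(\<integral>z. (g j z * (\<Prod>k\<in>{t}. 1))\<^sup>2 \<partial>PiM {t} M) = Sj"
    unfolding Sj_def Ieq(3) sq[OF inI(2)] by simp
  have S0: "St \<ge> 0" "Sj \<ge> 0" unfolding St_def Sj_def by auto
  have "(norm (\<integral>z. K z * (\<Prod>j\<in>I. f j (restrict z (I - {j}))) \<partial>PiM I M))\<^sup>2 \<le> Sj * (4 * (B / \<eta>) * St)"
    using order.trans[OF peel[unfolded Sj] mult_left_mono[OF Tn[unfolded St] S0(2)]] .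
  also have "\<dots> = (2 * (B / \<eta>) powr (1 / 2) * (Sj powr (1/2) * St powr (1/2)))\<^sup>2"
    using S0 B by (simp add: power_mult_distrib powr_half_sqrt)
  finally have "norm (\<integral>z. K z * (\<Prod>j\<in>I. f j (restrict z (I - {j}))) \<partial>PiM I M) \<le> 2 * (B / \<eta>) powr (1 / 2) * (Sj powr (1/2) * St powr (1/2))"
    by (rule power2_le_imp_le) auto
  also have "Sj powr (1/2) * St powr (1/2) = (\<Prod>j\<in>I. (\<integral>z. g j z powr 2 \<partial>PiM (I - {j}) M) powr (1 / 2))"
    unfolding Sj_def St_def using tj by (simp add: I)
  finally show ?thesis .
qed

end

text \<open>Here n counts the variables left after a step, q is the exponent for n variables, P the
  one for n + 1, and a is the power of |x - y| produced by the induction hypothesis. The identity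
  for 2 / P - 1 / q balances the weights between the two Cauchy-Schwarz factors. Jensen needs q
  \<le> n, which comes down to n \<le> 2 ^ (n - 1).\<close>

lemma exponent_identities:
  fixes m :: nat
  defines "n \<equiv> real (Suc (Suc m))" and "a \<equiv> (1::real) / 2 ^ Suc m"
    and "q \<equiv> p_exp (Suc (Suc m))" and "P \<equiv> p_exp (Suc (Suc (Suc m)))"
  shows "0 < a" "a < 1" "q > 0" "n / q \<ge> 1" "P = n * 2 / (2 - a)" "2 / P - 1 / q = (1 - 2 / P) / (n - 1)"
    "P > 2" "2 / P - 1 / q > 0"
proof -
  define D where "D = (2::real) ^ Suc m"
  have D2: "D \<ge> 2" unfolding D_def by (simp add: power_increasing[of 1 "Suc m" "2::real", simplified])
  have nD: "n \<le> D"
  proof -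
    have "Suc (Suc m) \<le> 2 ^ Suc m" using less_exp[of "Suc m"] by simp
    then have "real (Suc (Suc m)) \<le> real (2 ^ Suc m)" by (simp only: of_nat_le_iff)
    then show ?thesis by (simp add: n_def D_def)
  qed
  have n2: "n \<ge> 2" by (simp add: n_def)
  have a: "a = 1 / D" by (simp add: a_def D_def)
  have q: "q = (n - 1) * D / (D - 1)" by (simp add: q_def p_exp_def D_def n_def)
  have P: "P = n * (2 * D) / (2 * D - 1)" by (simp add: P_def p_exp_def D_def n_def)
  show "0 < a" "a < 1" using D2 by (auto simp: a)
  show q0: "q > 0" using n2 D2 by (simp add: q)
  have "q \<le> n" using nD n2 D2 by (simp add: q field_simps)
  then show "n / q \<ge> 1" using q0 by simp
  show "P = n * 2 / (2 - a)" using D2 by (simp add: P a field_simps)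
  have iP: "2 / P = (2 * D - 1) / (n * D)" using D2 n2 by (simp add: P field_simps)
  have iq: "1 / q = (D - 1) / ((n - 1) * D)" using D2 n2 by (simp add: q)
  show id: "2 / P - 1 / q = (1 - 2 / P) / (n - 1)"
    unfolding iP iq using D2 n2 by (simp add: field_simps)
  have "2 * (2 * D - 1) < 2 * (2 * D)" by simp
  also have "\<dots> \<le> n * (2 * D)" using n2 D2 by (intro mult_right_mono) auto
  finally have "n * (2 * D) > 2 * (2 * D - 1)" .
  then show P2: "P > 2" using D2 by (simp add: P field_simps)
  show "2 / P - 1 / q > 0" unfolding id using P2 n2 by simp
qed

context lebesgue_measures
begin

text \<open>The head of \<open>js\<close> is removed by \<open>peel\<close>. As weight for
  \<open>f k\<close> serves a power of its partial integral \<open>\<rho> k\<close> over the removed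
  variable, which depends on neither x_k nor that variable. The weights also occur with negative
  powers; this is why \<open>f\<close> comes with a majorant \<open>g\<close> bounded away from
  zero. The majorant changes along with \<open>f\<close> when the induction hypothesis is applied to
  products of values at two points x and y.\<close>

theorem multilinear_bound:
  fixes K :: "('i \<Rightarrow> real) \<Rightarrow> complex" and f :: "'i \<Rightarrow> ('i \<Rightarrow> real) \<Rightarrow> complex"
    and g :: "'i \<Rightarrow> ('i \<Rightarrow> real) \<Rightarrow> real"
  assumes "distinct (t # js)" "length js = Suc m" and "I = insert t (set js)" and "B > 0" "\<eta> > 0"
    and "K \<in> borel_measurable (PiM I M)" "\<And>z. norm (K z) \<le> BK"
    and "\<And>j. j \<in> I \<Longrightarrow> f j \<in> borel_measurable (PiM (I - {j}) M)"
    and "\<And>j. j \<in> I \<Longrightarrow> g j \<in> borel_measurable (PiM (I - {j}) M)"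
    and "\<And>j z. j \<in> I \<Longrightarrow> norm (f j z) \<le> g j z"
    and "\<And>j z. j \<in> I \<Longrightarrow> \<epsilon> \<le> g j z" and "\<And>j z. j \<in> I \<Longrightarrow> g j z \<le> L" and "\<epsilon> > 0"
    and "box_decay M t B js \<eta> K"
  shows "norm (\<integral>z. K z * (\<Prod>j\<in>I. f j (restrict z (I - {j}))) \<partial>PiM I M)
    \<le> multilinear_const m * (B / \<eta>) powr (1 / 2 ^ Suc m) *
      (\<Prod>j\<in>I. (\<integral>z. g j z powr p_exp (Suc (Suc m)) \<partial>PiM (I - {j}) M) powr (1 / p_exp (Suc (Suc m))))"
  using assms
proof (induction m arbitrary: js I K f g \<eta> \<epsilon> L BK)
  case 0
  then obtain j where js: "js = [j]" by (auto simp: length_Suc_conv)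
  have p2: "p_exp (Suc (Suc 0)) = 2" by (simp add: p_exp_def)
  show ?case
    unfolding p2 multilinear_const.simps
  proof -
    have tj: "t \<noteq> j" and Itj: "I = {t, j}" using 0 js by auto
    have one: "(2::real) ^ Suc 0 = 2" by simp
    show "norm (\<integral>z. K z * (\<Prod>j\<in>I. f j (restrict z (I - {j}))) \<partial>PiM I M)
      \<le> 2 * (B / \<eta>) powr (1 / 2 ^ Suc 0) * (\<Prod>j\<in>I. (\<integral>z. g j z powr 2 \<partial>PiM (I - {j}) M) powr (1 / 2))"
      unfolding one
      by (rule multilinear_bound_base[OF tj Itj 0(4,5,6,7,8,9,10,12) 0(14)[unfolded js]])
  qed
next
  case (Suc m)
  define n where "n = real (Suc (Suc m))"
  define a where "a = (1::real) / 2 ^ Suc m"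
  define q where "q = p_exp (Suc (Suc m))"
  define P where "P = p_exp (Suc (Suc (Suc m)))"
  note expo = exponent_identities[of m, folded n_def a_def q_def P_def]
  define \<kappa> where "\<kappa> = 2 / P - 1 / q"
  have \<kappa>: "\<kappa> > 0" unfolding \<kappa>_def by (rule expo(8))
  define H where "H = 2 * (2 / (1 - a) + 3)"
  have H: "H > 0" using expo by (simp add: H_def add_pos_pos)
  obtain i js' where js: "js = i # js'" using Suc.prems(2) by (cases js) auto
  define J where "J = insert t (set js')"
  have J: "finite J" "i \<notin> J" and I: "I = insert i J" and lenjs': "length js' = Suc m" and djs': "distinct (t # js')"
    using Suc.prems(1-3) js by (auto simp: J_def)
  have cJ: "card J = Suc (Suc m)"
    using djs' lenjs' by (simp add: J_def distinct_card)
  have JI: "J \<subseteq> I" "i \<in> I" using I by auto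
  have IiJ: "I - {i} = J" using I J by auto
  have IkJ: "I - {k} = insert i (J - {k})" if "k \<in> J" for k using I J that by auto
  note Km = Suc.prems(6) and KB = Suc.prems(7) and fm = Suc.prems(8) and gm = Suc.prems(9)
    and fg = Suc.prems(10) and g\<epsilon> = Suc.prems(11) and gL = Suc.prems(12) and \<epsilon> = Suc.prems(13)
  have gpos: "g j z > 0" if "j \<in> I" for j z using g\<epsilon>[OF that, of z] \<epsilon> by linarith
  have L: "L > 0" using gpos[OF JI(2)] gL[OF JI(2)] by (meson less_le_trans)
  have \<epsilon>L: "\<epsilon> \<le> L" using g\<epsilon>[OF JI(2)] gL[OF JI(2)] order_trans by blast
  have P2: "P > 2" and P0: "P > 0" using expo by auto
  define \<rho> where "\<rho> k v = (\<integral>x. g k (v(i := x)) powr P \<partial>M i)" for k v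
  have gupd: "(\<lambda>(v, x). g k (v(i := x))) \<in> borel_measurable (PiM (J - {k}) M \<Otimes>\<^sub>M M i)" if "k \<in> J" for k
    using gm[of k] that J JI unfolding I by (intro measurable_upd_restrict(1)) auto
  have fupd: "(\<lambda>(v, x). f k (v(i := x))) \<in> borel_measurable (PiM (J - {k}) M \<Otimes>\<^sub>M M i)" if "k \<in> J" for k
    using fm[of k] that J JI unfolding I by (intro measurable_upd_restrict(1)) auto
  have slice: "(\<lambda>v. h (v(i := x))) \<in> borel_measurable N"
    if "(\<lambda>(v, x). h (v(i := x))) \<in> borel_measurable (N \<Otimes>\<^sub>M M i)" for h :: "('i \<Rightarrow> real) \<Rightarrow> 'b::topological_space" and x N
    using measurable_compose[OF measurable_Pair2' that, of x] by simp
  have \<rho>m: "\<rho> k \<in> borel_measurable (PiM (J - {k}) M)" if "k \<in> J" for k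
  proof -
    interpret Mi: finite_measure "M i" by (rule finite_measures)
    note [measurable] = gupd[OF that]
    show ?thesis unfolding \<rho>_def by measurable
  qed
  have pi: "measure (M i) UNIV > 0" by (rule pos)
  define \<rho>0 where "\<rho>0 = \<epsilon> powr P * measure (M i) UNIV"
  define \<rho>1 where "\<rho>1 = L powr P * measure (M i) UNIV"
  have \<rho>0: "\<rho>0 > 0" using pi \<epsilon> by (simp add: \<rho>0_def)
  have \<rho>01: "\<rho>0 \<le> \<rho>1" unfolding \<rho>0_def \<rho>1_def using \<epsilon> \<epsilon>L P0 by (intro mult_right_mono powr_mono2) auto
  have \<rho>b: "\<rho>0 \<le> \<rho> k v" "\<rho> k v \<le> \<rho>1" if k: "k \<in> J" and v: "v \<in> space (PiM (J - {k}) M)" for k v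
  proof -
    interpret Mi: finite_measure "M i" by (rule finite_measures)
    have kI: "k \<in> I" using k JI by auto
    have "(\<lambda>x. g k (v(i := x))) \<in> borel_measurable (M i)"
      using measurable_compose[OF measurable_Pair1'[OF v] gupd[OF k]] by simp
    then have gi: "integrable (M i) (\<lambda>x. g k (v(i := x)) powr P)"
      using gpos[OF kI] gL[OF kI] P0 by (intro integrable_bounded[where B = "L powr P"]) (auto intro!: powr_mono2 simp: less_imp_le)
    have "(\<integral>x. \<epsilon> powr P \<partial>M i) \<le> \<rho> k v" unfolding \<rho>_def
      using gi g\<epsilon>[OF kI] \<epsilon> P0 by (intro integral_mono) (auto intro!: powr_mono2)
    then show "\<rho>0 \<le> \<rho> k v" by (simp add: \<rho>0_def mult.commute)
    have "\<rho> k v \<le> (\<integral>x. L powr P \<partial>M i)" unfolding \<rho>_def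
      using gi gL[OF kI] P0 gpos[OF kI] by (intro integral_mono) (auto intro!: powr_mono2 simp: less_imp_le)
    then show "\<rho> k v \<le> \<rho>1" by (simp add: \<rho>1_def mult.commute)
  qed
  \<comment> \<open>Clamping makes the bounds hold for every argument, as the following steps ask
    for, whereas \<rho> is controlled only on the space of the product measure.\<close>
  define r where "r k v = max \<rho>0 (min \<rho>1 (\<rho> k v))" for k v
  have rm: "r k \<in> borel_measurable (PiM (J - {k}) M)" if "k \<in> J" for k
    unfolding r_def using \<rho>m[OF that] by measurable
  have rb: "\<rho>0 \<le> r k v" "r k v \<le> \<rho>1" for k v using \<rho>01 by (auto simp: r_def)
  have rpos: "r k v > 0" for k v using rb(1)[of k v] \<rho>0 by linarith
  have r_eq: "r k v = \<rho> k v" if "k \<in> J" "v \<in> space (PiM (J - {k}) M)" for k v using \<rho>b[OF that] by (simp add: r_def)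
  define S where "S j = (\<integral>z. g j z powr P \<partial>PiM (I - {j}) M)" for j
  have S0: "S j \<ge> 0" for j unfolding S_def by auto
  have S_\<rho>: "(\<integral>v. \<rho> k v \<partial>PiM (J - {k}) M) = S k" if k: "k \<in> J" for k
  proof -
    have kI: "k \<in> I" using k JI by auto
    have gk: "g k \<in> borel_measurable (PiM (insert i (J - {k})) M)" using gm[OF kI] unfolding IkJ[OF k] .
    show ?thesis unfolding S_def \<rho>_def IkJ[OF k]
      using J gk gpos[OF kI] gL[OF kI] P0
      by (intro product_integral_insert[symmetric] integrable_PiM_bounded[where B = "L powr P"])
        (auto intro!: powr_mono2 simp: less_imp_le)
  qed
  have S_r: "(\<integral>v. r k v \<partial>PiM (J - {k}) M) = S k" if k: "k \<in> J" for k
    unfolding S_\<rho>[OF k, symmetric] using r_eq[OF k] by (intro Bochner_Integration.integral_cong) auto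
  \<comment> \<open>With this exponent the square in the first Cauchy-Schwarz factor carries the
    power \<kappa> of the weight, and the second factor the power -\<kappa>.\<close>
  define W where "W k v = r k v powr (\<kappa> / 2)" for k v
  define F where "F x y k = (\<lambda>v. f k (v(i := x)) * cnj (f k (v(i := y))) * of_real (1 / (W k v)\<^sup>2))" for x y k
  define T where "T x y = (\<integral>z. (K (z(i := x)) * cnj (K (z(i := y)))) * (\<Prod>k\<in>J. F x y k (restrict z (J - {k}))) \<partial>PiM J M)" for x y
  have Winv: "1 / (W k v)\<^sup>2 = r k v powr (- \<kappa>)" for k v
    using rpos[of k v] by (simp add: W_def powr_minus powr_power field_simps)
  have peeled: "(norm (\<integral>z. K z * (\<Prod>j\<in>I. f j (restrict z (I - {j}))) \<partial>PiM I M))\<^sup>2 \<le>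
    (\<integral>z. (g i z * (\<Prod>k\<in>J. W k (restrict z (J - {k}))))\<^sup>2 \<partial>PiM J M) * norm (\<integral>x. (\<integral>y. T x y \<partial>M i) \<partial>M i)"
    unfolding T_def F_def
  proof (rule peel[OF J I Km KB fm gm fg gL])
    show "W k \<in> borel_measurable (PiM (J - {k}) M)" if "k \<in> J" for k
      unfolding W_def using rm[OF that] by measurable
    show "\<rho>0 powr (\<kappa> / 2) \<le> W k v" "W k v \<le> \<rho>1 powr (\<kappa> / 2)" for k v
      unfolding W_def using rb \<rho>0 \<kappa> rpos[of k v] by (auto intro!: powr_mono2)
    show "\<rho>0 powr (\<kappa> / 2) > 0" using \<rho>0 by simp
  qed
  \<comment> \<open>the factor carrying \<open>f i\<close>: Hoelder and Loomis-Whitney\<close>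
  have first: "(\<integral>z. (g i z * (\<Prod>k\<in>J. W k (restrict z (J - {k}))))\<^sup>2 \<partial>PiM J M) \<le> S i powr (2 / P) * (\<Prod>k\<in>J. S k powr \<kappa>)"
  proof -
    define s where "s = 1 / (n - 1)"
    have n1: "n - 1 > 0" by (simp add: n_def)
    have s: "s > 0" using n1 by (simp add: s_def)
    \<comment> \<open>Loomis-Whitney supplies the exponent \<open>s\<close>, Hoelder against
      \<open>g i\<close> the exponent 1 - 2 / P. That their product is \<kappa> is the balancing
      identity between P and q.\<close>
    have sk: "s * (1 - 2 / P) = \<kappa>" using expo(6) by (simp add: s_def \<kappa>_def)
    define A where "A z = (\<Prod>k\<in>J. r k (restrict z (J - {k})) powr s)" for z
    have mr: "(\<lambda>z. r k (restrict z (J - {k}))) \<in> borel_measurable (PiM J M)" if "k \<in> J" for k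
      by (rule measurable_restrict_fun[OF rm[OF that]])
    have Am: "A \<in> borel_measurable (PiM J M)" unfolding A_def
      by (intro borel_measurable_prod powr_real_measurable borel_measurable_const mr)
    have A0: "A z \<ge> 0" for z unfolding A_def by (intro prod_nonneg) auto
    have AB: "A z \<le> (\<Prod>k\<in>J. \<rho>1 powr s)" for z unfolding A_def
      using rb rpos s by (intro prod_mono conjI powr_mono2) (auto simp: less_imp_le)
    have gim: "g i \<in> borel_measurable (PiM J M)" using gm[OF JI(2)] IiJ by simp
    have "(g i z * (\<Prod>k\<in>J. W k (restrict z (J - {k}))))\<^sup>2 = (g i z powr P) powr (2 / P) * A z powr (1 - 2 / P)" for z
    proof -
      have "(W k v)\<^sup>2 = r k v powr \<kappa>" for k v
        using rpos[of k v] by (simp add: W_def powr_power)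
      then have "(\<Prod>k\<in>J. W k (restrict z (J - {k})))\<^sup>2 = A z powr (1 - 2 / P)"
        unfolding A_def by (simp add: prod_power_distrib prod_powr_distrib powr_powr sk)
      moreover have "(g i z powr P) powr (2 / P) = (g i z)\<^sup>2"
        using P0 gpos[OF JI(2), of z] by (simp add: powr_powr)
      ultimately show ?thesis by (simp add: power_mult_distrib)
    qed
    then have "(\<integral>z. (g i z * (\<Prod>k\<in>J. W k (restrict z (J - {k}))))\<^sup>2 \<partial>PiM J M)
       = (\<integral>z. (g i z powr P) powr (2 / P) * A z powr (1 - 2 / P) \<partial>PiM J M)" by simp
    also have "\<dots> \<le> (\<integral>z. g i z powr P \<partial>PiM J M) powr (2 / P) * (\<integral>z. A z \<partial>PiM J M) powr (1 - 2 / P)"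
      using P2 gim Am A0 AB gpos[OF JI(2)] gL[OF JI(2)] J
      by (intro Holder_2 integrable_PiM_bounded[where B = "L powr P"] integrable_PiM_bounded[where B = "\<Prod>k\<in>J. \<rho>1 powr s"])
        (auto intro!: powr_mono2 simp: less_imp_le)
    also have "(\<integral>z. g i z powr P \<partial>PiM J M) = S i" unfolding S_def IiJ ..
    finally have le: "(\<integral>z. (g i z * (\<Prod>k\<in>J. W k (restrict z (J - {k}))))\<^sup>2 \<partial>PiM J M)
       \<le> S i powr (2 / P) * (\<integral>z. A z \<partial>PiM J M) powr (1 - 2 / P)" .
    have "(\<integral>z. A z \<partial>PiM J M) \<le> (\<Prod>k\<in>J. (\<integral>v. r k v \<partial>PiM (J - {k}) M) powr s)"
    proof -
      have se: "s = 1 / real (card J - 1)" by (simp add: s_def cJ n_def)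
      have "bounded_fun (r k)" for k unfolding bounded_fun_def
        using rb rpos[of k] by (intro exI[of _ \<rho>1]) (auto simp: less_imp_le abs_of_pos)
      then show ?thesis unfolding A_def se
        using J cJ rm rpos by (intro Loomis_Whitney) (auto simp: less_imp_le)
    qed
    also have "(\<Prod>k\<in>J. (\<integral>v. r k v \<partial>PiM (J - {k}) M) powr s) = (\<Prod>k\<in>J. S k powr s)"
      by (intro prod.cong refl) (simp add: S_r)
    finally have "(\<integral>z. A z \<partial>PiM J M) powr (1 - 2 / P) \<le> (\<Prod>k\<in>J. S k powr s) powr (1 - 2 / P)"
      using P2 A0 by (intro powr_mono2) (auto intro!: integral_nonneg_AE)
    with le have "(\<integral>z. (g i z * (\<Prod>k\<in>J. W k (restrict z (J - {k}))))\<^sup>2 \<partial>PiM J M)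
       \<le> S i powr (2 / P) * (\<Prod>k\<in>J. S k powr s) powr (1 - 2 / P)"
      by (rule order.trans[OF _ mult_left_mono]) simp
    also have "(\<Prod>k\<in>J. S k powr s) powr (1 - 2 / P) = (\<Prod>k\<in>J. S k powr \<kappa>)"
      by (simp add: prod_powr_distrib powr_powr sk)
    finally show ?thesis .
  qed
  \<comment> \<open>the remaining factor: induction hypothesis and Hardy-Littlewood-Sobolev\<close>
  define G where "G x y k = (\<lambda>v. g k (v(i := x)) * g k (v(i := y)) * r k v powr (- \<kappa>))" for x y k
  define A where "A k p = (\<integral>v. (g k (v(i := fst p)) * g k (v(i := snd p)) * \<rho> k v powr (- (2 / P - 1 / q))) powr q \<partial>PiM (J - {k}) M)" for k p
  define c where "c = multilinear_const m * (B / \<eta>) powr a"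
  have c0: "c \<ge> 0" unfolding c_def using multilinear_const_pos[of m] by simp
  define Pr where "Pr p = (\<Prod>k\<in>J. A k p powr (1 / q))" for p
  have AG: "A k (x, y) = (\<integral>v. G x y k v powr q \<partial>PiM (J - {k}) M)" if "k \<in> J" for k x y
    unfolding A_def G_def using r_eq[OF that] by (intro Bochner_Integration.integral_cong) (auto simp: \<kappa>_def)
  have Tb: "norm (T x y) \<le> c * \<bar>x - y\<bar> powr (- a) * Pr (x, y)" if xy: "x \<noteq> y" for x y
  proof -
    define GL where "GL = L * L * \<rho>0 powr (- \<kappa>)"
    define G\<epsilon> where "G\<epsilon> = \<epsilon> * \<epsilon> * \<rho>1 powr (- \<kappa>)"
    \<comment> \<open>The difference in the removed variable turns \<eta> into \<eta> |x - y|, so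
      the induction hypothesis yields the kernel |x - y| powr (-a) with a = 1 / 2 ^ Suc m.\<close>
    have "norm (T x y) \<le> multilinear_const m * (B / (\<eta> * \<bar>x - y\<bar>)) powr (1 / 2 ^ Suc m) *
      (\<Prod>k\<in>J. (\<integral>v. G x y k v powr p_exp (Suc (Suc m)) \<partial>PiM (J - {k}) M) powr (1 / p_exp (Suc (Suc m))))"
      unfolding T_def
    proof (rule Suc.IH[OF djs' lenjs' J_def Suc.prems(4)])
      show "0 < \<eta> * \<bar>x - y\<bar>" using xy Suc.prems(5) by simp
      have Ku: "(\<lambda>(z, x). K (z(i := x))) \<in> borel_measurable (PiM J M \<Otimes>\<^sub>M M i)"
        using Km J unfolding I by (intro measurable_upd_PiM) auto
      show "(\<lambda>z. K (z(i := x)) * cnj (K (z(i := y)))) \<in> borel_measurable (PiM J M)"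
        using slice[OF Ku, of x] slice[OF Ku, of y] by measurable
      have BK0: "0 \<le> BK" using KB[of undefined] norm_ge_zero order_trans by blast
      show "norm (K (z(i := x)) * cnj (K (z(i := y)))) \<le> BK * BK" for z
        unfolding norm_mult complex_mod_cnj using KB BK0 by (intro mult_mono) auto
      show "box_decay M t B js' (\<eta> * \<bar>x - y\<bar>) (\<lambda>z. K (z(i := x)) * cnj (K (z(i := y))))"
        using Suc.prems(14) xy by (simp add: js)
      fix k assume k: "k \<in> J"
      then have kI: "k \<in> I" using JI by auto
      note gx = slice[OF gupd[OF k], of x] slice[OF gupd[OF k], of y]
      note fx = slice[OF fupd[OF k], of x] slice[OF fupd[OF k], of y]
      show "F x y k \<in> borel_measurable (PiM (J - {k}) M)"
        unfolding F_def Winv using fx rm[OF k] by measurable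
      show "G x y k \<in> borel_measurable (PiM (J - {k}) M)"
        unfolding G_def using gx rm[OF k] by measurable
      fix v
      show "norm (F x y k v) \<le> G x y k v"
        unfolding F_def G_def Winv norm_mult complex_mod_cnj norm_of_real
        using fg[OF kI] gpos[OF kI] by (intro mult_mono) (auto simp: less_imp_le)
      show "G x y k v \<le> GL"
        unfolding G_def GL_def using gL[OF kI] gpos[OF kI] L rb \<rho>0 \<kappa>
        by (intro mult_mono powr_mono2') (auto simp: less_imp_le)
      show "G\<epsilon> \<le> G x y k v"
        unfolding G_def G\<epsilon>_def using g\<epsilon>[OF kI] gpos[OF kI] \<epsilon> rb rpos \<kappa>
        by (intro mult_mono powr_mono2') (auto simp: less_imp_le)
    next
      show "G\<epsilon> > 0" unfolding G\<epsilon>_def using \<epsilon> \<rho>0 \<rho>01 by simp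
    qed
    also have "(B / (\<eta> * \<bar>x - y\<bar>)) powr (1 / 2 ^ Suc m) = (B / \<eta>) powr a * \<bar>x - y\<bar> powr (- a)"
    proof -
      have "(B / (\<eta> * \<bar>x - y\<bar>)) powr a = ((B / \<eta>) / \<bar>x - y\<bar>) powr a" by simp
      also have "\<dots> = (B / \<eta>) powr a * \<bar>x - y\<bar> powr (- a)"
        using Suc.prems(4,5) by (simp only: powr_divide powr_minus_divide) simp
      finally show ?thesis by (simp add: a_def)
    qed
    also have "(\<Prod>k\<in>J. (\<integral>v. G x y k v powr p_exp (Suc (Suc m)) \<partial>PiM (J - {k}) M) powr (1 / p_exp (Suc (Suc m)))) = Pr (x, y)"
      unfolding Pr_def q_def[symmetric] by (intro prod.cong refl) (simp add: AG)
    finally show ?thesis by (simp add: c_def mult_ac)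
  qed
  interpret Mi: dominated_by_lborel "M i" by (rule dominated)
  interpret R: finite_measure "Mi.riesz a" using expo(1,2) by (rule Mi.finite_riesz)
  have pb: "A k \<in> borel_measurable (borel \<Otimes>\<^sub>M borel)" "\<exists>B. \<forall>p. 0 \<le> A k p \<and> A k p \<le> B"
      "(\<integral>p. A k p powr (n / q) \<partial>Mi.riesz a) \<le> H * (\<integral>v. \<rho> k v \<partial>PiM (J - {k}) M) powr (n / q)" if k: "k \<in> J" for k
  proof -
    have kI: "k \<in> I" using k JI by auto
    have fin: "finite_measure (PiM (J - {k}) M)" using J by (intro finite_PiM) auto
    have n0: "n > 0" by (simp add: n_def)
    note pb = Mi.pair_bound[where g = "\<lambda>v x. g k (v(i := x))" and \<rho> = "\<rho> k" and A = "A k" and P = P and q = q and a = a and n = n and \<epsilon> = \<epsilon> and L = L,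
        OF fin gupd[OF k] g\<epsilon>[OF kI] gL[OF kI] \<epsilon> pi expo(1,2) n0 expo(5,3,4) \<rho>_def A_def]
    show "A k \<in> borel_measurable (borel \<Otimes>\<^sub>M borel)" "\<exists>B. \<forall>p. 0 \<le> A k p \<and> A k p \<le> B"
      "(\<integral>p. A k p powr (n / q) \<partial>Mi.riesz a) \<le> H * (\<integral>v. \<rho> k v \<partial>PiM (J - {k}) M) powr (n / q)"
      using pb unfolding H_def by blast+
  qed
  have n0: "n > 0" by (simp add: n_def)
  have A0: "A k p \<ge> 0" for k p unfolding A_def by (intro integral_nonneg_AE) auto
  have iA: "integrable (Mi.riesz a) (\<lambda>p. A k p powr (n / q))" if k: "k \<in> J" for k
  proof -
    obtain BA where "\<And>p. A k p \<le> BA" using pb(2)[OF k] by blast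
    then show ?thesis using pb(1)[OF k] A0 expo(3) n0
      by (intro R.integrable_const_bound[where B = "BA powr (n / q)"]) (auto intro!: AE_I2 powr_mono2)
  qed
  \<comment> \<open>There are n functions left and each gets the exponent 1/n: Hoelder with respect
    to \<open>riesz\<close> reduces the product to one application of \<open>pair_bound\<close> for
    each k.\<close>
  have Preq: "Pr p = (\<Prod>k\<in>J. (A k p powr (n / q)) powr (1 / n))" for p
    unfolding Pr_def using n0 by (simp add: powr_powr)
  have Jne: "J \<noteq> {}" using cJ by auto
  have sumn: "(\<Sum>k\<in>J. 1 / n) = 1" by (simp add: cJ n_def)
  have iPi: "integrable (Mi.riesz a) Pr" unfolding Preq
    using J Jne n0 sumn iA by (intro Holder_prod(1)) auto
  have Pr0: "Pr p \<ge> 0" for p unfolding Pr_def by (intro prod_nonneg) auto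
  have "(\<integral>p. Pr p \<partial>Mi.riesz a) \<le> (\<Prod>k\<in>J. (\<integral>p. A k p powr (n / q) \<partial>Mi.riesz a) powr (1 / n))" unfolding Preq
    using J Jne n0 sumn iA by (intro Holder_prod(2)) auto
  also have "\<dots> \<le> (\<Prod>k\<in>J. H powr (1 / n) * S k powr (1 / q))"
  proof (rule prod_mono, rule conjI)
    fix k assume k: "k \<in> J"
    have "(\<integral>p. A k p powr (n / q) \<partial>Mi.riesz a) powr (1 / n) \<le> (H * S k powr (n / q)) powr (1 / n)"
      using pb(3)[OF k] n0 unfolding S_\<rho>[OF k] by (intro powr_mono2) auto
    also have "\<dots> = H powr (1 / n) * S k powr (1 / q)"
      using n0 H by (simp add: powr_mult powr_powr)
    finally show "(\<integral>p. A k p powr (n / q) \<partial>Mi.riesz a) powr (1 / n) \<le> H powr (1 / n) * S k powr (1 / q)" .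
  qed simp
  also have "\<dots> = H * (\<Prod>k\<in>J. S k powr (1 / q))"
  proof -
    have "(\<Prod>k\<in>J. H powr (1 / n)) = H powr (\<Sum>k\<in>J. 1 / n)"
      using H by (intro powr_sum[symmetric]) auto
    also have "\<dots> = H" unfolding sumn using H by simp
    finally show ?thesis by (simp only: prod.distrib)
  qed
  finally have Pi_le: "(\<integral>p. Pr p \<partial>Mi.riesz a) \<le> H * (\<Prod>k\<in>J. S k powr (1 / q))" .
  have Prm: "Pr \<in> borel_measurable (borel \<Otimes>\<^sub>M borel)"
    unfolding Pr_def by (intro borel_measurable_prod powr_real_measurable pb(1)) auto
  have "ennreal (norm (\<integral>x. (\<integral>y. T x y \<partial>M i) \<partial>M i)) \<le> (\<integral>\<^sup>+x. (\<integral>\<^sup>+y. ennreal (\<bar>x - y\<bar> powr (- a)) * ennreal (c * Pr (x, y)) \<partial>M i) \<partial>M i)"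
  proof (rule order.trans[OF ennreal_norm_integral_le nn_integral_mono])
    fix x
    show "ennreal (norm (\<integral>y. T x y \<partial>M i)) \<le> (\<integral>\<^sup>+y. ennreal (\<bar>x - y\<bar> powr (- a)) * ennreal (c * Pr (x, y)) \<partial>M i)"
    proof (rule order.trans[OF ennreal_norm_integral_le nn_integral_mono_AE])
      show "AE y in M i. ennreal (norm (T x y)) \<le> ennreal (\<bar>x - y\<bar> powr (- a)) * ennreal (c * Pr (x, y))"
        using AE_neq[of x i]
      proof eventually_elim
        case (elim y)
        from Tb[OF elim] show ?case
          using c0 Pr0 by (subst ennreal_mult[symmetric]) (auto intro!: ennreal_leI simp: mult_ac)
      qed
    qed
  qed
  also have "\<dots> = (\<integral>\<^sup>+p. ennreal (c * Pr p) \<partial>Mi.riesz a)"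
    using Prm by (subst Mi.nn_integral_riesz) auto
  also have "\<dots> = ennreal (c * (\<integral>p. Pr p \<partial>Mi.riesz a))"
    using iPi c0 Pr0 by (subst nn_integral_eq_integral) auto
  finally have "norm (\<integral>x. (\<integral>y. T x y \<partial>M i) \<partial>M i) \<le> c * (\<integral>p. Pr p \<partial>Mi.riesz a)"
    using c0 Pr0 by (subst (asm) ennreal_le_iff) (auto intro!: mult_nonneg_nonneg integral_nonneg_AE)
  also have "\<dots> \<le> c * (H * (\<Prod>k\<in>J. S k powr (1 / q)))" by (intro mult_left_mono Pi_le c0)
  finally have second: "norm (\<integral>x. (\<integral>y. T x y \<partial>M i) \<partial>M i) \<le> c * (H * (\<Prod>k\<in>J. S k powr (1 / q)))" .
  have "(norm (\<integral>z. K z * (\<Prod>j\<in>I. f j (restrict z (I - {j}))) \<partial>PiM I M))\<^sup>2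
    \<le> (S i powr (2 / P) * (\<Prod>k\<in>J. S k powr \<kappa>)) * (c * (H * (\<Prod>k\<in>J. S k powr (1 / q))))"
    using peeled first second by (rule order.trans[OF _ mult_mono]) (auto intro!: mult_nonneg_nonneg prod_nonneg)
  also have "\<dots> = c * H * (S i powr (2 / P) * (\<Prod>k\<in>J. S k powr \<kappa> * S k powr (1 / q)))"
    by (simp add: prod.distrib mult_ac)
  \<comment> \<open>The power \<kappa> from the first factor and 1/q from the second add up to 2/P,
    the power with which \<open>f i\<close> enters, so that all functions end up on the same
    footing.\<close>
  also have "(\<Prod>k\<in>J. S k powr \<kappa> * S k powr (1 / q)) = (\<Prod>k\<in>J. S k powr (2 / P))"
    by (intro prod.cong refl) (simp add: powr_add[symmetric] \<kappa>_def)
  also have "S i powr (2 / P) * (\<Prod>k\<in>J. S k powr (2 / P)) = (\<Prod>j\<in>I. S j powr (2 / P))"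
    unfolding I using J by simp
  also have "c * H * (\<Prod>j\<in>I. S j powr (2 / P)) =
     (multilinear_const (Suc m) * (B / \<eta>) powr (1 / 2 ^ Suc (Suc m)) * (\<Prod>j\<in>I. S j powr (1 / P)))\<^sup>2"
  proof -
    have 1: "((B / \<eta>) powr (1 / 2 ^ Suc (Suc m)))\<^sup>2 = (B / \<eta>) powr a"
      by (simp add: a_def power2_eq_square powr_add[symmetric])
    have 2: "(multilinear_const (Suc m))\<^sup>2 = multilinear_const m * H"
      using multilinear_const_pos[of m] H by (simp add: H_def a_def)
    have 3: "(\<Prod>j\<in>I. S j powr (1 / P))\<^sup>2 = (\<Prod>j\<in>I. S j powr (2 / P))"
      unfolding prod_power_distrib by (intro prod.cong refl) (simp add: power2_eq_square powr_add[symmetric])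
    show ?thesis unfolding power_mult_distrib 1 2 3 by (simp add: c_def mult_ac)
  qed
  finally have "norm (\<integral>z. K z * (\<Prod>j\<in>I. f j (restrict z (I - {j}))) \<partial>PiM I M)
    \<le> multilinear_const (Suc m) * (B / \<eta>) powr (1 / 2 ^ Suc (Suc m)) * (\<Prod>j\<in>I. S j powr (1 / P))"
    by (rule power2_le_imp_le)
      (intro mult_nonneg_nonneg prod_nonneg ballI powr_ge_zero less_imp_le[OF multilinear_const_pos])
  then show ?case by (simp only: S_def P_def)
qed


text \<open>The majorants norm (f j z) + 1 / (k + 1) are admissible for the theorem; dominated
  convergence removes the added constant.\<close>

corollary multilinear_bound_bounded:
  fixes K :: "('i \<Rightarrow> real) \<Rightarrow> complex" and f :: "'i \<Rightarrow> ('i \<Rightarrow> real) \<Rightarrow> complex"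
  assumes js: "distinct (t # js)" "length js = Suc m" and I: "I = insert t (set js)" and B: "B > 0" "\<eta> > 0"
    and K: "K \<in> borel_measurable (PiM I M)" "\<And>z. norm (K z) \<le> BK"
    and f: "\<And>j. j \<in> I \<Longrightarrow> f j \<in> borel_measurable (PiM (I - {j}) M)"
    and fL: "\<And>j z. j \<in> I \<Longrightarrow> norm (f j z) \<le> L"
    and dec: "box_decay M t B js \<eta> K"
  shows "norm (\<integral>z. K z * (\<Prod>j\<in>I. f j (restrict z (I - {j}))) \<partial>PiM I M)
    \<le> multilinear_const m * (B / \<eta>) powr (1 / 2 ^ Suc m) *
      (\<Prod>j\<in>I. (\<integral>z. norm (f j z) powr p_exp (Suc (Suc m)) \<partial>PiM (I - {j}) M) powr (1 / p_exp (Suc (Suc m))))"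
proof -
  define P where "P = p_exp (Suc (Suc m))"
  have P: "P > 0" using exponent_identities(3)[of m] by (simp add: P_def)
  have finI: "finite I" using I by simp
  have L0: "0 \<le> L" using fL[of t undefined] I norm_ge_zero order_trans by blast
  define \<epsilon> where "\<epsilon> k = 1 / real (Suc k)" for k
  have \<epsilon>: "\<epsilon> k > 0" "\<epsilon> k \<le> 1" for k by (auto simp: \<epsilon>_def)
  have \<epsilon>lim: "\<epsilon> \<longlonglongrightarrow> 0" unfolding \<epsilon>_def by (rule LIMSEQ_Suc[OF lim_1_over_n])
  define S where "S k j = (\<integral>z. (norm (f j z) + \<epsilon> k) powr P \<partial>PiM (I - {j}) M)" for k j
  have bound: "norm (\<integral>z. K z * (\<Prod>j\<in>I. f j (restrict z (I - {j}))) \<partial>PiM I M)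
    \<le> multilinear_const m * (B / \<eta>) powr (1 / 2 ^ Suc m) * (\<Prod>j\<in>I. S k j powr (1 / P))" for k
    unfolding S_def P_def
  proof (rule multilinear_bound[OF js I B K f])
    show "(\<lambda>z. norm (f j z) + \<epsilon> k) \<in> borel_measurable (PiM (I - {j}) M)" if "j \<in> I" for j
      using f[OF that] by measurable
    show "norm (f j z) + \<epsilon> k \<le> L + \<epsilon> k" if "j \<in> I" for j z using fL[OF that] by simp
  qed (use \<epsilon>[of k] dec in auto)
  have lim: "(\<lambda>k. S k j) \<longlonglongrightarrow> (\<integral>z. norm (f j z) powr P \<partial>PiM (I - {j}) M)" if j: "j \<in> I" for j
    unfolding S_def
  proof (rule integral_dominated_convergence[where w = "\<lambda>_. (L + 1) powr P"])
    note [measurable] = f[OF j]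
    show "(\<lambda>z. norm (f j z) powr P) \<in> borel_measurable (PiM (I - {j}) M)" by measurable
    show "(\<lambda>z. (norm (f j z) + \<epsilon> k) powr P) \<in> borel_measurable (PiM (I - {j}) M)" for k by measurable
    show "integrable (PiM (I - {j}) M) (\<lambda>_. (L + 1) powr P)"
      using finI by (intro integrable_PiM_bounded[where B = "(L + 1) powr P"]) auto
    show "AE z in PiM (I - {j}) M. (\<lambda>k. (norm (f j z) + \<epsilon> k) powr P) \<longlonglongrightarrow> norm (f j z) powr P"
    proof (rule AE_I2)
      fix z
      have "(\<lambda>k. norm (f j z) + \<epsilon> k) \<longlonglongrightarrow> norm (f j z) + 0" by (intro tendsto_intros \<epsilon>lim)
      then show "(\<lambda>k. (norm (f j z) + \<epsilon> k) powr P) \<longlonglongrightarrow> norm (f j z) powr P"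
        using P \<epsilon> by (intro tendsto_powr' tendsto_const) (auto intro!: always_eventually add_nonneg_nonneg less_imp_le)
    qed
    show "AE z in PiM (I - {j}) M. norm ((norm (f j z) + \<epsilon> k) powr P) \<le> (L + 1) powr P" for k
    proof (rule AE_I2)
      fix z
      have "(norm (f j z) + \<epsilon> k) powr P \<le> (L + 1) powr P"
        using fL[OF j, of z] \<epsilon>[of k] P by (intro powr_mono2 add_mono) auto
      then show "norm ((norm (f j z) + \<epsilon> k) powr P) \<le> (L + 1) powr P" by simp
    qed
  qed
  have "(\<lambda>k. multilinear_const m * (B / \<eta>) powr (1 / 2 ^ Suc m) * (\<Prod>j\<in>I. S k j powr (1 / P))) \<longlonglongrightarrow>
    multilinear_const m * (B / \<eta>) powr (1 / 2 ^ Suc m) * (\<Prod>j\<in>I. (\<integral>z. norm (f j z) powr P \<partial>PiM (I - {j}) M) powr (1 / P))"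
    using P by (intro tendsto_mult tendsto_const tendsto_prod tendsto_powr' lim)
      (auto simp: S_def intro!: always_eventually integral_nonneg_AE)
  then show ?thesis unfolding P_def[symmetric]
    by (rule LIMSEQ_le_const) (use bound in auto)
qed

end

section \<open>Box kernels of oscillatory integrals\<close>

text \<open>Dividing by the phase derivative and integrating by parts twice; the boundary terms
  vanish because \<open>a\<close> and \<open>a1\<close> do. The derivatives of \<open>D\<close> are
  measured relative to m and those of \<open>a\<close> relative to c, each order costing a factor
  \<beta>. The two steps thus gain (\<beta> / (lam * m))^2 with a constant that depends on C only,
  and the trivial bound supplies the minimum with 1.\<close>

lemma oscillatory_integral_bound:
  fixes \<Phi> D D1 D2 :: "real \<Rightarrow> real" and a a1 a2 :: "real \<Rightarrow> complex"
  assumes pq: "p < q"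
    and D: "\<And>t. t \<in> {p..q} \<Longrightarrow> (\<Phi> has_real_derivative D t) (at t within {p..q})"
      "\<And>t. t \<in> {p..q} \<Longrightarrow> (D has_real_derivative D1 t) (at t within {p..q})"
      "\<And>t. t \<in> {p..q} \<Longrightarrow> (D1 has_real_derivative D2 t) (at t within {p..q})"
      "continuous_on {p..q} D2"
    and Db: "\<And>t. t \<in> {p..q} \<Longrightarrow> m \<le> \<bar>D t\<bar>" "\<And>t. t \<in> {p..q} \<Longrightarrow> \<bar>D1 t\<bar> \<le> C * m * \<beta>"
      "\<And>t. t \<in> {p..q} \<Longrightarrow> \<bar>D2 t\<bar> \<le> C * m * \<beta>\<^sup>2"
    and a: "\<And>t. t \<in> {p..q} \<Longrightarrow> (a has_vector_derivative a1 t) (at t within {p..q})"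
      "\<And>t. t \<in> {p..q} \<Longrightarrow> (a1 has_vector_derivative a2 t) (at t within {p..q})"
      "continuous_on {p..q} a2"
    and ab: "\<And>t. t \<in> {p..q} \<Longrightarrow> norm (a t) \<le> c" "\<And>t. t \<in> {p..q} \<Longrightarrow> norm (a1 t) \<le> c * \<beta>"
      "\<And>t. t \<in> {p..q} \<Longrightarrow> norm (a2 t) \<le> c * \<beta>\<^sup>2"
    and a0: "a p = 0" "a q = 0" "a1 p = 0" "a1 q = 0"
    and pos: "m > 0" "\<beta> > 0" "C \<ge> 0" "lam > 0"
  shows "norm (integral {p..q} (\<lambda>t. exp (\<i> * of_real (lam * \<Phi> t)) * a t))
    \<le> (q - p) * (1 + 4 * C + 3 * C\<^sup>2) * c * min 1 (1 / (lam * m / \<beta>)\<^sup>2)"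
proof -
  define u where "u t = exp (\<i> * of_real (lam * \<Phi> t))" for t
  define E where "E t = 1 / D t" for t
  define E1 where "E1 t = - D1 t / (D t)\<^sup>2" for t
  define E2 where "E2 t = - D2 t / (D t)\<^sup>2 + 2 * (D1 t)\<^sup>2 / (D t) ^ 3" for t
  define b1 where "b1 t = E t *\<^sub>R a1 t + E1 t *\<^sub>R a t" for t
  define b2 where "b2 t = (E t *\<^sub>R a2 t + E1 t *\<^sub>R a1 t) + (E1 t *\<^sub>R a1 t + E2 t *\<^sub>R a t)" for t
  define d1 where "d1 t = E t *\<^sub>R b2 t + E1 t *\<^sub>R b1 t" for t
  \<comment> \<open>The terms 1 + 3 * C + 2 * \<open>C\<^sup>2\<close> come from \<open>E\<close>
    times \<open>b2\<close>, and C * (1 + C) from \<open>E1\<close> times \<open>b1\<close>.\<close>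
  define \<kappa> where "\<kappa> = 1 + 4 * C + 3 * C\<^sup>2"
  have \<kappa>: "\<kappa> \<ge> 1" using pos by (simp add: \<kappa>_def)
  have c0: "0 \<le> c"
  proof -
    have "norm (a p) \<le> c" using pq by (intro ab(1)) auto
    then show ?thesis using norm_ge_zero[of "a p"] by linarith
  qed
  have D0: "D t \<noteq> 0" if "t \<in> {p..q}" for t using Db(1)[OF that] pos by auto
  have nu: "norm (u t) = 1" for t unfolding u_def by (rule norm_exp_i_times)
  have du: "(u has_vector_derivative (\<i> * of_real (lam * D t)) * u t) (at t within {p..q})" if "t \<in> {p..q}" for t
  proof -
    have "((\<lambda>t. lam * \<Phi> t) has_real_derivative lam * D t) (at t within {p..q})"
      by (rule DERIV_cmult[OF D(1)[OF that]])
    then have "((\<lambda>t. complex_of_real (lam * \<Phi> t)) has_vector_derivative of_real (lam * D t)) (at t within {p..q})"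
      by (rule has_vector_derivative_of_real)
    then have v: "((\<lambda>t. \<i> * of_real (lam * \<Phi> t)) has_vector_derivative \<i> * of_real (lam * D t)) (at t within {p..q})"
      by (rule has_vector_derivative_mult_right)
    have "(exp has_field_derivative exp (\<i> * of_real (lam * \<Phi> t))) (at (\<i> * of_real (lam * \<Phi> t)) within (\<lambda>t. \<i> * of_real (lam * \<Phi> t)) ` {p..q})"
      by (rule has_field_derivative_at_within[OF DERIV_exp])
    from field_vector_diff_chain_within[OF v this] show ?thesis by (simp add: u_def[abs_def] o_def)
  qed
  have dE: "(E has_real_derivative E1 t) (at t within {p..q})" if "t \<in> {p..q}" for t
    unfolding E_def E1_def using D(2)[OF that] D0[OF that]
    by (auto intro!: derivative_eq_intros simp: power2_eq_square)
  have dE1: "(E1 has_real_derivative E2 t) (at t within {p..q})" if "t \<in> {p..q}" for t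
  proof -
    have sq: "((\<lambda>t. (D t)\<^sup>2) has_real_derivative 2 * D t * D1 t) (at t within {p..q})"
      using DERIV_power[OF D(2)[OF that], of 2] by (simp add: mult_ac)
    have "(E1 has_real_derivative (- D2 t * (D t)\<^sup>2 - (- D1 t) * (2 * D t * D1 t)) / ((D t)\<^sup>2 * (D t)\<^sup>2)) (at t within {p..q})"
      unfolding E1_def by (rule DERIV_divide[OF DERIV_minus[OF D(3)[OF that]] sq]) (use D0[OF that] in simp)
    also have "(- D2 t * (D t)\<^sup>2 - (- D1 t) * (2 * D t * D1 t)) / ((D t)\<^sup>2 * (D t)\<^sup>2) = E2 t"
      using D0[OF that] by (simp add: E2_def field_simps power2_eq_square power3_eq_cube)
    finally show ?thesis .
  qed
  have db: "((\<lambda>t. E t *\<^sub>R a t) has_vector_derivative b1 t) (at t within {p..q})" if "t \<in> {p..q}" for t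
    unfolding b1_def by (rule has_vector_derivative_scaleR[OF dE[OF that] a(1)[OF that]])
  have db1: "(b1 has_vector_derivative b2 t) (at t within {p..q})" if "t \<in> {p..q}" for t
    unfolding b1_def b2_def
    by (intro has_vector_derivative_add has_vector_derivative_scaleR dE dE1 a that)
  have dd: "((\<lambda>t. E t *\<^sub>R b1 t) has_vector_derivative d1 t) (at t within {p..q})" if "t \<in> {p..q}" for t
    unfolding d1_def by (rule has_vector_derivative_scaleR[OF dE[OF that] db1[OF that]])
  have step: "(\<i> * of_real lam) * integral {p..q} (\<lambda>t. u t * g t) = - integral {p..q} (\<lambda>t. u t * g1 t)"
    if dg: "\<And>t. t \<in> {p..q} \<Longrightarrow> ((\<lambda>t. E t *\<^sub>R g t) has_vector_derivative g1 t) (at t within {p..q})"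
      and cg: "continuous_on {p..q} g" "continuous_on {p..q} g1" and g0: "g p = 0" "g q = 0" for g g1
  proof -
    have cu: "continuous_on {p..q} u"
      by (rule continuous_on_vector_derivative[OF du])
    have "((\<lambda>t. u t * (E t *\<^sub>R g t)) has_vector_derivative (\<i> * of_real lam) * (u t * g t) + u t * g1 t) (at t within {p..q})"
      if t: "t \<in> {p..q}" for t
    proof -
      have "((\<lambda>t. u t * (E t *\<^sub>R g t)) has_vector_derivative u t * g1 t + ((\<i> * of_real (lam * D t)) * u t) * (E t *\<^sub>R g t)) (at t within {p..q})"
        by (rule has_vector_derivative_mult[OF du[OF t] dg[OF t]])
      also have "((\<i> * of_real (lam * D t)) * u t) * (E t *\<^sub>R g t) = (\<i> * of_real lam) * (u t * g t)"
        using D0[OF t] by (simp add: E_def scaleR_conv_of_real)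
      finally show ?thesis by (simp add: add.commute)
    qed
    then have "((\<lambda>t. (\<i> * of_real lam) * (u t * g t) + u t * g1 t) has_integral u q * (E q *\<^sub>R g q) - u p * (E p *\<^sub>R g p)) {p..q}"
      using pq by (intro fundamental_theorem_of_calculus) auto
    then have "integral {p..q} (\<lambda>t. (\<i> * of_real lam) * (u t * g t) + u t * g1 t) = 0"
      using g0 by (simp add: integral_unique)
    moreover have "integral {p..q} (\<lambda>t. (\<i> * of_real lam) * (u t * g t) + u t * g1 t) =
        integral {p..q} (\<lambda>t. (\<i> * of_real lam) * (u t * g t)) + integral {p..q} (\<lambda>t. u t * g1 t)"
      using cu cg by (intro Henstock_Kurzweil_Integration.integral_add integrable_continuous_interval continuous_intros)
    moreover have "integral {p..q} (\<lambda>t. (\<i> * of_real lam) * (u t * g t)) = (\<i> * of_real lam) * integral {p..q} (\<lambda>t. u t * g t)"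
      by (rule integral_mult_right)
    ultimately show ?thesis by (simp add: add_eq_0_iff)
  qed
  have ca: "continuous_on {p..q} a" "continuous_on {p..q} a1" "continuous_on {p..q} b1"
    using continuous_on_vector_derivative[OF a(1)] continuous_on_vector_derivative[OF a(2)]
      continuous_on_vector_derivative[OF db1] by auto
  have cD: "continuous_on {p..q} D" "continuous_on {p..q} D1"
    using DERIV_continuous_on[OF D(2)] DERIV_continuous_on[OF D(3)] by auto
  have cE: "continuous_on {p..q} E" "continuous_on {p..q} E1" "continuous_on {p..q} E2"
    unfolding E_def E1_def E2_def using D0 by (auto intro!: continuous_intros cD D(4))
  have cd1: "continuous_on {p..q} d1"
    unfolding d1_def b2_def using ca cE a(3) by (intro continuous_intros)
  have b10: "b1 p = 0" "b1 q = 0" using a0 by (auto simp: b1_def)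
  have eq: "(\<i> * of_real lam) * ((\<i> * of_real lam) * integral {p..q} (\<lambda>t. u t * a t)) = integral {p..q} (\<lambda>t. u t * d1 t)"
  proof -
    have s1: "(\<i> * of_real lam) * integral {p..q} (\<lambda>t. u t * a t) = - integral {p..q} (\<lambda>t. u t * b1 t)"
      by (rule step[OF db ca(1) ca(3) a0(1) a0(2)])
    have s2: "(\<i> * of_real lam) * integral {p..q} (\<lambda>t. u t * b1 t) = - integral {p..q} (\<lambda>t. u t * d1 t)"
      by (rule step[OF dd ca(3) cd1 b10])
    show ?thesis by (simp only: s1 s2 mult_minus_right minus_minus)
  qed
  have d1b: "norm (d1 t) \<le> \<kappa> * c * (\<beta> / m)\<^sup>2" if t: "t \<in> {p..q}" for t
  proof -
    have Dm: "\<bar>D t\<bar> \<ge> m" by (rule Db(1)[OF t])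
    have Et: "\<bar>E t\<bar> \<le> 1 / m" using Dm pos by (simp add: E_def frac_le)
    have E1t: "\<bar>E1 t\<bar> \<le> C * \<beta> / m"
    proof -
      have "\<bar>E1 t\<bar> = \<bar>D1 t\<bar> / \<bar>D t\<bar>\<^sup>2" by (simp add: E1_def)
      also have "\<dots> \<le> (C * m * \<beta>) / m\<^sup>2" using Db(2)[OF t] Dm pos by (intro frac_le power_mono) auto
      finally show ?thesis using pos by (simp add: power2_eq_square)
    qed
    have E2t: "\<bar>E2 t\<bar> \<le> (C + 2 * C\<^sup>2) * \<beta>\<^sup>2 / m"
    proof -
      have "\<bar>E2 t\<bar> \<le> \<bar>D2 t\<bar> / \<bar>D t\<bar>\<^sup>2 + 2 * \<bar>D1 t\<bar>\<^sup>2 / \<bar>D t\<bar> ^ 3"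
        unfolding E2_def by (rule order.trans[OF abs_triangle_ineq]) (simp add: abs_mult power_abs)
      also have "\<dots> \<le> (C * m * \<beta>\<^sup>2) / m\<^sup>2 + 2 * (C * m * \<beta>)\<^sup>2 / m ^ 3"
        using Db(2,3)[OF t] Dm pos by (intro add_mono frac_le power_mono mult_left_mono) auto
      also have "\<dots> = (C + 2 * C\<^sup>2) * \<beta>\<^sup>2 / m"
        using pos by (simp add: power2_eq_square power3_eq_cube field_simps)
      finally show ?thesis .
    qed
    have b1t: "norm (b1 t) \<le> (1 + C) * c * \<beta> / m"
    proof -
      have "norm (b1 t) \<le> \<bar>E t\<bar> * norm (a1 t) + \<bar>E1 t\<bar> * norm (a t)"
        unfolding b1_def by (rule order.trans[OF norm_triangle_ineq]) simp
      also have "\<dots> \<le> (1 / m) * (c * \<beta>) + (C * \<beta> / m) * c"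
        using Et E1t ab[OF t] pos c0 by (intro add_mono mult_mono) auto
      finally show ?thesis by (simp add: field_simps add_divide_distrib)
    qed
    have b2t: "norm (b2 t) \<le> (1 + 3 * C + 2 * C\<^sup>2) * c * \<beta>\<^sup>2 / m"
    proof -
      have "norm (b2 t) \<le> (\<bar>E t\<bar> * norm (a2 t) + \<bar>E1 t\<bar> * norm (a1 t)) + (\<bar>E1 t\<bar> * norm (a1 t) + \<bar>E2 t\<bar> * norm (a t))"
        unfolding b2_def norm_scaleR[symmetric]
        by (intro order.trans[OF norm_triangle_ineq] add_mono norm_triangle_ineq order.refl)
      also have "\<dots> \<le> ((1 / m) * (c * \<beta>\<^sup>2) + (C * \<beta> / m) * (c * \<beta>)) + ((C * \<beta> / m) * (c * \<beta>) + ((C + 2 * C\<^sup>2) * \<beta>\<^sup>2 / m) * c)"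
        using Et E1t E2t ab[OF t] pos c0 by (intro add_mono mult_mono) auto
      also have "\<dots> = (1 + 3 * C + 2 * C\<^sup>2) * c * \<beta>\<^sup>2 / m" by (simp add: field_simps power2_eq_square add_divide_distrib)
      finally show ?thesis .
    qed
    have "norm (d1 t) \<le> \<bar>E t\<bar> * norm (b2 t) + \<bar>E1 t\<bar> * norm (b1 t)"
      unfolding d1_def by (rule order.trans[OF norm_triangle_ineq]) simp
    also have "\<dots> \<le> (1 / m) * ((1 + 3 * C + 2 * C\<^sup>2) * c * \<beta>\<^sup>2 / m) + (C * \<beta> / m) * ((1 + C) * c * \<beta> / m)"
      using Et E1t b1t b2t pos c0 by (intro add_mono mult_mono) auto
    also have "\<dots> = \<kappa> * c * (\<beta> / m)\<^sup>2" using pos by (simp add: \<kappa>_def field_simps power2_eq_square)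
    finally show ?thesis .
  qed
  have cu: "continuous_on {p..q} u" by (rule continuous_on_vector_derivative[OF du])
  let ?I = "integral {p..q} (\<lambda>t. u t * a t)"
  have b1: "norm ?I \<le> c * (q - p)"
    using pq ab cu ca by (intro integral_bound) (auto simp: norm_mult nu intro!: continuous_intros)
  have "norm (integral {p..q} (\<lambda>t. u t * d1 t)) \<le> (\<kappa> * c * (\<beta> / m)\<^sup>2) * (q - p)"
    using pq d1b cu cd1 by (intro integral_bound) (auto simp: norm_mult nu intro!: continuous_intros)
  then have "lam\<^sup>2 * norm ?I \<le> (\<kappa> * c * (\<beta> / m)\<^sup>2) * (q - p)"
    unfolding eq[symmetric] using pos by (simp add: norm_mult power2_eq_square)
  then have "norm ?I \<le> (\<kappa> * c * (\<beta> / m)\<^sup>2) * (q - p) / lam\<^sup>2" using pos by (simp add: field_simps)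
  also have "\<dots> = (q - p) * \<kappa> * c * (1 / (lam * m / \<beta>)\<^sup>2)" using pos by (simp add: field_simps)
  finally have b2: "norm ?I \<le> (q - p) * \<kappa> * c * (1 / (lam * m / \<beta>)\<^sup>2)" .
  have "c * (q - p) \<le> (q - p) * \<kappa> * c * 1" using \<kappa> c0 pq mult_left_mono[of 1 \<kappa> "c * (q - p)"] by (simp add: mult_ac)
  then have b1': "norm ?I \<le> (q - p) * \<kappa> * c * 1" using b1 by linarith
  have "norm ?I \<le> (q - p) * \<kappa> * c * min 1 (1 / (lam * m / \<beta>)\<^sup>2)"
    using b1' b2 by (cases "1 \<le> 1 / (lam * m / \<beta>)\<^sup>2") (auto simp: min_def)
  then show ?thesis by (simp add: u_def \<kappa>_def)
qed

section \<open>Phase and amplitude under repeated differencing\<close>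

lemma box_decay_zero: "B \<ge> 0 \<Longrightarrow> box_decay M t B js \<eta> (\<lambda>_. 0)"
  by (induction js arbitrary: \<eta>) auto

definition in_box :: "('i \<Rightarrow> real set) \<Rightarrow> 'i \<Rightarrow> real \<Rightarrow> real \<Rightarrow> 'i list \<Rightarrow> ('i \<Rightarrow> real) \<Rightarrow> bool" where
  "in_box X t p q js z \<longleftrightarrow> z t \<in> {p..q} \<and> (\<forall>k\<in>set js. z k \<in> X k)"

text \<open>The derivatives are given as an abstract family because a difference of two values of
  the phase has to be a phase of the same kind again. Only derivatives along suffixes of
  \<open>js\<close> are linked, since the list is consumed from its head. In these directions the
  orders 1 to 3 in t suffice: the mean value theorem is applied to t-derivatives and never to the
  phase itself.\<close>

definition phase_bounds :: "('i \<Rightarrow> real set) \<Rightarrow> 'i \<Rightarrow> real \<Rightarrow> real \<Rightarrow> real \<Rightarrow> real \<Rightarrow> real \<Rightarrow> 'i list \<Rightarrow>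
    (nat \<Rightarrow> 'i list \<Rightarrow> ('i \<Rightarrow> real) \<Rightarrow> real) \<Rightarrow> bool" where
  "phase_bounds X t p q m C \<beta> js H \<longleftrightarrow>
    (\<forall>l1 k l2 n z. js = l1 @ k # l2 \<longrightarrow> n \<in> {1,2,3} \<longrightarrow> in_box X t p q js z \<longrightarrow>
      ((\<lambda>s. H n l2 (z(k := s))) has_real_derivative H n (k # l2) z) (at (z k) within X k)) \<and>
    (\<forall>n z. n < 3 \<longrightarrow> in_box X t p q js z \<longrightarrow>
      ((\<lambda>s. H n [] (z(t := s))) has_real_derivative H (Suc n) [] z) (at (z t) within {p..q})) \<and>
    (\<forall>z. in_box X t p q js z \<longrightarrow> continuous_on {p..q} (\<lambda>s. H 3 [] (z(t := s))) \<and>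
      m \<le> \<bar>H 1 js z\<bar> \<and> \<bar>H 2 js z\<bar> \<le> C * m * \<beta> \<and> \<bar>H 3 js z\<bar> \<le> C * m * \<beta>\<^sup>2)"

text \<open>Only t-derivatives occur, since the amplitude is multiplied by its conjugate at another
  point but never differenced. Vanishing of orders 0 and 1 at both ends is inherited by such
  products and removes the boundary terms.\<close>

definition amplitude_bounds :: "('i \<Rightarrow> real set) \<Rightarrow> 'i \<Rightarrow> real \<Rightarrow> real \<Rightarrow> real \<Rightarrow> real \<Rightarrow> 'i list \<Rightarrow>
    (nat \<Rightarrow> ('i \<Rightarrow> real) \<Rightarrow> complex) \<Rightarrow> bool" where
  "amplitude_bounds X t p q c \<beta> js a \<longleftrightarrow>
    (\<forall>n z. n < 2 \<longrightarrow> in_box X t p q js z \<longrightarrow>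
      ((\<lambda>s. a n (z(t := s))) has_vector_derivative a (Suc n) z) (at (z t) within {p..q})) \<and>
    (\<forall>z. in_box X t p q js z \<longrightarrow> continuous_on {p..q} (\<lambda>s. a 2 (z(t := s)))) \<and>
    (\<forall>n z. n \<le> 2 \<longrightarrow> in_box X t p q js z \<longrightarrow> norm (a n z) \<le> c * \<beta> ^ n) \<and>
    (\<forall>n z. n < 2 \<longrightarrow> in_box X t p q js z \<longrightarrow> z t = p \<or> z t = q \<longrightarrow> a n z = 0)"

lemma phase_boundsD:
  assumes "phase_bounds X t p q m C \<beta> js H"
  shows "\<And>l1 k l2 n z. js = l1 @ k # l2 \<Longrightarrow> n \<in> {1,2,3} \<Longrightarrow> in_box X t p q js z \<Longrightarrow>
      ((\<lambda>s. H n l2 (z(k := s))) has_real_derivative H n (k # l2) z) (at (z k) within X k)"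
    "\<And>n z. n < 3 \<Longrightarrow> in_box X t p q js z \<Longrightarrow>
      ((\<lambda>s. H n [] (z(t := s))) has_real_derivative H (Suc n) [] z) (at (z t) within {p..q})"
    "\<And>z. in_box X t p q js z \<Longrightarrow> continuous_on {p..q} (\<lambda>s. H 3 [] (z(t := s)))"
    "\<And>z. in_box X t p q js z \<Longrightarrow> m \<le> \<bar>H 1 js z\<bar>"
    "\<And>z. in_box X t p q js z \<Longrightarrow> \<bar>H 2 js z\<bar> \<le> C * m * \<beta>"
    "\<And>z. in_box X t p q js z \<Longrightarrow> \<bar>H 3 js z\<bar> \<le> C * m * \<beta>\<^sup>2"
  using assms unfolding phase_bounds_def by blast+

lemma amplitude_boundsD:
  assumes "amplitude_bounds X t p q c \<beta> js a"
  shows "\<And>n z. n < 2 \<Longrightarrow> in_box X t p q js z \<Longrightarrow>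
      ((\<lambda>s. a n (z(t := s))) has_vector_derivative a (Suc n) z) (at (z t) within {p..q})"
    "\<And>z. in_box X t p q js z \<Longrightarrow> continuous_on {p..q} (\<lambda>s. a 2 (z(t := s)))"
    "\<And>n z. n \<le> 2 \<Longrightarrow> in_box X t p q js z \<Longrightarrow> norm (a n z) \<le> c * \<beta> ^ n"
    "\<And>n z. n < 2 \<Longrightarrow> in_box X t p q js z \<Longrightarrow> z t = p \<or> z t = q \<Longrightarrow> a n z = 0"
  using assms unfolding amplitude_bounds_def by blast+

text \<open>\<open>H n l\<close> stands for the derivative \<open>\<partial>\<^sub>l\<partial>\<^sub>t\<^sup>n\<close> of the phase \<open>H 0 []\<close>, and \<open>a n\<close> for \<open>\<partial>\<^sub>t\<^sup>n\<close> of the amplitude.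
  Differencing in \<open>x\<^sub>j\<close> replaces \<open>\<partial>\<^sub>j\<close> by a difference quotient (mean value theorem), so that after all of \<open>js\<close>
  has been used, the bounds for \<open>H n js\<close> are bounds for the \<open>n\<close>-th derivative of the phase of the box kernel.\<close>
lemma box_decay_oscillatory:
  fixes H :: "nat \<Rightarrow> 'i list \<Rightarrow> ('i \<Rightarrow> real) \<Rightarrow> real" and a :: "nat \<Rightarrow> ('i \<Rightarrow> real) \<Rightarrow> complex"
  assumes pq: "p < q" and X: "\<And>k. is_interval (X k)" and pos: "\<beta> > 0" "C \<ge> 0" "lam > 0"
    and Mt: "\<And>h::real \<Rightarrow> complex. continuous_on {p..q} h \<Longrightarrow> (\<integral>s. (if s \<in> {p..q} then h s else 0) \<partial>M t) = integral {p..q} h"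
    and "distinct (t # js)" and "m > 0" and "c \<ge> 0"
    and "phase_bounds X t p q m C \<beta> js H" and "amplitude_bounds X t p q c \<beta> js a"
  shows "box_decay M t ((q - p) * (1 + 4 * C + 3 * C\<^sup>2) * (4 * c) ^ (2 ^ length js)) js (lam * m / \<beta>)
    (\<lambda>z. if in_box X t p q js z then exp (\<i> * of_real (lam * H 0 [] z)) * a 0 z else 0)"
  using assms(7-)
proof (induction js arbitrary: H a m c)
  case Nil
  note prems = Nil.prems
  note ph = phase_boundsD[OF prems(4)] and am = amplitude_boundsD[OF prems(5)]
  have box: "in_box X t p q [] (z(t := s)) \<longleftrightarrow> s \<in> {p..q}" for z :: "'i \<Rightarrow> real" and s by (simp add: in_box_def)
  show ?case unfolding box_decay.simps
  proof
    fix z :: "'i \<Rightarrow> real"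
    have H: "((\<lambda>s. H n [] (z(t := s))) has_real_derivative H (Suc n) [] (z(t := s))) (at s within {p..q})"
      if "n < 3" "s \<in> {p..q}" for n s
      using ph(2)[OF that(1) iffD2[OF box that(2)], of z] unfolding fun_upd_upd fun_upd_same .
    have a: "((\<lambda>s. a n (z(t := s))) has_vector_derivative a (Suc n) (z(t := s))) (at s within {p..q})"
      if "n < 2" "s \<in> {p..q}" for n s
      using am(1)[OF that(1) iffD2[OF box that(2)], of z] unfolding fun_upd_upd fun_upd_same .
    have e: "Suc 0 = 1" "Suc 1 = 2" "Suc 2 = 3" by auto
    have le12: "0 \<le> (2::nat)" "1 \<le> (2::nat)" by auto
    have pb: "in_box X t p q [] (z(t := p))" using pq by (simp add: box)
    have cH: "continuous_on {p..q} (\<lambda>s. H 3 [] (z(t := s)))" using ph(3)[OF pb] unfolding fun_upd_upd .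
    have ca: "continuous_on {p..q} (\<lambda>s. a 2 (z(t := s)))" using am(2)[OF pb] unfolding fun_upd_upd .
    have B: "norm (integral {p..q} (\<lambda>s. exp (\<i> * of_real (lam * H 0 [] (z(t := s)))) * a 0 (z(t := s))))
       \<le> (q - p) * (1 + 4 * C + 3 * C\<^sup>2) * c * min 1 (1 / (lam * m / \<beta>)\<^sup>2)"
    proof (rule oscillatory_integral_bound[OF pq H[of 0, unfolded e] H[of 1, unfolded e] H[of 2, unfolded e] cH _ _ _
          a[of 0, unfolded e] a[of 1, unfolded e] ca])
      fix s assume s: "s \<in> {p..q}"
      then have b: "in_box X t p q [] (z(t := s))" by (simp add: box)
      show "m \<le> \<bar>H 1 [] (z(t := s))\<bar>" "\<bar>H 2 [] (z(t := s))\<bar> \<le> C * m * \<beta>" "\<bar>H 3 [] (z(t := s))\<bar> \<le> C * m * \<beta>\<^sup>2"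
        by (rule ph(4-6)[OF b])+
      show "norm (a 0 (z(t := s))) \<le> c" "norm (a 1 (z(t := s))) \<le> c * \<beta>" "norm (a 2 (z(t := s))) \<le> c * \<beta>\<^sup>2"
        using am(3)[OF le12(1) b] am(3)[OF le12(2) b] am(3)[OF order.refl b]
        unfolding power_0 power_one_right mult_1_right by blast+
    next
      have qb: "in_box X t p q [] (z(t := q))" using pq by (simp add: box)
      show "a 0 (z(t := p)) = 0" "a 1 (z(t := p)) = 0" "a 0 (z(t := q)) = 0" "a 1 (z(t := q)) = 0"
        by (rule am(4)[OF _ pb] am(4)[OF _ qb], simp, simp)+
    qed (use prems(2) pos in \<open>auto\<close>)
    have cont: "continuous_on {p..q} (\<lambda>s. exp (\<i> * of_real (lam * H 0 [] (z(t := s)))) * a 0 (z(t := s)))"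
    proof -
      have "continuous_on {p..q} (\<lambda>s. H 0 [] (z(t := s)))" by (rule DERIV_continuous_on[OF H[of 0]]) auto
      moreover have "continuous_on {p..q} (\<lambda>s. a 0 (z(t := s)))" by (rule continuous_on_vector_derivative[OF a[of 0]]) auto
      ultimately show ?thesis by (intro continuous_intros)
    qed
    have "norm (\<integral>s. (if in_box X t p q [] (z(t := s)) then exp (\<i> * of_real (lam * H 0 [] (z(t := s)))) * a 0 (z(t := s)) else 0) \<partial>M t)
       = norm (integral {p..q} (\<lambda>s. exp (\<i> * of_real (lam * H 0 [] (z(t := s)))) * a 0 (z(t := s))))"
      unfolding box Mt[OF cont] ..
    also have "\<dots> \<le> (q - p) * (1 + 4 * C + 3 * C\<^sup>2) * c * min 1 (1 / (lam * m / \<beta>)\<^sup>2)" by (rule B)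
    also have "\<dots> \<le> (q - p) * (1 + 4 * C + 3 * C\<^sup>2) * (4 * c) ^ 2 ^ length ([] :: 'i list) * min 1 (1 / (lam * m / \<beta>)\<^sup>2)"
      using pq pos prems(3) by (intro mult_right_mono mult_left_mono mult_nonneg_nonneg) auto
    finally show "norm (\<integral>s. (if in_box X t p q [] (z(t := s)) then exp (\<i> * of_real (lam * H 0 [] (z(t := s)))) * a 0 (z(t := s)) else 0) \<partial>M t)
      \<le> (q - p) * (1 + 4 * C + 3 * C\<^sup>2) * (4 * c) ^ 2 ^ length ([] :: 'i list) * min 1 (1 / (lam * m / \<beta>)\<^sup>2)" .
  qed
next
  case (Cons j js)
  note prems = Cons.prems
  note ph = phase_boundsD[OF prems(4)] and am = amplitude_boundsD[OF prems(5)]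
  have dist: "distinct (t # js)" and jt: "j \<noteq> t" and jjs: "j \<notin> set js" using prems(1) by auto
  let ?B = "(q - p) * (1 + 4 * C + 3 * C\<^sup>2) * (4 * c) ^ 2 ^ length (j # js)"
  have B0: "?B \<ge> 0" using pq pos prems(3) by (intro mult_nonneg_nonneg) auto
  define K where "K = (\<lambda>z. if in_box X t p q (j # js) z then exp (\<i> * of_real (lam * H 0 [] z)) * a 0 z else 0)"
  have "box_decay M t ?B js (lam * m / \<beta> * \<bar>x - y\<bar>) (\<lambda>z. K (z(j := x)) * cnj (K (z(j := y))))"
    if xy: "x \<noteq> y" for x y
  proof (cases "x \<in> X j \<and> y \<in> X j")
    \<comment> \<open>If x or y lies outside \<open>X j\<close>, one of the two kernel factors
      vanishes identically.\<close>
    case False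
    then have "(\<lambda>z. K (z(j := x)) * cnj (K (z(j := y)))) = (\<lambda>_. 0)"
      using jt by (auto simp: K_def in_box_def)
    then show ?thesis using box_decay_zero[OF B0] by simp
  next
    case True
    \<comment> \<open>The data for one variable less: a difference of phases, and a product of
      amplitudes whose t-derivatives \<open>A1\<close> and \<open>A2\<close> are written out by the
      product rule.\<close>
    define H' where "H' n l z = H n l (z(j := x)) - H n l (z(j := y))" for n l z
    define A0 where "A0 z = a 0 (z(j := x)) * cnj (a 0 (z(j := y)))" for z
    define A1 where "A1 z = a 0 (z(j := x)) * cnj (a 1 (z(j := y))) + a 1 (z(j := x)) * cnj (a 0 (z(j := y)))" for z
    define A2 where "A2 z = (a 0 (z(j := x)) * cnj (a 2 (z(j := y))) + a 1 (z(j := x)) * cnj (a 1 (z(j := y))))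
          + (a 1 (z(j := x)) * cnj (a 1 (z(j := y))) + a 2 (z(j := x)) * cnj (a 0 (z(j := y))))" for z
    define a' where "a' n = (if n = (0::nat) then A0 else if n = 1 then A1 else A2)" for n
    have a': "a' 0 = A0" "a' 1 = A1" "a' 2 = A2" "a' (Suc 0) = A1" "a' (Suc 1) = A2" by (auto simp: a'_def)
    have box: "in_box X t p q (j # js) (z(j := w)) \<longleftrightarrow> in_box X t p q js z" if "w \<in> X j" for z w
      using that jt jjs by (auto simp: in_box_def)
    note bx = box[of x, OF conjunct1[OF True]] and by' = box[of y, OF conjunct2[OF True]]
    have tw: "z(t := s, j := w) = z(j := w, t := s)" for z :: "'i \<Rightarrow> real" and s w
      by (rule fun_upd_twist[OF jt[symmetric]])
    \<comment> \<open>The factor |x - y| is the same for all three orders, so it can be absorbed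
      into m while C and \<beta> stay unchanged.\<close>
    have mvt: "\<exists>\<xi>. in_box X t p q (j # js) (z(j := \<xi>)) \<and> \<bar>H' n js z\<bar> = \<bar>x - y\<bar> * \<bar>H n (j # js) (z(j := \<xi>))\<bar>"
      if n: "n \<in> {1,2,3}" and z: "in_box X t p q js z" for n z
    proof -
      have main: "\<exists>\<xi>\<in>{v..w}. H n js (z(j := w)) - H n js (z(j := v)) = (w - v) * H n (j # js) (z(j := \<xi>))"
        if vw: "v \<le> w" "v \<in> X j" "w \<in> X j" for v w
      proof -
        \<comment> \<open>Here the sets have to be intervals: the intermediate point must again lie
          where the bounds hold.\<close>
        have sub: "{v..w} \<subseteq> X j" using mem_is_interval_1_I[OF X vw(2,3)] by auto
        have "((\<lambda>s. H n js (z(j := s))) has_derivative (\<lambda>h. h * H n (j # js) (z(j := s)))) (at s within {v..w})" if "v \<le> s" "s \<le> w" for s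
        proof -
          have sX: "s \<in> X j" using sub that by auto
          have "((\<lambda>s. H n js (z(j := s))) has_real_derivative H n (j # js) (z(j := s))) (at s within X j)"
            using ph(1)[OF append_Nil[symmetric] n iffD2[OF box[OF sX] z]] unfolding fun_upd_upd fun_upd_same .
          then show ?thesis using sub unfolding has_field_derivative_def
            by (auto simp: mult_commute_abs intro: has_derivative_subset)
        qed
        from mvt_very_simple[OF vw(1) this] show ?thesis by auto
      qed
      show ?thesis
      proof (cases "y \<le> x")
        case le: True
        obtain \<xi> where \<xi>: "\<xi> \<in> {y..x}" "H n js (z(j := x)) - H n js (z(j := y)) = (x - y) * H n (j # js) (z(j := \<xi>))"
          using main[OF le] True by blast
        have "\<xi> \<in> X j" using mem_is_interval_1_I[OF X, of y j x \<xi>] \<xi>(1) True by simp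
        then show ?thesis using \<xi>(2) z box[of \<xi> z] by (intro exI[of _ \<xi>]) (simp add: H'_def abs_mult)
      next
        case False
        obtain \<xi> where \<xi>: "\<xi> \<in> {x..y}" "H n js (z(j := y)) - H n js (z(j := x)) = (y - x) * H n (j # js) (z(j := \<xi>))"
          using main[of x y] True False by (meson linear)
        have "\<xi> \<in> X j" using mem_is_interval_1_I[OF X, of x j y \<xi>] \<xi>(1) True by simp
        moreover have "\<bar>H' n js z\<bar> = \<bar>x - y\<bar> * \<bar>H n (j # js) (z(j := \<xi>))\<bar>"
          using arg_cong[OF \<xi>(2), of abs] by (simp add: H'_def abs_mult abs_minus_commute)
        ultimately show ?thesis using z box[of \<xi> z] by (intro exI[of _ \<xi>]) simp
      qed
    qed
    have "box_decay M t ((q - p) * (1 + 4 * C + 3 * C\<^sup>2) * (4 * (4 * c\<^sup>2)) ^ (2 ^ length js)) js (lam * (m * \<bar>x - y\<bar>) / \<beta>)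
      (\<lambda>z. if in_box X t p q js z then exp (\<i> * of_real (lam * H' 0 [] z)) * a' 0 z else 0)"
    proof (rule Cons.IH[OF dist])
      show "m * \<bar>x - y\<bar> > 0" using xy prems(2) by simp
      show "4 * c\<^sup>2 \<ge> 0" by simp
      show "phase_bounds X t p q (m * \<bar>x - y\<bar>) C \<beta> js H'" unfolding phase_bounds_def
      proof (intro conjI allI impI)
        fix l1 k l2 n and z :: "'i \<Rightarrow> real"
        assume js: "js = l1 @ k # l2" and n: "n \<in> {1,2,3::nat}" and z: "in_box X t p q js z"
        have kj: "k \<noteq> j" using jjs js by auto
        have "((\<lambda>s. H n l2 ((z(j := w))(k := s))) has_real_derivative H n (k # l2) (z(j := w))) (at (z k) within X k)"
          if "w \<in> X j" for w
        proof -
          have e: "j # js = (j # l1) @ k # l2" using js by simp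
          show ?thesis using ph(1)[OF e n iffD2[OF box[OF that] z]] unfolding fun_upd_other[OF kj] .
        qed
        from this[of x] this[of y]
        show "((\<lambda>s. H' n l2 (z(k := s))) has_real_derivative H' n (k # l2) z) (at (z k) within X k)"
          using True unfolding H'_def fun_upd_twist[OF kj] by (auto intro!: derivative_eq_intros)
      next
        fix n and z :: "'i \<Rightarrow> real" assume n: "n < (3::nat)" and z: "in_box X t p q js z"
        have "((\<lambda>s. H n [] ((z(j := w))(t := s))) has_real_derivative H (Suc n) [] (z(j := w))) (at (z t) within {p..q})"
          if "w \<in> X j" for w
          using ph(2)[OF n iffD2[OF box[OF that] z]] unfolding fun_upd_other[OF jt[symmetric]] .
        from this[of x] this[of y]
        show "((\<lambda>s. H' n [] (z(t := s))) has_real_derivative H' (Suc n) [] z) (at (z t) within {p..q})"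
          using True unfolding H'_def tw by (auto intro!: derivative_eq_intros)
      next
        fix z :: "'i \<Rightarrow> real" assume z: "in_box X t p q js z"
        show "continuous_on {p..q} (\<lambda>s. H' 3 [] (z(t := s)))"
          unfolding H'_def tw using ph(3)[OF iffD2[OF bx z]] ph(3)[OF iffD2[OF by' z]]
          by (rule continuous_on_diff)
        obtain \<xi>1 where \<xi>1: "in_box X t p q (j # js) (z(j := \<xi>1))" "\<bar>H' 1 js z\<bar> = \<bar>x - y\<bar> * \<bar>H 1 (j # js) (z(j := \<xi>1))\<bar>"
          using mvt[OF _ z, of 1] by auto
        show "m * \<bar>x - y\<bar> \<le> \<bar>H' 1 js z\<bar>"
          unfolding \<xi>1(2) by (subst mult.commute) (rule mult_left_mono[OF ph(4)[OF \<xi>1(1)] abs_ge_zero])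
        obtain \<xi>2 where \<xi>2: "in_box X t p q (j # js) (z(j := \<xi>2))" "\<bar>H' 2 js z\<bar> = \<bar>x - y\<bar> * \<bar>H 2 (j # js) (z(j := \<xi>2))\<bar>"
          using mvt[OF _ z, of 2] by auto
        have "\<bar>H' 2 js z\<bar> \<le> \<bar>x - y\<bar> * (C * m * \<beta>)"
          unfolding \<xi>2(2) by (rule mult_left_mono[OF ph(5)[OF \<xi>2(1)] abs_ge_zero])
        then show "\<bar>H' 2 js z\<bar> \<le> C * (m * \<bar>x - y\<bar>) * \<beta>" by (simp add: mult_ac)
        obtain \<xi>3 where \<xi>3: "in_box X t p q (j # js) (z(j := \<xi>3))" "\<bar>H' 3 js z\<bar> = \<bar>x - y\<bar> * \<bar>H 3 (j # js) (z(j := \<xi>3))\<bar>"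
          using mvt[OF _ z, of 3] by auto
        have "\<bar>H' 3 js z\<bar> \<le> \<bar>x - y\<bar> * (C * m * \<beta>\<^sup>2)"
          unfolding \<xi>3(2) by (rule mult_left_mono[OF ph(6)[OF \<xi>3(1)] abs_ge_zero])
        then show "\<bar>H' 3 js z\<bar> \<le> C * (m * \<bar>x - y\<bar>) * \<beta>\<^sup>2" by (simp add: mult_ac)
      qed
    next
      \<comment> \<open>\<open>A2\<close> consists of four products, each at most
        \<open>c\<^sup>2 * \<beta>\<^sup>2\<close>; lower orders have fewer terms.\<close>
      show "amplitude_bounds X t p q (4 * c\<^sup>2) \<beta> js a'" unfolding amplitude_bounds_def
      proof (intro conjI allI impI)
        fix n and z :: "'i \<Rightarrow> real" assume n: "n < (2::nat)" and z: "in_box X t p q js z"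
        have da: "((\<lambda>s. a n ((z(j := w))(t := s))) has_vector_derivative a (Suc n) (z(j := w))) (at (z t) within {p..q})"
          if "w \<in> X j" "n < 2" for w n
          using am(1)[OF that(2) iffD2[OF box[OF that(1)] z]] unfolding fun_upd_other[OF jt[symmetric]] .
        have dca: "((\<lambda>s. cnj (a n ((z(j := w))(t := s)))) has_vector_derivative cnj (a (Suc n) (z(j := w)))) (at (z t) within {p..q})"
          if "w \<in> X j" "n < 2" for w n
          by (rule has_vector_derivative_cnj[OF da[OF that]])
        have id: "z(j := w, t := z t) = z(j := w)" for w using jt by (auto simp: fun_eq_iff)
        note dx = da[of x, OF conjunct1[OF True]] and dy = dca[of y, OF conjunct2[OF True]]
        have m0: "((\<lambda>s. a n1 (z(j := x, t := s)) * cnj (a n2 (z(j := y, t := s)))) has_vector_derivative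
            a n1 (z(j := x)) * cnj (a (Suc n2) (z(j := y))) + a (Suc n1) (z(j := x)) * cnj (a n2 (z(j := y)))) (at (z t) within {p..q})"
          if "n1 < 2" "n2 < 2" for n1 n2
          using has_vector_derivative_mult[OF dx[OF that(1)] dy[OF that(2)]] unfolding id .
        have e: "Suc 0 = 1" "Suc 1 = 2" by auto
        have "n = 0 \<or> n = 1" using n by auto
        then show "((\<lambda>s. a' n (z(t := s))) has_vector_derivative a' (Suc n) z) (at (z t) within {p..q})"
        proof
          assume n0: "n = 0"
          have "0 < (2::nat)" by simp
          from m0[OF this this] show ?thesis unfolding n0 a' A0_def A1_def tw e .
        next
          assume n1: "n = 1"
          have l: "0 < (2::nat)" "1 < (2::nat)" by auto
          from has_vector_derivative_add[OF m0[OF l] m0[OF l(2) l(1)]]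
          show ?thesis unfolding n1 a' A1_def A2_def tw e .
        qed
      next
        fix z :: "'i \<Rightarrow> real" assume z: "in_box X t p q js z"
        have ca: "continuous_on {p..q} (\<lambda>s. a n (z(j := w, t := s)))" if w: "w \<in> X j" and n: "n \<le> 2" for w n
        proof (cases "n = 2")
          case True
          show ?thesis unfolding True by (rule am(2)[OF iffD2[OF box[OF w] z]])
        next
          case False
          then have n2: "n < 2" using n by simp
          show ?thesis
          proof (rule continuous_on_vector_derivative)
            fix s assume s: "s \<in> {p..q}"
            have "in_box X t p q (j # js) (z(j := w, t := s))" using z box[OF w, of z] s jjs jt prems(1) by (auto simp: in_box_def)
            note am(1)[OF n2 this, unfolded fun_upd_upd fun_upd_same]
            then
            show "((\<lambda>s. a n (z(j := w, t := s))) has_vector_derivative a (Suc n) (z(j := w, t := s))) (at s within {p..q})" .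
          qed
        qed
        show "continuous_on {p..q} (\<lambda>s. a' 2 (z(t := s)))"
          unfolding a' A2_def tw using True
          by (intro continuous_intros ca) auto
      next
        fix n and z :: "'i \<Rightarrow> real" assume n: "n \<le> (2::nat)" and z: "in_box X t p q js z"
        have ab: "norm (a n1 (z(j := w))) \<le> c * \<beta> ^ n1" if "w \<in> X j" "n1 \<le> 2" for w n1
          by (rule am(3)[OF that(2) iffD2[OF box[OF that(1)] z]])
        have m0: "norm (a n1 (z(j := x)) * cnj (a n2 (z(j := y)))) \<le> c\<^sup>2 * \<beta> ^ (n1 + n2)" if "n1 \<le> 2" "n2 \<le> 2" for n1 n2
        proof -
          have "norm (a n1 (z(j := x)) * cnj (a n2 (z(j := y)))) \<le> (c * \<beta> ^ n1) * (c * \<beta> ^ n2)"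
            unfolding norm_mult complex_mod_cnj using ab that True pos prems(3) by (intro mult_mono) auto
          then show ?thesis by (simp add: power_add power2_eq_square mult_ac)
        qed
        have e: "(1::nat) + 1 = 2" "(0::nat) + 0 = 0" "(0::nat) + n = n" "n + (0::nat) = n" for n by auto
        have l: "0 \<le> (2::nat)" "1 \<le> (2::nat)" "2 \<le> (2::nat)" by auto
        have c2: "0 \<le> c\<^sup>2 * \<beta> ^ n" for n using pos by simp
        consider "n = 0" | "n = 1" | "n = 2" using n by linarith
        then show "norm (a' n z) \<le> 4 * c\<^sup>2 * \<beta> ^ n"
        proof cases
          case 1
          have "norm (a' n z) \<le> c\<^sup>2 * \<beta> ^ n" using m0[OF l(1) l(1)] unfolding 1 a' A0_def e .
          then show ?thesis using c2[of n] by linarith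
        next
          case 2
          have "norm (a' n z) \<le> c\<^sup>2 * \<beta> ^ n + c\<^sup>2 * \<beta> ^ n"
            using norm_triangle_mono[OF m0[OF l(1) l(2)] m0[OF l(2) l(1)]] unfolding 2 a' A1_def e .
          then show ?thesis using c2[of n] by linarith
        next
          case 3
          have "norm (a' n z) \<le> (c\<^sup>2 * \<beta> ^ n + c\<^sup>2 * \<beta> ^ n) + (c\<^sup>2 * \<beta> ^ n + c\<^sup>2 * \<beta> ^ n)"
            using norm_triangle_mono[OF norm_triangle_mono[OF m0[OF l(1) l(3)] m0[OF l(2) l(2)]] norm_triangle_mono[OF m0[OF l(2) l(2)] m0[OF l(3) l(1)]]]
            unfolding 3 a' A2_def e .
          then show ?thesis by linarith
        qed
      next
        fix n and z :: "'i \<Rightarrow> real" assume n: "n < (2::nat)" and z: "in_box X t p q js z" and e: "z t = p \<or> z t = q"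
        have "a n1 (z(j := w)) = 0" if "w \<in> X j" "n1 < 2" for w n1
        proof (rule am(4)[OF that(2) iffD2[OF box[OF that(1)] z]])
          show "(z(j := w)) t = p \<or> (z(j := w)) t = q" using e jt by simp
        qed
        then have z0: "a n1 (z(j := x)) = 0" "cnj (a n1 (z(j := y))) = 0" if "n1 < 2" for n1 using that True by auto
        have l: "0 < (2::nat)" "1 < (2::nat)" by auto
        have "n = 0 \<or> n = 1" using n by auto
        then show "a' n z = 0"
        proof
          assume n0: "n = 0"
          show ?thesis unfolding n0 a' A0_def z0[OF l(1)] by (rule mult_zero_left)
        next
          assume n1: "n = 1"
          show ?thesis unfolding n1 a' A1_def z0[OF l(1)] z0[OF l(2)] by (simp only: mult_zero_left add_0_left)
        qed
      qed
    qed
    moreover have "(4 * (4 * c\<^sup>2)) ^ (2 ^ length js) = (4 * c) ^ 2 ^ length (j # js)"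
    proof -
      \<comment> \<open>Passing from c to \<open>4 * c\<^sup>2\<close> squares \<open>4 * c\<close>,
        which explains the iterated squares of \<open>4 * c\<close> in the bound.\<close>
      have "4 * (4 * c\<^sup>2) = (4 * c)\<^sup>2" by (simp add: power2_eq_square algebra_simps)
      then show ?thesis by (simp only: power_mult[symmetric] length_Cons power_Suc)
    qed
    moreover have "(\<lambda>z. if in_box X t p q js z then exp (\<i> * of_real (lam * H' 0 [] z)) * a' 0 z else 0)
      = (\<lambda>z. K (z(j := x)) * cnj (K (z(j := y))))"
    proof
      fix z
      have "cnj (exp (\<i> * of_real (lam * H 0 [] (z(j := y))))) = exp (- (\<i> * of_real (lam * H 0 [] (z(j := y)))))"
        by (simp add: exp_cnj)
      moreover have "exp (\<i> * of_real (lam * H' 0 [] z)) = exp (\<i> * of_real (lam * H 0 [] (z(j := x)))) * exp (- (\<i> * of_real (lam * H 0 [] (z(j := y)))))"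
        unfolding H'_def exp_add[symmetric] by (simp add: algebra_simps)
      ultimately have "exp (\<i> * of_real (lam * H' 0 [] z)) * a' 0 z =
          (exp (\<i> * of_real (lam * H 0 [] (z(j := x)))) * a 0 (z(j := x))) *
          cnj (exp (\<i> * of_real (lam * H 0 [] (z(j := y)))) * a 0 (z(j := y)))"
        unfolding a' A0_def complex_cnj_mult by (simp only: mult_ac)
      then show "(if in_box X t p q js z then exp (\<i> * of_real (lam * H' 0 [] z)) * a' 0 z else 0) = K (z(j := x)) * cnj (K (z(j := y)))"
        unfolding K_def bx[of z] by'[of z] by (cases "in_box X t p q js z") (simp_all only: if_True if_False mult_zero_left)
    qed
    moreover have "lam * (m * \<bar>x - y\<bar>) / \<beta> = lam * m / \<beta> * \<bar>x - y\<bar>" by simp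
    ultimately show ?thesis by (simp only:)
  qed
  then show ?case unfolding K_def box_decay.simps by blast
qed

section \<open>Partial derivatives of real analytic functions\<close>

definition monomial :: "real^'n::finite \<Rightarrow> ('n \<Rightarrow> nat) \<Rightarrow> real^'n \<Rightarrow> real" where
  "monomial x0 \<alpha> x = (\<Prod>i\<in>UNIV. (x$i - x0$i) ^ \<alpha> i)"

text \<open>The coefficients after termwise differentiation, already shifted, so that a derivative
  is once more a series over all multi-indices.\<close>

definition series_deriv :: "'n \<Rightarrow> (('n \<Rightarrow> nat) \<Rightarrow> real) \<Rightarrow> ('n \<Rightarrow> nat) \<Rightarrow> real" where
  "series_deriv j c \<alpha> = real (Suc (\<alpha> j)) * c (\<alpha>(j := Suc (\<alpha> j)))"

lemma series_deriv_commute: "series_deriv j (series_deriv k c) = series_deriv k (series_deriv j c)"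
  by (cases "j = k") (auto simp: series_deriv_def fun_eq_iff fun_upd_twist)

lemma monomial_upd:
  "monomial x0 \<alpha> (x + t *\<^sub>R axis j 1) = (\<Prod>i\<in>UNIV - {j}. (x$i - x0$i) ^ \<alpha> i) * (x$j - x0$j + t) ^ \<alpha> j"
proof -
  have "monomial x0 \<alpha> (x + t *\<^sub>R axis j 1) = (\<Prod>i\<in>UNIV. (if i = j then x$j - x0$j + t else x$i - x0$i) ^ \<alpha> i)"
    unfolding monomial_def by (intro prod.cong refl) (auto simp: axis_def algebra_simps)
  also have "\<dots> = (x$j - x0$j + t) ^ \<alpha> j * (\<Prod>i\<in>UNIV - {j}. (if i = j then x$j - x0$j + t else x$i - x0$i) ^ \<alpha> i)"
    by (subst prod.remove[of _ j]) auto
  also have "(\<Prod>i\<in>UNIV - {j}. (if i = j then x$j - x0$j + t else x$i - x0$i) ^ \<alpha> i) = (\<Prod>i\<in>UNIV - {j}. (x$i - x0$i) ^ \<alpha> i)"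
    by (intro prod.cong) auto
  finally show ?thesis by (simp add: mult.commute)
qed

lemma monomial_split:
  "monomial x0 \<alpha> x = (\<Prod>i\<in>UNIV - {j}. (x$i - x0$i) ^ \<alpha> i) * (x$j - x0$j) ^ \<alpha> j"
  using monomial_upd[of x0 \<alpha> x 0 j] by simp

text \<open>After multiplication by \<epsilon> the left-hand side is one term of the binomial
  expansion of (\<rho> + \<epsilon>) ^ n. A slightly larger radius pays for the factor n of a
  derivative.\<close>

lemma power_deriv_le:
  fixes \<rho> \<epsilon> :: real
  assumes "\<rho> \<ge> 0" "\<epsilon> > 0"
  shows "real n * \<rho> ^ (n - 1) \<le> (\<rho> + \<epsilon>) ^ n / \<epsilon>"
proof (induction n)
  case (Suc n)
  have "real (Suc n) * \<rho> ^ n * \<epsilon> \<le> (\<rho> + \<epsilon>) ^ Suc n"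
  proof (cases n)
    case 0 then show ?thesis using assms by simp
  next
    case (Suc m)
    have IH: "real n * \<rho> ^ (n - 1) * \<epsilon> \<le> (\<rho> + \<epsilon>) ^ n" using Suc.IH assms by (simp add: field_simps)
    have "real (Suc n) * \<rho> ^ n * \<epsilon> = \<rho> * (real n * \<rho> ^ (n - 1) * \<epsilon>) + \<epsilon> * \<rho> ^ n"
      by (simp add: Suc algebra_simps)
    also have "\<dots> \<le> \<rho> * (\<rho> + \<epsilon>) ^ n + \<epsilon> * (\<rho> + \<epsilon>) ^ n"
      using assms IH by (intro add_mono mult_left_mono power_mono) auto
    finally show ?thesis by (simp add: algebra_simps)
  qed
  then show ?case using assms by (simp add: field_simps)
qed (use assms in simp)

text \<open>The series converges at a point y farther out in direction j, and absolutely so since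
  the terms are real. Its terms there dominate the differentiated terms on a short segment through
  x, so that termwise differentiation is justified by the Weierstrass test.\<close>

lemma power_series_partial:
  fixes x0 :: "real^'n::finite"
  assumes ser: "\<And>x. x \<in> ball x0 r \<Longrightarrow> ((\<lambda>\<alpha>. c \<alpha> * monomial x0 \<alpha> x) has_sum S x) UNIV"
    and x: "x \<in> ball x0 r"
  shows "\<exists>d. ((\<lambda>t. S (x + t *\<^sub>R axis j 1)) has_vector_derivative d) (at 0) \<and>
     ((\<lambda>\<alpha>. series_deriv j c \<alpha> * monomial x0 \<alpha> x) has_sum d) UNIV"
proof -
  define \<epsilon> where "\<epsilon> = (r - norm (x - x0)) / 2"
  have \<epsilon>: "\<epsilon> > 0" using x by (simp add: \<epsilon>_def dist_norm norm_minus_commute)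
  have \<epsilon>2: "norm (x - x0) + 2 * \<epsilon> = r" unfolding \<epsilon>_def by (simp add: field_simps)
  \<comment> \<open>Absolute values make every factor of the monomials nonnegative without leaving
    the ball, as the norm stays the same; half of the remaining distance to the boundary is spent in
    direction j.\<close>
  define y where "y = x0 + (\<chi> i. \<bar>x$i - x0$i\<bar>) + \<epsilon> *\<^sub>R axis j 1"
  have nabs: "norm ((\<chi> i. \<bar>x$i - x0$i\<bar>) :: real^'n) = norm (x - x0)"
    by (simp add: norm_vec_def L2_set_def)
  have yb: "y \<in> ball x0 r"
  proof -
    have "norm (y - x0) \<le> norm ((\<chi> i. \<bar>x$i - x0$i\<bar>) :: real^'n) + norm (\<epsilon> *\<^sub>R axis j (1::real))"
      unfolding y_def by (rule order.trans[OF _ norm_triangle_ineq]) simp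
    also have "\<dots> = norm (x - x0) + \<epsilon>" using \<epsilon> unfolding nabs by simp
    also have "\<dots> < r" using \<epsilon> \<epsilon>2 by linarith
    finally show ?thesis by (simp add: dist_norm norm_minus_commute)
  qed
  define R where "R \<alpha> = (\<Prod>i\<in>UNIV - {j}. \<bar>x$i - x0$i\<bar> ^ \<alpha> i)" for \<alpha>
  have R0: "R \<alpha> \<ge> 0" for \<alpha> unfolding R_def by (intro prod_nonneg) auto
  have mon_y: "monomial x0 \<alpha> y = R \<alpha> * (\<bar>x$j - x0$j\<bar> + \<epsilon>) ^ \<alpha> j" for \<alpha>
    unfolding y_def monomial_upd by (simp add: R_def)
  \<comment> \<open>The enlargement \<epsilon> is used in two halves, one for the range of t and one
    for \<open>power_deriv_le\<close>; the latter gives the factor 2 / \<epsilon>.\<close>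
  define D where "D \<alpha> = (2 / \<epsilon>) * norm (c \<alpha> * monomial x0 \<alpha> y)" for \<alpha>
  have Dsum: "D summable_on UNIV"
  proof -
    have "(\<lambda>\<alpha>. c \<alpha> * monomial x0 \<alpha> y) summable_on UNIV"
      using ser[OF yb] by (rule has_sum_imp_summable)
    then have "(\<lambda>\<alpha>. norm (c \<alpha> * monomial x0 \<alpha> y)) summable_on UNIV"
      by (rule iffD1[OF summable_on_iff_abs_summable_on_real])
    then show ?thesis unfolding D_def by (rule summable_on_cmult_right)
  qed
  define F where "F \<alpha> t = c \<alpha> * monomial x0 \<alpha> (x + t *\<^sub>R axis j 1)" for \<alpha> t
  define F' where "F' \<alpha> t = c \<alpha> * (\<Prod>i\<in>UNIV - {j}. (x$i - x0$i) ^ \<alpha> i) * (real (\<alpha> j) * (x$j - x0$j + t) ^ (\<alpha> j - 1))" for \<alpha> t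
  define T where "T = {- \<epsilon> / 2 <..< \<epsilon> / 2}"
  have dF: "(F \<alpha> has_field_derivative F' \<alpha> t) (at t within T)" for \<alpha> t
    unfolding F_def F'_def monomial_upd by (auto intro!: derivative_eq_intros)
  have F'D: "norm (F' \<alpha> t) \<le> D \<alpha>" if "t \<in> T" for \<alpha> t
  proof -
    have t: "\<bar>t\<bar> \<le> \<epsilon> / 2" using that by (auto simp: T_def)
    have "norm (F' \<alpha> t) = \<bar>c \<alpha>\<bar> * R \<alpha> * (real (\<alpha> j) * \<bar>x$j - x0$j + t\<bar> ^ (\<alpha> j - 1))"
      by (simp add: F'_def R_def abs_mult abs_prod power_abs)
    also have "\<dots> \<le> \<bar>c \<alpha>\<bar> * R \<alpha> * (real (\<alpha> j) * (\<bar>x$j - x0$j\<bar> + \<epsilon> / 2) ^ (\<alpha> j - 1))"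
      using t R0 by (intro mult_left_mono power_mono mult_nonneg_nonneg) auto
    also have "\<dots> \<le> \<bar>c \<alpha>\<bar> * R \<alpha> * ((\<bar>x$j - x0$j\<bar> + \<epsilon> / 2 + \<epsilon> / 2) ^ \<alpha> j / (\<epsilon> / 2))"
      using \<epsilon> R0 by (intro mult_left_mono power_deriv_le mult_nonneg_nonneg) auto
    also have "\<dots> = D \<alpha>"
      using \<epsilon> R0[of \<alpha>] by (simp add: D_def mon_y abs_mult add.commute)
    finally show ?thesis .
  qed
  \<comment> \<open>Summability over multi-indices is unconditional, so they may be enumerated and
    the sum differentiated as an ordinary series.\<close>
  define e where "e = from_nat_into (UNIV :: ('n \<Rightarrow> nat) set)"
  have inf: "infinite (UNIV :: ('n \<Rightarrow> nat) set)"
  proof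
    assume "finite (UNIV :: ('n \<Rightarrow> nat) set)"
    moreover have "inj (\<lambda>n::nat. (\<lambda>_::'n. n))" by (auto simp: inj_on_def fun_eq_iff)
    ultimately have "finite (UNIV :: nat set)" by (metis finite_imageD finite_subset subset_UNIV)
    then show False by simp
  qed
  have e: "bij_betw e UNIV UNIV" unfolding e_def
    by (rule bij_betw_from_nat_into) (use inf in auto)
  have De: "summable (\<lambda>n. D (e n))"
    using Dsum summable_on_reindex_bij_betw[OF e, of D] by (intro summable_on_imp_summable) simp
  have xt: "x + t *\<^sub>R axis j 1 \<in> ball x0 r" if "t \<in> T" for t
  proof -
    have "norm (x + t *\<^sub>R axis j 1 - x0) \<le> norm (x - x0) + norm (t *\<^sub>R axis j (1::real))"
      by (rule order.trans[OF _ norm_triangle_ineq]) (simp add: algebra_simps)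
    also have "\<dots> \<le> norm (x - x0) + \<epsilon> / 2" using that by (auto simp: T_def)
    also have "\<dots> < r" using \<epsilon> \<epsilon>2 by linarith
    finally show ?thesis by (simp add: dist_norm norm_minus_commute)
  qed
  have Fsums: "(\<lambda>n. F (e n) t) sums S (x + t *\<^sub>R axis j 1)" if "t \<in> T" for t
    using ser[OF xt[OF that]] has_sum_reindex_bij_betw[OF e, of "\<lambda>\<alpha>. F \<alpha> t"]
    by (intro has_sum_imp_sums) (simp add: F_def)
  have T: "convex T" "0 \<in> T" "open T" using \<epsilon> by (auto simp: T_def)
  have "((\<lambda>t. \<Sum>n. F (e n) t) has_field_derivative (\<Sum>n. F' (e n) 0)) (at 0)"
  proof (rule has_field_derivative_series'(2)[OF T(1) dF _ T(2)])
    show "uniformly_convergent_on T (\<lambda>n t. \<Sum>i<n. F' (e i) t)"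
      by (rule Weierstrass_m_test'[where M = "\<lambda>n. D (e n)"]) (use F'D De in auto)
    show "summable (\<lambda>n. F (e n) 0)" using Fsums[OF T(2)] by (simp add: sums_iff)
    show "0 \<in> interior T" using T by (simp add: interior_open)
  qed
  moreover have "eventually (\<lambda>t. (\<Sum>n. F (e n) t) = S (x + t *\<^sub>R axis j 1)) (nhds 0)"
    using eventually_nhds_in_open[OF T(3,2)] by eventually_elim (use Fsums in \<open>auto simp: sums_iff\<close>)
  ultimately have der: "((\<lambda>t. S (x + t *\<^sub>R axis j 1)) has_field_derivative (\<Sum>n. F' (e n) 0)) (at 0)"
    using DERIV_cong_ev[of 0 0 "\<lambda>t. \<Sum>n. F (e n) t" "\<lambda>t. S (x + t *\<^sub>R axis j 1)"] by simp
  define d where "d = (\<Sum>n. F' (e n) 0)"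
  have nsum: "summable (\<lambda>n. norm (F' (e n) 0))"
    using De by (rule summable_comparison_test'[where N = 0]) (use F'D[OF T(2)] in auto)
  have "((\<lambda>n. F' (e n) 0) has_sum d) UNIV"
    unfolding d_def
    by (rule norm_summable_imp_has_sum[OF nsum summable_sums[OF summable_norm_cancel[OF nsum]]])
  then have hs: "((\<lambda>\<alpha>. F' \<alpha> 0) has_sum d) UNIV"
    using has_sum_reindex_bij_betw[OF e, of "\<lambda>\<alpha>. F' \<alpha> 0"] by simp
  \<comment> \<open>Only multi-indices with positive j-th entry survive the differentiation;
    \<sigma> parametrises them by all multi-indices.\<close>
  define \<sigma> where "\<sigma> \<alpha> = \<alpha>(j := Suc (\<alpha> j))" for \<alpha> :: "'n \<Rightarrow> nat"
  have inj: "inj \<sigma>"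
  proof (rule injI)
    fix \<alpha> \<beta> assume eq: "\<sigma> \<alpha> = \<sigma> \<beta>"
    show "\<alpha> = \<beta>"
    proof
      fix i from fun_cong[OF eq, of i] show "\<alpha> i = \<beta> i" by (cases "i = j") (auto simp: \<sigma>_def)
    qed
  qed
  have "((\<lambda>\<alpha>. F' \<alpha> 0) has_sum d) (range \<sigma>)"
  proof (subst has_sum_cong_neutral[where T = UNIV and g = "\<lambda>\<alpha>. F' \<alpha> 0"])
    fix \<alpha> assume "\<alpha> \<in> UNIV - range \<sigma>"
    then have nr: "\<alpha> \<notin> range \<sigma>" by simp
    have "\<alpha> j = 0"
    proof (rule ccontr)
      assume "\<alpha> j \<noteq> 0"
      then have "\<alpha> = \<sigma> (\<alpha>(j := \<alpha> j - 1))" by (auto simp: \<sigma>_def)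
      then show False using nr by blast
    qed
    then show "F' \<alpha> 0 = 0" by (simp add: F'_def)
  qed (use hs in auto)
  then have "((\<lambda>\<alpha>. F' (\<sigma> \<alpha>) 0) has_sum d) UNIV"
    using has_sum_reindex[OF inj, of "\<lambda>\<alpha>. F' \<alpha> 0" d] by (simp add: o_def)
  moreover have "F' (\<sigma> \<alpha>) 0 = series_deriv j c \<alpha> * monomial x0 \<alpha> x" for \<alpha>
  proof -
    have "(\<Prod>i\<in>UNIV - {j}. (x$i - x0$i) ^ (\<sigma> \<alpha>) i) = (\<Prod>i\<in>UNIV - {j}. (x$i - x0$i) ^ \<alpha> i)"
      by (intro prod.cong) (auto simp: \<sigma>_def)
    then show ?thesis unfolding F'_def series_deriv_def monomial_split[of x0 \<alpha> x j]
      by (simp add: \<sigma>_def)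
  qed
  ultimately have "((\<lambda>\<alpha>. series_deriv j c \<alpha> * monomial x0 \<alpha> x) has_sum d) UNIV" by simp
  moreover have "((\<lambda>t. S (x + t *\<^sub>R axis j 1)) has_vector_derivative d) (at 0)"
    using der by (simp add: d_def has_real_derivative_iff_has_vector_derivative)
  ultimately show ?thesis by blast
qed

lemma power_series_partial':
  fixes x0 :: "real^'n::finite"
  assumes ser: "\<And>x. x \<in> ball x0 r \<Longrightarrow> ((\<lambda>\<alpha>. c \<alpha> * monomial x0 \<alpha> x) has_sum S x) UNIV"
    and x: "x \<in> ball x0 r"
  shows "((\<lambda>t. S (x + t *\<^sub>R axis j 1)) has_vector_derivative partial j S x) (at 0)"
    and "((\<lambda>\<alpha>. series_deriv j c \<alpha> * monomial x0 \<alpha> x) has_sum partial j S x) UNIV"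
proof -
  obtain d where d: "((\<lambda>t. S (x + t *\<^sub>R axis j 1)) has_vector_derivative d) (at 0)"
    "((\<lambda>\<alpha>. series_deriv j c \<alpha> * monomial x0 \<alpha> x) has_sum d) UNIV"
    using power_series_partial[OF assms] by blast
  have "partial j S x = d" unfolding partial_def by (rule vector_derivative_at[OF d(1)])
  then show "((\<lambda>t. S (x + t *\<^sub>R axis j 1)) has_vector_derivative partial j S x) (at 0)"
    "((\<lambda>\<alpha>. series_deriv j c \<alpha> * monomial x0 \<alpha> x) has_sum partial j S x) UNIV" using d by auto
qed

lemma real_analytic_onE:
  assumes "real_analytic_on U S" "x0 \<in> U"
  obtains r c where "r > 0" "\<And>x. x \<in> ball x0 r \<Longrightarrow> ((\<lambda>\<alpha>. c \<alpha> * monomial x0 \<alpha> x) has_sum S x) UNIV"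
  using assms unfolding real_analytic_on_def monomial_def by metis

lemma real_analytic_has_partial:
  assumes "real_analytic_on U S" "x \<in> U"
  shows "((\<lambda>t. S (x + t *\<^sub>R axis j 1)) has_vector_derivative partial j S x) (at 0)"
proof -
  obtain r c where rc: "r > 0" "\<And>y. y \<in> ball x r \<Longrightarrow> ((\<lambda>\<alpha>. c \<alpha> * monomial x \<alpha> y) has_sum S y) UNIV"
    using real_analytic_onE[OF assms] by blast
  show ?thesis using power_series_partial'(1)[of x r c S x j, OF rc(2)] rc(1) by auto
qed

lemma real_analytic_partial:
  assumes "real_analytic_on U S"
  shows "real_analytic_on U (partial j S)"
  unfolding real_analytic_on_def
proof (intro conjI ballI)
  show "open U" using assms by (simp add: real_analytic_on_def)
  fix x0 assume "x0 \<in> U"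
  then obtain r c where rc: "r > 0" "\<And>y. y \<in> ball x0 r \<Longrightarrow> ((\<lambda>\<alpha>. c \<alpha> * monomial x0 \<alpha> y) has_sum S y) UNIV"
    using real_analytic_onE[OF assms] by blast
  show "\<exists>r>0. \<exists>c. \<forall>x\<in>ball x0 r. ((\<lambda>\<alpha>. c \<alpha> * (\<Prod>i\<in>UNIV. (x$i - x0$i) ^ \<alpha> i)) has_sum partial j S x) UNIV"
    using power_series_partial'(2)[of x0 r c S _ j, OF rc(2)] rc(1)
    by (intro exI[of _ r] conjI exI[of _ "series_deriv j c"]) (auto simp: monomial_def)
qed

text \<open>The expansions of both mixed derivatives about x have the same coefficients, because
  shifts in two coordinates commute.\<close>

lemma real_analytic_partial_commute:
  assumes "real_analytic_on U S" "x \<in> U"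
  shows "partial j (partial k S) x = partial k (partial j S) x"
proof -
  obtain r c where rc: "r > 0" "\<And>y. y \<in> ball x r \<Longrightarrow> ((\<lambda>\<alpha>. c \<alpha> * monomial x \<alpha> y) has_sum S y) UNIV"
    using real_analytic_onE[OF assms] by blast
  have 1: "((\<lambda>\<alpha>. series_deriv j (series_deriv k c) \<alpha> * monomial x \<alpha> x) has_sum partial j (partial k S) x) UNIV" for j k
    by (intro power_series_partial'(2)[of x r] power_series_partial'(2)[of x r c S] rc(2)) (use rc(1) in auto)
  show ?thesis
    using infsumI[OF 1[of j k]] infsumI[OF 1[of k j]] by (simp add: series_deriv_commute)
qed

section \<open>Order of differentiation\<close>

lemma real_analytic_iter_partial:
  assumes "real_analytic_on U S"
  shows "real_analytic_on U (iter_partial l S)"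
  by (induction l) (auto intro: real_analytic_partial assms)

lemma partial_cong_open:
  assumes "open U" "x \<in> U" "\<And>y. y \<in> U \<Longrightarrow> F y = G y"
  shows "partial j F x = partial j G x"
proof -
  have "eventually (\<lambda>t. x + t *\<^sub>R axis j 1 \<in> U) (nhds (0::real))"
  proof -
    have "((\<lambda>t. x + t *\<^sub>R axis j (1::real)) \<longlongrightarrow> x + 0 *\<^sub>R axis j 1) (nhds 0)"
      by (intro tendsto_intros) (simp add: filterlim_ident)
    then show ?thesis using assms(1,2) by (auto dest: topological_tendstoD)
  qed
  then have ev: "eventually (\<lambda>t. F (x + t *\<^sub>R axis j 1) = G (x + t *\<^sub>R axis j 1)) (nhds 0)"
    by eventually_elim (use assms(3) in auto)
  then show ?thesis unfolding partial_def by (intro vector_derivative_cong_eq) auto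
qed

lemma iter_partial_move:
  assumes "real_analytic_on U S" "x \<in> U"
  shows "iter_partial (p @ a # s) S x = iter_partial (a # p @ s) S x"
  using assms(2)
proof (induction p arbitrary: x)
  case (Cons b p)
  have op: "open U" using assms(1) by (simp add: real_analytic_on_def)
  have "iter_partial ((b # p) @ a # s) S x = partial b (iter_partial (a # p @ s) S) x"
    using partial_cong_open[OF op Cons.prems, of "iter_partial (p @ a # s) S" "iter_partial (a # p @ s) S" b] Cons.IH by simp
  also have "\<dots> = partial a (partial b (iter_partial (p @ s) S)) x"
    using real_analytic_partial_commute[OF real_analytic_iter_partial[OF assms(1)] Cons.prems] by simp
  finally show ?case by simp
qed simp

text \<open>\<open>Dd\<close> fixes some enumeration of the coordinates, and further derivatives in
  one direction are applied on the outside. The family of phase derivatives has them on the inside,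
  so a rearrangement is needed.\<close>

lemma iter_partial_mset:
  assumes "real_analytic_on U S" "x \<in> U" "mset l = mset l'"
  shows "iter_partial l S x = iter_partial l' S x"
  using assms(2,3)
proof (induction l arbitrary: l' x)
  case (Cons a l)
  have op: "open U" using assms(1) by (simp add: real_analytic_on_def)
  from Cons.prems(2) have "a \<in> set l'" by (metis list.set_intros(1) set_mset_mset)
  then obtain p s where l': "l' = p @ a # s" by (meson split_list)
  have "mset l = mset (p @ s)" using Cons.prems(2) l' by simp
  then have "partial a (iter_partial l S) x = partial a (iter_partial (p @ s) S) x"
    using Cons.IH by (intro partial_cong_open[OF op Cons.prems(1)]) auto
  then show ?case using iter_partial_move[OF assms(1) Cons.prems(1), of p a s] l' by simp
qed simp

text \<open>Weierstrass test on the ball of radius s about the centre: the monomials are dominated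
  by their values at the corner y that lies s away in every coordinate, and s is small enough for y
  to stay in the ball of convergence.\<close>

lemma real_analytic_continuous_on:
  assumes "real_analytic_on U S"
  shows "continuous_on U S"
proof -
  have op: "open U" using assms by (simp add: real_analytic_on_def)
  have "isCont S x0" if x0: "x0 \<in> U" for x0
  proof -
    obtain r c where rc: "r > 0" "\<And>y. y \<in> ball x0 r \<Longrightarrow> ((\<lambda>\<alpha>. c \<alpha> * monomial x0 \<alpha> y) has_sum S y) UNIV"
      using real_analytic_onE[OF assms x0] by blast
    define s where "s = r / (2 * real CARD('a))"
    have c1: "real CARD('a) \<ge> 1" by (simp add: Suc_leI)
    have s: "s > 0" using rc(1) c1 by (simp add: s_def)
    define y where "y = x0 + (\<chi> i. s)"
    have yb: "y \<in> ball x0 r"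
    proof -
      have "norm (y - x0) \<le> (\<Sum>i\<in>UNIV. \<bar>(y - x0) $ i\<bar>)" by (rule norm_le_l1_cart)
      also have "\<dots> = real CARD('a) * s" using s by (simp add: y_def)
      also have "\<dots> < r" using rc(1) c1 by (simp add: s_def)
      finally show ?thesis by (simp add: dist_norm norm_minus_commute)
    qed
    define D where "D \<alpha> = norm (c \<alpha> * monomial x0 \<alpha> y)" for \<alpha>
    have Dsum: "D summable_on UNIV"
      using has_sum_imp_summable[OF rc(2)[OF yb]] unfolding D_def by (rule iffD1[OF summable_on_iff_abs_summable_on_real])
    have sr: "s \<le> r"
    proof -
      have "s \<le> real CARD('a) * s" using c1 s by simp
      also have "\<dots> \<le> r" using rc(1) c1 by (simp add: s_def)
      finally show ?thesis .
    qed
    have ul: "uniform_limit (ball x0 s) (\<lambda>X y. \<Sum>\<alpha>\<in>X. c \<alpha> * monomial x0 \<alpha> y) S (finite_subsets_at_top UNIV)"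
    proof (rule Weierstrass_m_test_general'[OF _ _ Dsum])
      fix \<alpha> x assume x: "x \<in> ball x0 s"
      have "\<bar>monomial x0 \<alpha> x\<bar> \<le> \<bar>monomial x0 \<alpha> y\<bar>"
        unfolding monomial_def abs_prod power_abs
      proof (intro prod_mono conjI power_mono)
        fix i
        have "\<bar>x $ i - x0 $ i\<bar> \<le> norm (x - x0)" using component_le_norm_cart[of "x - x0" i] by simp
        also have "\<dots> \<le> s" using x by (simp add: dist_norm norm_minus_commute)
        finally show "\<bar>x $ i - x0 $ i\<bar> \<le> \<bar>y $ i - x0 $ i\<bar>" using s by (simp add: y_def)
      qed auto
      then show "norm (c \<alpha> * monomial x0 \<alpha> x) \<le> D \<alpha>" by (simp add: D_def abs_mult mult_left_mono)
    next
      fix x assume "x \<in> ball x0 s"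
      then show "((\<lambda>\<alpha>. c \<alpha> * monomial x0 \<alpha> x) has_sum S x) UNIV" using sr by (intro rc(2)) auto
    qed
    have "continuous_on (ball x0 s) S"
      by (rule uniform_limit_theorem[OF _ ul]) (auto simp: monomial_def intro!: always_eventually continuous_intros)
    then show ?thesis using s by (simp add: continuous_on_eq_continuous_at)
  qed
  then show ?thesis using op by (simp add: continuous_on_eq_continuous_at)
qed

lemma vec_upd: "(\<chi> i. (z(j := s')) i) = (\<chi> i. (z(j := s)) i) + (s' - s) *\<^sub>R (axis j 1 :: real^'n)"
  by (auto simp: vec_eq_iff axis_def)

text \<open>Partial derivatives are taken at 0 in an increment h, whereas box kernels vary a
  coordinate s by function update. The chain rule for the shift s' - s relates the two.\<close>

lemma has_vector_derivative_along_axis: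
  fixes F :: "real^'n::finite \<Rightarrow> 'b::real_normed_vector"
  assumes "((\<lambda>h. F ((\<chi> i. (z(j := s)) i) + h *\<^sub>R axis j 1)) has_vector_derivative D) (at 0)"
  shows "((\<lambda>s'. F (\<chi> i. (z(j := s')) i)) has_vector_derivative D) (at s within A)"
proof -
  have "((\<lambda>s'. s' - s) has_vector_derivative 1) (at s)" by (auto intro!: derivative_eq_intros)
  moreover have "((\<lambda>h. F ((\<chi> i. (z(j := s)) i) + h *\<^sub>R axis j 1)) has_vector_derivative D) (at (s - s))"
    using assms by simp
  ultimately have "((\<lambda>h. F ((\<chi> i. (z(j := s)) i) + h *\<^sub>R axis j 1)) \<circ> (\<lambda>s'. s' - s) has_vector_derivative 1 *\<^sub>R D) (at s)"
    by (rule vector_diff_chain_at)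
  then have "((\<lambda>s'. F ((\<chi> i. (z(j := s)) i) + (s' - s) *\<^sub>R axis j 1)) has_vector_derivative D) (at s)"
    by (simp only: o_def scaleR_one)
  then have "((\<lambda>s'. F (\<chi> i. (z(j := s')) i)) has_vector_derivative D) (at s)"
    unfolding vec_upd[of z j _ s, symmetric] .
  then show ?thesis by (rule has_vector_derivative_at_within)
qed

text \<open>The coordinates of y are replaced by those of x one at a time, and each replacement is a
  one-dimensional mean value estimate.\<close>

lemma partials_Lipschitz:
  fixes F :: "real^'n::finite \<Rightarrow> complex" and x y :: "real^'n"
  assumes der: "\<And>j x. ((\<lambda>h. F (x + h *\<^sub>R axis j 1)) has_vector_derivative partial j F x) (at 0)"
    and bd: "\<And>j x. norm (partial j F x) \<le> L j"
  shows "norm (F x - F y) \<le> (\<Sum>i\<in>UNIV. L i * \<bar>x$i - y$i\<bar>)"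
proof -
  have one: "norm (F (\<chi> i. (z(j := s)) i) - F (\<chi> i. (z(j := s')) i)) \<le> L j * \<bar>s - s'\<bar>" for z j s s'
  proof -
    have "norm (F (\<chi> i. (z(j := s)) i) - F (\<chi> i. (z(j := s')) i)) \<le> L j * norm (s - s')"
    proof (rule differentiable_bound[where S = UNIV and f = "\<lambda>s. F (\<chi> i. (z(j := s)) i)"])
      fix w
      show "((\<lambda>s. F (\<chi> i. (z(j := s)) i)) has_derivative (\<lambda>h. h *\<^sub>R partial j F (\<chi> i. (z(j := w)) i))) (at w within UNIV)"
        using has_vector_derivative_along_axis[OF der, where A = UNIV]
        unfolding has_vector_derivative_def by blast
      show "onorm (\<lambda>h. h *\<^sub>R partial j F (\<chi> i. (z(j := w)) i)) \<le> L j"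
        by (rule onorm_bound) (use bd[of j] order_trans[OF norm_ge_zero bd] in \<open>auto simp: mult.commute intro!: mult_left_mono\<close>)
    qed auto
    then show ?thesis by simp
  qed
  have "norm (F (\<chi> i. if i \<in> A then x$i else y$i) - F y) \<le> (\<Sum>i\<in>A. L i * \<bar>x$i - y$i\<bar>)" if "finite A" for A
    using that
  proof (induction A)
    case empty show ?case by simp
  next
    case (insert j A)
    define z where "z = (\<lambda>i. if i \<in> A then x$i else y$i)"
    have 1: "(\<chi> i. if i \<in> insert j A then x$i else y$i) = (\<chi> i. (z(j := x$j)) i)"
      by (auto simp: vec_eq_iff z_def)
    have 2: "(\<chi> i. if i \<in> A then x$i else y$i) = (\<chi> i. (z(j := y$j)) i)"
      using insert by (auto simp: vec_eq_iff z_def)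
    have "norm (F (\<chi> i. if i \<in> insert j A then x$i else y$i) - F y) \<le>
       norm (F (\<chi> i. if i \<in> insert j A then x$i else y$i) - F (\<chi> i. if i \<in> A then x$i else y$i)) +
       norm (F (\<chi> i. if i \<in> A then x$i else y$i) - F y)"
      using norm_triangle_ineq[of "F (\<chi> i. if i \<in> insert j A then x$i else y$i) - F (\<chi> i. if i \<in> A then x$i else y$i)"
          "F (\<chi> i. if i \<in> A then x$i else y$i) - F y"] by simp
    also have "\<dots> \<le> L j * \<bar>x$j - y$j\<bar> + (\<Sum>i\<in>A. L i * \<bar>x$i - y$i\<bar>)"
      unfolding 1 by (rule add_mono) (unfold 2, rule one, rule insert.IH[unfolded 2])
    finally show ?case using insert by simp
  qed
  from this[of UNIV] show ?thesis by simp
qed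

section \<open>Coordinates of Lebesgue measure\<close>

lemma measurable_vec [measurable]:
  "(\<lambda>z::'n::finite \<Rightarrow> real. \<chi> i. z i) \<in> PiM UNIV (\<lambda>_. lborel) \<rightarrow>\<^sub>M (borel :: (real^'n) measure)"
proof (rule borel_measurable_euclidean_space[THEN iffD2], rule ballI)
  fix b :: "real^'n" assume "b \<in> Basis"
  then obtain j where "b = axis j 1" by (auto simp: Basis_vec_def)
  then show "(\<lambda>z::'n \<Rightarrow> real. (\<chi> i. z i) \<bullet> b) \<in> borel_measurable (PiM UNIV (\<lambda>_. lborel))"
    by (simp add: inner_axis)
qed

text \<open>Lebesgue measure is determined by its values on boxes. Replacing vectors by functions on
  the index set makes deletion of a coordinate a restriction and Fubini a statement about
  products.\<close>

lemma lborel_vec_eq_distr: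
  "(lborel :: (real^'n::finite) measure) = distr (PiM UNIV (\<lambda>_. lborel)) borel (\<lambda>z. \<chi> i. z i)"
proof (rule lborel_eqI)
  interpret product_sigma_finite "\<lambda>_::'n. lborel :: real measure" by standard
  fix l u :: "real^'n" assume lu: "\<And>b. b \<in> Basis \<Longrightarrow> l \<bullet> b \<le> u \<bullet> b"
  have lu': "l$i \<le> u$i" for i using lu[of "axis i 1"] by (simp add: inner_axis)
  have "emeasure (distr (PiM UNIV (\<lambda>_. lborel)) borel (\<lambda>z. \<chi> i. z i)) (box l u)
     = emeasure (PiM UNIV (\<lambda>_. lborel)) (Pi\<^sub>E UNIV (\<lambda>i. {l$i<..<u$i}))"
    by (subst emeasure_distr[OF measurable_vec]) (auto simp: space_PiM mem_box_cart PiE_def Pi_def intro!: arg_cong2[where f = emeasure])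
  also have "\<dots> = (\<Prod>i\<in>UNIV. emeasure lborel {l$i<..<u$i})"
    by (rule emeasure_PiM) auto
  also have "\<dots> = ennreal (\<Prod>i\<in>UNIV. u$i - l$i)"
    using lu' by (simp add: prod_ennreal)
  also have "(\<Prod>i\<in>UNIV. u$i - l$i) = (\<Prod>b\<in>Basis. (u - l) \<bullet> b)"
  proof -
    have inj: "inj (\<lambda>i::'n. axis i (1::real))" by (auto simp: inj_on_def axis_eq_axis)
    have Basis: "(Basis :: (real^'n) set) = range (\<lambda>i. axis i 1)" by (auto simp: Basis_vec_def)
    have "(\<Prod>b\<in>Basis. (u - l) \<bullet> b) = (\<Prod>i\<in>UNIV. (u - l) \<bullet> axis i 1)"
      unfolding Basis prod.reindex[OF inj] o_def ..
    then show ?thesis by (simp add: inner_axis)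
  qed
  finally show "emeasure (distr (PiM UNIV (\<lambda>_. lborel)) borel (\<lambda>z. \<chi> i. z i)) (box l u) = (\<Prod>b\<in>Basis. (u - l) \<bullet> b)" .
qed simp

lemma integral_lborel_vec:
  fixes h :: "real^'n::finite \<Rightarrow> 'b::{banach, second_countable_topology}"
  assumes "h \<in> borel_measurable borel"
  shows "(\<integral>x. h x \<partial>lborel) = (\<integral>z. h (\<chi> i. z i) \<partial>PiM UNIV (\<lambda>_. lborel))"
  by (subst lborel_vec_eq_distr) (rule integral_distr[OF measurable_vec assms])

text \<open>Cutting down by a density leaves the whole line as the underlying space.\<close>

definition interval_lborel :: "('i \<Rightarrow> real) \<Rightarrow> ('i \<Rightarrow> real) \<Rightarrow> 'i \<Rightarrow> real measure" where
  "interval_lborel l u i = density lborel (\<lambda>s. indicator {l i..u i} s)"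

lemma interval_lborel_measures:
  assumes "\<And>i. l i < u i"
  shows "lebesgue_measures (interval_lborel l u)"
proof (rule lebesgue_measures.intro)
  fix i
  let ?M = "interval_lborel l u i"
  have em: "emeasure ?M A = emeasure lborel ({l i..u i} \<inter> A)" if "A \<in> sets borel" for A
  proof -
    have "emeasure ?M A = (\<integral>\<^sup>+s. indicator {l i..u i} s * indicator A s \<partial>lborel)"
      unfolding interval_lborel_def using that by (subst emeasure_density) auto
    also have "\<dots> = (\<integral>\<^sup>+s. indicator ({l i..u i} \<inter> A) s \<partial>lborel)"
      by (intro nn_integral_cong) (auto simp: indicator_def)
    finally show ?thesis using that by simp
  qed
  have eU: "emeasure ?M UNIV = ennreal (u i - l i)"
    using em[of UNIV] assms[of i] by simp
  have sp: "space ?M = UNIV" by (simp add: interval_lborel_def)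
  have fin: "finite_measure ?M" by (rule finite_measureI) (simp add: sp eU)
  show "dominated_by_lborel ?M"
  proof (intro dominated_by_lborel.intro dominated_by_lborel_axioms.intro fin)
    show "sets ?M = sets borel" by (simp add: interval_lborel_def)
    fix h :: "real \<Rightarrow> ennreal" assume [measurable]: "h \<in> borel_measurable borel"
    have "(\<integral>\<^sup>+x. h x \<partial>?M) = (\<integral>\<^sup>+x. indicator {l i..u i} x * h x \<partial>lborel)"
      unfolding interval_lborel_def by (rule nn_integral_density) auto
    also have "\<dots> \<le> (\<integral>\<^sup>+x. h x \<partial>lborel)" by (intro nn_integral_mono) (auto simp: indicator_def)
    finally show "(\<integral>\<^sup>+x. h x \<partial>?M) \<le> (\<integral>\<^sup>+x. h x \<partial>lborel)" .
  qed
  show "measure ?M UNIV > 0" unfolding measure_def eU using assms[of i] by simp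
qed

text \<open>Both measures give the same value to measurable rectangles. The identity transfers
  integrals and norms between the bounding box and the full space.\<close>

lemma PiM_interval_lborel:
  assumes I: "finite I" and lu: "\<And>i. l i < u i"
  shows "PiM I (interval_lborel l u) = density (PiM I (\<lambda>_. lborel)) (\<lambda>z. \<Prod>i\<in>I. indicator {l i..u i} (z i))"
proof -
  interpret A: lebesgue_measures "interval_lborel l u" by (rule interval_lborel_measures[OF lu])
  interpret L: product_sigma_finite "\<lambda>_. lborel :: real measure" by standard
  have dm: "(\<lambda>z. \<Prod>i\<in>I. indicator {l i..u i} (z i) :: ennreal) \<in> borel_measurable (PiM I (\<lambda>_. lborel))"
    by (intro borel_measurable_prod_ennreal) measurable
  have sets: "sets (density (PiM I (\<lambda>_. lborel)) (\<lambda>z. \<Prod>i\<in>I. indicator {l i..u i} (z i))) = sets (PiM I (interval_lborel l u))"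
    unfolding sets_density by (intro sets_PiM_cong) (auto simp: interval_lborel_def)
  show ?thesis
  proof (rule A.PiM_eqI[OF I sets, symmetric])
    fix Q assume Q: "\<And>i. i \<in> I \<Longrightarrow> Q i \<in> sets (interval_lborel l u i)"
    then have Qb [measurable]: "i \<in> I \<Longrightarrow> Q i \<in> sets borel" for i by (simp add: interval_lborel_def)
    have Qs: "Pi\<^sub>E I Q \<in> sets (PiM I (\<lambda>_. lborel))" using I Qb by (intro sets_PiM_I_finite) auto
    have "emeasure (density (PiM I (\<lambda>_. lborel)) (\<lambda>z. \<Prod>i\<in>I. indicator {l i..u i} (z i))) (Pi\<^sub>E I Q)
      = (\<integral>\<^sup>+z. (\<Prod>i\<in>I. indicator {l i..u i} (z i)) * indicator (Pi\<^sub>E I Q) z \<partial>PiM I (\<lambda>_. lborel))"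
      by (rule emeasure_density[OF dm Qs])
    also have "\<dots> = (\<integral>\<^sup>+z. (\<Prod>i\<in>I. indicator {l i..u i} (z i) * indicator (Q i) (z i)) \<partial>PiM I (\<lambda>_. lborel))"
    proof (intro nn_integral_cong)
      fix z :: "'a \<Rightarrow> real" assume "z \<in> space (PiM I (\<lambda>_. lborel))"
      then have ext: "z \<in> extensional I" by (auto simp: space_PiM PiE_def)
      have "indicator (Pi\<^sub>E I Q) z = (\<Prod>i\<in>I. indicator (Q i) (z i) :: ennreal)"
      proof (cases "z \<in> Pi\<^sub>E I Q")
        case True
        then have "z i \<in> Q i" if "i \<in> I" for i using that by auto
        then have "(\<Prod>i\<in>I. indicator (Q i) (z i) :: ennreal) = 1" by (intro prod.neutral) auto
        then show ?thesis using True by simp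
      next
        case False
        then obtain i where "i \<in> I" "z i \<notin> Q i" using ext by (auto simp: PiE_def)
        then have "(\<Prod>i\<in>I. indicator (Q i) (z i) :: ennreal) = 0" using I by (intro prod_zero bexI[of _ i]) auto
        then show ?thesis using False by simp
      qed
      then show "(\<Prod>i\<in>I. indicator {l i..u i} (z i)) * indicator (Pi\<^sub>E I Q) z =
        (\<Prod>i\<in>I. indicator {l i..u i} (z i) * indicator (Q i) (z i) :: ennreal)" by (simp add: prod.distrib)
    qed
    also have "\<dots> = (\<Prod>i\<in>I. (\<integral>\<^sup>+s. indicator {l i..u i} s * indicator (Q i) s \<partial>lborel))"
      using I by (intro L.product_nn_integral_prod) auto
    also have "\<dots> = (\<Prod>i\<in>I. emeasure (interval_lborel l u i) (Q i))"
      by (intro prod.cong refl) (simp add: interval_lborel_def emeasure_density)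
    finally show "emeasure (density (PiM I (\<lambda>_. lborel)) (\<lambda>z. \<Prod>i\<in>I. indicator {l i..u i} (z i))) (Pi\<^sub>E I Q)
       = (\<Prod>i\<in>I. emeasure (interval_lborel l u i) (Q i))" .
  qed
qed

text \<open>Loomis-Whitney for counting measure, applied to the powers N powr (d - 1), bounds the
  sum by discrete norms of exponent d - 1. As P exceeds d - 1, Hoelder passes to the exponent P at
  the price of a power of the number of grid points.\<close>

lemma discrete_Loomis_Whitney:
  fixes N :: "'n::finite \<Rightarrow> ('n \<Rightarrow> nat) \<Rightarrow> real" and P :: real
  assumes d: "CARD('n) \<ge> 2" and K: "K > 0" and P: "P > real (CARD('n) - 1)"
    and N0: "\<And>j v. N j v \<ge> 0" and A0: "\<And>j. A j \<ge> 0"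
    and NA: "\<And>j. (\<Sum>v\<in>Pi\<^sub>E (UNIV - {j}) (\<lambda>_. {..<K}). N j v powr P) \<le> A j powr P"
  shows "(\<Sum>\<kappa>\<in>Pi\<^sub>E UNIV (\<lambda>_. {..<K}). \<Prod>j\<in>UNIV. N j (restrict \<kappa> (UNIV - {j})))
    \<le> real K powr (real CARD('n) * (1 - real (CARD('n) - 1) / P)) * (\<Prod>j\<in>UNIV. A j)"
proof -
  define e where "e = real (CARD('n) - 1)"
  have e: "e > 0" "e < P" using d P by (auto simp: e_def)
  interpret finite_measures "\<lambda>_::'n. count_space {..<K}"
    by (rule finite_measures.intro) (rule finite_measure_count_space, simp)
  let ?V = "\<lambda>I::'n set. Pi\<^sub>E I (\<lambda>_. {..<K})"
  have finV: "finite (?V I)" for I by (intro finite_PiE) auto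
  have cs: "PiM I (\<lambda>_. count_space {..<K}) = count_space (?V I)" for I :: "'n set"
    by (rule count_space_PiM_finite) auto
  have sumV: "(\<integral>v. h v \<partial>PiM I (\<lambda>_. count_space {..<K})) = (\<Sum>v\<in>?V I. h v)" for I :: "'n set" and h :: "_ \<Rightarrow> real"
    unfolding cs using finV by (simp add: lebesgue_integral_count_space_finite)
  define g where "g j v = (if v \<in> ?V (UNIV - {j}) then N j v powr e else 0)" for j v
  have g0: "g j v \<ge> 0" for j v by (simp add: g_def)
  have bg: "bounded_fun (g j)" for j
  proof -
    have "norm (g j v) \<le> (\<Sum>v\<in>?V (UNIV - {j}). N j v powr e)" for v
    proof (cases "v \<in> ?V (UNIV - {j})")
      case True
      then have "N j v powr e \<le> (\<Sum>v\<in>?V (UNIV - {j}). N j v powr e)"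
        by (rule member_le_sum) (use finV in simp_all)
      then show ?thesis using True by (simp add: g_def)
    next
      case False
      then show ?thesis by (simp add: g_def sum_nonneg)
    qed
    then show ?thesis unfolding bounded_fun_def by blast
  qed
  have "(\<Sum>\<kappa>\<in>?V UNIV. \<Prod>j\<in>UNIV. N j (restrict \<kappa> (UNIV - {j}))) =
    (\<Sum>\<kappa>\<in>?V UNIV. \<Prod>j\<in>UNIV. g j (restrict \<kappa> (UNIV - {j})) powr (1 / e))"
  proof (intro sum.cong prod.cong refl)
    fix \<kappa> j assume "\<kappa> \<in> ?V UNIV"
    then have "restrict \<kappa> (UNIV - {j}) \<in> ?V (UNIV - {j})" by auto
    then show "N j (restrict \<kappa> (UNIV - {j})) = g j (restrict \<kappa> (UNIV - {j})) powr (1 / e)"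
      using N0 e by (simp add: g_def powr_powr)
  qed
  also have "\<dots> \<le> (\<Prod>j\<in>UNIV. (\<Sum>v\<in>?V (UNIV - {j}). g j v) powr (1 / e))"
    using Loomis_Whitney[of UNIV g] d bg g0 unfolding sumV e_def by (simp add: cs)
  also have "\<dots> \<le> (\<Prod>j\<in>UNIV. real K powr (1 - e / P) * A j)"
  proof (intro prod_mono conjI)
    fix j :: 'n
    let ?W = "?V (UNIV - {j})"
    have "real (card ?W) = real K ^ (CARD('n) - 1)" by (simp add: card_PiE)
    also have "\<dots> = real K powr e" unfolding e_def using K by (intro powr_realpow[symmetric]) simp
    finally have cW: "real (card ?W) = real K powr e" .
    \<comment> \<open>Hoelder against the constant 1 on K powr e points, the source of the loss:
      after the root 1 / e it is K powr (1 - e / P) for every j.\<close>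
    have "(\<integral>v. (N j v powr P) powr (e / P) * 1 powr (1 - e / P) \<partial>count_space ?W) \<le>
       (\<integral>v. N j v powr P \<partial>count_space ?W) powr (e / P) * (\<integral>v. 1 \<partial>count_space ?W) powr (1 - e / P)"
      using e finV by (intro Holder_2(2) integrable_count_space) auto
    then have "(\<Sum>v\<in>?W. N j v powr e) \<le> (\<Sum>v\<in>?W. N j v powr P) powr (e / P) * (real K powr e) powr (1 - e / P)"
      using finV e by (simp add: lebesgue_integral_count_space_finite powr_powr cW)
    also have "\<dots> \<le> (A j powr P) powr (e / P) * (real K powr e) powr (1 - e / P)"
      using NA e by (intro mult_right_mono powr_mono2) (auto intro!: sum_nonneg)
    finally have le: "(\<Sum>v\<in>?W. g j v) \<le> A j powr e * real K powr (e * (1 - e / P))"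
      using e by (simp add: g_def powr_powr)
    have "(\<Sum>v\<in>?W. g j v) powr (1 / e) \<le> (A j powr e * real K powr (e * (1 - e / P))) powr (1 / e)"
      using le g0 e by (intro powr_mono2) (auto intro!: sum_nonneg)
    also have "\<dots> = real K powr (1 - e / P) * A j"
      using e A0 by (simp add: powr_mult powr_powr mult.commute)
    finally show "(\<Sum>v\<in>?W. g j v) powr (1 / e) \<le> real K powr (1 - e / P) * A j" .
  qed simp
  also have "\<dots> = real K powr (real CARD('n) * (1 - e / P)) * (\<Prod>j\<in>UNIV. A j)"
    using K by (simp add: prod.distrib powr_power mult.commute)
  finally show ?thesis by (simp add: e_def)
qed

section \<open>Whitney cells\<close>

text \<open>\<open>t # js\<close> is the enumeration behind \<open>Dd\<close>, so \<open>t\<close>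
  is its outermost derivative. This is the variable in which the phase will be integrated, and those
  of \<open>js\<close> are removed by differencing.\<close>

locale oscillatory_form =
  fixes lam \<mu> C1 C2 :: real and S :: "real^'n::finite \<Rightarrow> real" and \<psi> :: "real^'n \<Rightarrow> complex"
    and b lo :: "'n \<Rightarrow> real" and U :: "(real^'n) set" and t :: 'n and js :: "'n list"
  assumes lam: "lam > 0" and \<mu>: "\<mu> > 0" and C1: "C1 > 0" and C2: "C2 > 0" and b: "\<And>j. b j > 0"
    and smooth: "smooth_on UNIV \<psi>"
    and analytic: "real_analytic_on U S" and suppU: "tsupport \<psi> \<subseteq> U"
    and supp: "\<And>j x. x \<in> tsupport \<psi> \<Longrightarrow> lo j \<le> x$j \<and> x$j \<le> lo j + b j"
    and \<psi>_bound: "\<And>j n x. n \<le> 2 \<Longrightarrow> norm (partial_pow j n \<psi> x) \<le> C1 / b j ^ n"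
    and D_bound: "\<And>x. x \<in> tsupport \<psi> \<Longrightarrow> \<mu> \<le> \<bar>Dd S x\<bar>"
      "\<And>x. x \<in> tsupport \<psi> \<Longrightarrow> \<bar>partial t (Dd S) x\<bar> \<le> C2 * \<mu> / b t"
      "\<And>x. x \<in> tsupport \<psi> \<Longrightarrow> \<bar>partial_pow t 2 (Dd S) x\<bar> \<le> C2 * \<mu> / (b t)\<^sup>2"
    and js: "distinct (t # js)" "set (t # js) = UNIV" and Dd_eq: "Dd S = iter_partial (t # js) S"
    and card3: "CARD('n) \<ge> 3"
begin

definition vec :: "('n \<Rightarrow> real) \<Rightarrow> real^'n" where "vec z = (\<chi> i. z i)"

definition M :: "'n \<Rightarrow> real measure" where "M = interval_lborel lo (\<lambda>i. lo i + b i)"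

sublocale lebesgue_measures M
  unfolding M_def using b by (intro interval_lborel_measures) simp

definition kernel :: "('n \<Rightarrow> real) \<Rightarrow> complex" where
  "kernel z = exp (\<i> * of_real (lam * S (vec z))) * \<psi> (vec z)"

text \<open>The coordinate in units of the cell side b i / 2 ^ k. The grid is scaled by b in each
  direction separately, so that no constant will depend on b.\<close>

definition pos_in_grid :: "nat \<Rightarrow> 'n \<Rightarrow> real \<Rightarrow> real" where
  "pos_in_grid k i s = 2 ^ k * ((s - lo i) / b i)"

text \<open>Half-open, so that the cells of one generation are disjoint and a point determines its
  cell.\<close>

definition cell :: "nat \<Rightarrow> ('n \<Rightarrow> nat) \<Rightarrow> 'n \<Rightarrow> real set" where
  "cell k \<kappa> i = {s. real (\<kappa> i) \<le> pos_in_grid k i s \<and> pos_in_grid k i s < real (\<kappa> i) + 1}"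

text \<open>The star of a cell is wider than the cell in direction \<open>t\<close> only, where the cutoff needs room to vanish.\<close>
definition cell_lo :: "nat \<Rightarrow> ('n \<Rightarrow> nat) \<Rightarrow> real" where
  "cell_lo k \<kappa> = lo t + (real (\<kappa> t) - 1) * (b t / 2 ^ k)"

definition cell_hi :: "nat \<Rightarrow> ('n \<Rightarrow> nat) \<Rightarrow> real" where
  "cell_hi k \<kappa> = lo t + (real (\<kappa> t) + 2) * (b t / 2 ^ k)"

abbreviation in_star :: "nat \<Rightarrow> ('n \<Rightarrow> nat) \<Rightarrow> ('n \<Rightarrow> real) \<Rightarrow> bool" where
  "in_star k \<kappa> \<equiv> in_box (cell k \<kappa>) t (cell_lo k \<kappa>) (cell_hi k \<kappa>) js"

text \<open>The lower bound for \<open>Dd S\<close> then holds on a product set, which is what the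
  mean value theorem in the differenced variables requires.\<close>

definition good :: "nat \<Rightarrow> ('n \<Rightarrow> nat) \<Rightarrow> bool" where
  "good k \<kappa> \<longleftrightarrow> (\<forall>z. in_star k \<kappa> z \<longrightarrow> vec z \<in> tsupport \<psi>)"

text \<open>The maximal good cells of the dyadic tree; halving the index gives the parent, and
  generation 0 has none.\<close>

definition whitney :: "nat \<Rightarrow> ('n \<Rightarrow> nat) \<Rightarrow> bool" where
  "whitney k \<kappa> \<longleftrightarrow> good k \<kappa> \<and> (k = 0 \<or> \<not> good (k - 1) (\<lambda>i. \<kappa> i div 2))"

definition in_cell :: "'n set \<Rightarrow> nat \<Rightarrow> ('n \<Rightarrow> nat) \<Rightarrow> ('n \<Rightarrow> real) \<Rightarrow> bool" where
  "in_cell J k \<kappa> z \<longleftrightarrow> (\<forall>i\<in>J. z i \<in> cell k \<kappa> i)"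

section \<open>Geometry of cells and stars\<close>

lemma js_facts: "t \<notin> set js" "insert t (set js) = UNIV" "length js = CARD('n) - 1"
proof -
  show "t \<notin> set js" "insert t (set js) = UNIV" using js by auto
  have "length (t # js) = card (set (t # js))" using js(1) by (metis distinct_card)
  then show "length js = CARD('n) - 1" using js(2) by simp
qed

lemma in_cell_lo_hi: "s \<in> {cell_lo k \<kappa>..cell_hi k \<kappa>} \<longleftrightarrow> real (\<kappa> t) - 1 \<le> pos_in_grid k t s \<and> pos_in_grid k t s \<le> real (\<kappa> t) + 2"
proof -
  have "pos_in_grid k t s = (s - lo t) / (b t / 2 ^ k)" by (simp add: pos_in_grid_def field_simps)
  moreover have "b t / 2 ^ k > 0" using b by simp
  moreover have "s \<in> {u + (v - 1) * e..u + (v + 2) * e} \<longleftrightarrow> v - 1 \<le> (s - u) / e \<and> (s - u) / e \<le> v + 2"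
    if "e > 0" for u v e :: real
    unfolding pos_le_divide_eq[OF that] pos_divide_le_eq[OF that] by auto
  ultimately show ?thesis unfolding cell_lo_def cell_hi_def by metis
qed

lemma cell_subset: "cell k \<kappa> t \<subseteq> {cell_lo k \<kappa>..cell_hi k \<kappa>}"
proof
  fix s assume "s \<in> cell k \<kappa> t"
  then show "s \<in> {cell_lo k \<kappa>..cell_hi k \<kappa>}" unfolding in_cell_lo_hi cell_def by auto
qed

lemma cell_lo_less_hi: "cell_lo k \<kappa> < cell_hi k \<kappa>" and cell_width: "cell_hi k \<kappa> - cell_lo k \<kappa> = 3 * (b t / 2 ^ k)"
proof -
  show w: "cell_hi k \<kappa> - cell_lo k \<kappa> = 3 * (b t / 2 ^ k)" 
  proof -
    have "(u + (v + 2) * e) - (u + (v - 1) * e) = 3 * e" for u v e :: real by (simp add: algebra_simps)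
    then show ?thesis unfolding cell_lo_def cell_hi_def .
  qed
  have "b t / 2 ^ k > 0" using b by simp
  then show "cell_lo k \<kappa> < cell_hi k \<kappa>" using w by linarith
qed

lemma is_interval_cell: "is_interval (cell k \<kappa> i)"
  unfolding is_interval_1 cell_def pos_in_grid_def
proof (intro ballI allI impI, elim CollectE conjE, intro CollectI conjI)
  fix u v x assume ux: "u \<le> x" "x \<le> v" and u: "real (\<kappa> i) \<le> 2 ^ k * ((u - lo i) / b i)" and v: "2 ^ k * ((v - lo i) / b i) < real (\<kappa> i) + 1"
  have "2 ^ k * ((u - lo i) / b i) \<le> 2 ^ k * ((x - lo i) / b i)" "2 ^ k * ((x - lo i) / b i) \<le> 2 ^ k * ((v - lo i) / b i)"
    using ux b[of i] by (auto intro!: mult_left_mono divide_right_mono)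
  then show "real (\<kappa> i) \<le> 2 ^ k * ((x - lo i) / b i)" "2 ^ k * ((x - lo i) / b i) < real (\<kappa> i) + 1"
    using u v by linarith+
qed

text \<open>The star of a cell lies in the star of its parent. Goodness is thus inherited by
  descendants, and maximal good cells are disjoint.\<close>

lemma good_child:
  assumes "good k (\<lambda>i. \<kappa> i div 2)" shows "good (Suc k) \<kappa>"
  unfolding good_def
proof (intro allI impI)
  fix z assume z: "in_star (Suc k) \<kappa> z"
  have pg: "pos_in_grid (Suc k) i s = 2 * pos_in_grid k i s" for i s by (simp add: pos_in_grid_def)
  have half: "real (\<kappa> i) - 1 \<le> 2 * real (\<kappa> i div 2)" "2 * real (\<kappa> i div 2) \<le> real (\<kappa> i)" for i by linarith+
  have "in_star k (\<lambda>i. \<kappa> i div 2) z"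
    unfolding in_box_def in_cell_lo_hi
  proof (intro conjI ballI)
    have "real (\<kappa> t) - 1 \<le> 2 * pos_in_grid k t (z t)" "2 * pos_in_grid k t (z t) \<le> real (\<kappa> t) + 2"
      using z unfolding in_box_def in_cell_lo_hi pg by auto
    then show "real (\<kappa> t div 2) - 1 \<le> pos_in_grid k t (z t)" "pos_in_grid k t (z t) \<le> real (\<kappa> t div 2) + 2"
      using half[of t] by linarith+
    fix i assume "i \<in> set js"
    then have "real (\<kappa> i) \<le> 2 * pos_in_grid k i (z i)" "2 * pos_in_grid k i (z i) < real (\<kappa> i) + 1"
      using z unfolding in_box_def cell_def pg by auto
    then show "z i \<in> cell k (\<lambda>i. \<kappa> i div 2) i"
      unfolding cell_def using half[of i] by (intro CollectI conjI) linarith+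
  qed
  then show "vec z \<in> tsupport \<psi>" using assms unfolding good_def by blast
qed

lemma \<psi>_zero: "x \<notin> tsupport \<psi> \<Longrightarrow> \<psi> x = 0"
  unfolding tsupport_def using closure_subset by force

lemma \<psi>_partial: "((\<lambda>h. iter_partial l \<psi> (x + h *\<^sub>R axis j 1)) has_vector_derivative iter_partial (j # l) \<psi> x) (at 0)"
  using smooth unfolding smooth_on_def by (auto simp: partial_def vector_derivative_works)

lemma \<psi>_bounds: "norm (\<psi> x) \<le> C1" "norm (partial j \<psi> x) \<le> C1 / b j" "norm (iter_partial [j, j] \<psi> x) \<le> C1 / (b j)\<^sup>2"
  using \<psi>_bound[of 0 j x] \<psi>_bound[of 1 j x] \<psi>_bound[of 2 j x] by (auto simp: partial_pow_def numeral_2_eq_2)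

definition c1 :: real where "c1 = 6 * real CARD('n) * C1"

lemma c1: "c1 \<ge> C1" "c1 > 0"
proof -
  have "1 \<le> 6 * real CARD('n)" using card3 by simp
  then show "c1 \<ge> C1" unfolding c1_def using C1 mult_right_mono[of 1 "6 * real CARD('n)" C1] by simp
  then show "c1 > 0" using C1 by linarith
qed

text \<open>For k > 0 the star of the parent contains a point outside the support, where \<psi>
  vanishes. Moving from there in direction i by at most 6 * b i / 2 ^ k, at the rate C1 / b i, and
  summing over the directions gives the constant \<open>c1\<close>.\<close>

lemma \<psi>_small:
  assumes w: "whitney k \<kappa>" and z: "in_star k \<kappa> z"
  shows "norm (\<psi> (vec z)) \<le> c1 / 2 ^ k"
proof (cases k)
  case 0
  then show ?thesis using \<psi>_bounds(1)[of "vec z"] c1 by simp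
next
  case (Suc l)
  define \<kappa>' where "\<kappa>' = (\<lambda>i. \<kappa> i div 2)"
  have "\<not> good l \<kappa>'" using w Suc by (simp add: whitney_def \<kappa>'_def)
  then obtain z' where z': "in_star l \<kappa>' z'" "vec z' \<notin> tsupport \<psi>" by (auto simp: good_def)
  have pg: "pos_in_grid (Suc l) i s = 2 * pos_in_grid l i s" for i s by (simp add: pos_in_grid_def)
  have half: "real (\<kappa> i) - 1 \<le> 2 * real (\<kappa> i div 2)" "2 * real (\<kappa> i div 2) \<le> real (\<kappa> i)" for i by linarith+
  \<comment> \<open>Both points lie in the star of the parent, which is at most three units of
    generation l wide, that is, six of generation k.\<close>
  have dist: "\<bar>vec z $ i - vec z' $ i\<bar> \<le> 6 * (b i / 2 ^ k)" for i
  proof -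
    have "\<bar>pos_in_grid l i (z i) - pos_in_grid l i (z' i)\<bar> \<le> 3"
    proof (cases "i = t")
      case True
      have "real (\<kappa> t) - 1 \<le> 2 * pos_in_grid l t (z t)" "2 * pos_in_grid l t (z t) \<le> real (\<kappa> t) + 2"
        using z unfolding Suc in_box_def in_cell_lo_hi pg by auto
      moreover have "real (\<kappa> t div 2) - 1 \<le> pos_in_grid l t (z' t)" "pos_in_grid l t (z' t) \<le> real (\<kappa> t div 2) + 2"
        using z'(1) unfolding in_box_def in_cell_lo_hi \<kappa>'_def by auto
      ultimately show ?thesis unfolding True using half[of t] by (simp only: abs_le_iff) linarith
    next
      case False
      then have i: "i \<in> set js" using js_facts(2) by auto
      have "real (\<kappa> i) \<le> 2 * pos_in_grid l i (z i)" "2 * pos_in_grid l i (z i) < real (\<kappa> i) + 1"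
        using z i unfolding Suc in_box_def cell_def pg by auto
      moreover have "real (\<kappa> i div 2) \<le> pos_in_grid l i (z' i)" "pos_in_grid l i (z' i) < real (\<kappa> i div 2) + 1"
        using z'(1) i unfolding in_box_def cell_def \<kappa>'_def by auto
      ultimately show ?thesis using half[of i] by (simp only: abs_le_iff) linarith
    qed
    moreover have "pos_in_grid l i (z i) - pos_in_grid l i (z' i) = (z i - z' i) * (2 ^ l / b i)"
      unfolding pos_in_grid_def by (simp add: diff_divide_distrib[symmetric] right_diff_distrib[symmetric])
    ultimately have "\<bar>z i - z' i\<bar> * (2 ^ l / b i) \<le> 3" using b[of i] by (simp add: abs_mult)
    then have "\<bar>z i - z' i\<bar> \<le> 3 * b i / 2 ^ l" using b[of i] by (simp add: field_simps)
    then show ?thesis by (simp add: vec_def Suc)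
  qed
  have "norm (\<psi> (vec z) - \<psi> (vec z')) \<le> (\<Sum>i\<in>UNIV. C1 / b i * \<bar>vec z $ i - vec z' $ i\<bar>)"
  proof (rule partials_Lipschitz)
    show "((\<lambda>h. \<psi> (x + h *\<^sub>R axis j 1)) has_vector_derivative partial j \<psi> x) (at 0)" for j x
      using \<psi>_partial[of "[]" x j] by simp
  qed (rule \<psi>_bounds)
  also have "\<dots> \<le> (\<Sum>i\<in>(UNIV::'n set). C1 / b i * (6 * (b i / 2 ^ k)))"
    using dist C1 b by (intro sum_mono mult_left_mono) (auto simp: less_imp_le)
  also have "\<dots> = (\<Sum>i\<in>(UNIV::'n set). 6 * C1 / 2 ^ k)"
    using b by (intro sum.cong refl) (simp add: less_imp_neq[symmetric])
  also have "\<dots> = c1 / 2 ^ k" by (simp add: c1_def)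
  finally show ?thesis using \<psi>_zero[OF z'(2)] by simp
qed

text \<open>A cutoff in \<open>x\<^sub>t\<close> that vanishes to second order at the end points of the enlarged interval and is
  at least \<open>1/2\<close> on the cell, so that it can be divided out again.\<close>
definition cutoff :: "nat \<Rightarrow> ('n \<Rightarrow> nat) \<Rightarrow> real \<Rightarrow> real" where
  "cutoff k \<kappa> s = (1 - (2 / 3 * (pos_in_grid k t s - real (\<kappa> t) - 1 / 2))\<^sup>2)\<^sup>2"

text \<open>The affine variable \<open>v\<close> carries the enlarged interval, three grid units
  long, onto [-1, 1]; this is the origin of the factor 2 / 3 in the derivatives.\<close>

definition cutoff1 :: "nat \<Rightarrow> ('n \<Rightarrow> nat) \<Rightarrow> real \<Rightarrow> real" where
  "cutoff1 k \<kappa> s = (let v = 2 / 3 * (pos_in_grid k t s - real (\<kappa> t) - 1 / 2) in - 4 * v * (1 - v\<^sup>2) * (2 / 3 * (2 ^ k / b t)))"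

definition cutoff2 :: "nat \<Rightarrow> ('n \<Rightarrow> nat) \<Rightarrow> real \<Rightarrow> real" where
  "cutoff2 k \<kappa> s = (let v = 2 / 3 * (pos_in_grid k t s - real (\<kappa> t) - 1 / 2) in (12 * v\<^sup>2 - 4) * (2 / 3 * (2 ^ k / b t))\<^sup>2)"

lemma pos_in_grid_deriv: "((\<lambda>s. 2 / 3 * (pos_in_grid k t s - real (\<kappa> t) - 1 / 2)) has_real_derivative 2 / 3 * (2 ^ k / b t)) (at s within A)"
  unfolding pos_in_grid_def using b[of t] by (auto intro!: derivative_eq_intros)

lemma cutoff_deriv: "(cutoff k \<kappa> has_real_derivative cutoff1 k \<kappa> s) (at s within A)"
  "(cutoff1 k \<kappa> has_real_derivative cutoff2 k \<kappa> s) (at s within A)"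
proof -
  define v where "v = (\<lambda>s. 2 / 3 * (pos_in_grid k t s - real (\<kappa> t) - 1 / 2))"
  define e where "e = 2 / 3 * (2 ^ k / b t)"
  have dv: "(v has_real_derivative e) (at s within A)" unfolding v_def e_def by (rule pos_in_grid_deriv)
  have "cutoff k \<kappa> = (\<lambda>s. (1 - (v s)\<^sup>2)\<^sup>2)" unfolding cutoff_def[abs_def] v_def ..
  moreover have "((\<lambda>s. (1 - (v s)\<^sup>2)\<^sup>2) has_real_derivative - 4 * v s * (1 - (v s)\<^sup>2) * e) (at s within A)"
    using dv by (auto intro!: derivative_eq_intros simp: algebra_simps power2_eq_square)
  moreover have "cutoff1 k \<kappa> s = - 4 * v s * (1 - (v s)\<^sup>2) * e" unfolding cutoff1_def v_def e_def Let_def ..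
  ultimately show "(cutoff k \<kappa> has_real_derivative cutoff1 k \<kappa> s) (at s within A)" by simp
  have "cutoff1 k \<kappa> = (\<lambda>s. - 4 * v s * (1 - (v s)\<^sup>2) * e)" unfolding cutoff1_def[abs_def] v_def e_def Let_def ..
  moreover have "((\<lambda>s. - 4 * v s * (1 - (v s)\<^sup>2) * e) has_real_derivative (12 * (v s)\<^sup>2 - 4) * e\<^sup>2) (at s within A)"
    using dv by (auto intro!: derivative_eq_intros simp: algebra_simps power2_eq_square)
  moreover have "cutoff2 k \<kappa> s = (12 * (v s)\<^sup>2 - 4) * e\<^sup>2" unfolding cutoff2_def v_def e_def Let_def ..
  ultimately show "(cutoff1 k \<kappa> has_real_derivative cutoff2 k \<kappa> s) (at s within A)" by simp
qed

lemma cutoff_bounds: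
  assumes s: "s \<in> {cell_lo k \<kappa>..cell_hi k \<kappa>}"
  shows "\<bar>cutoff k \<kappa> s\<bar> \<le> 1" "\<bar>cutoff1 k \<kappa> s\<bar> \<le> 3 * (2 ^ k / b t)" "\<bar>cutoff2 k \<kappa> s\<bar> \<le> 4 * (2 ^ k / b t)\<^sup>2"
proof -
  define v where "v = 2 / 3 * (pos_in_grid k t s - real (\<kappa> t) - 1 / 2)"
  define \<beta> where "\<beta> = 2 ^ k / b t"
  have \<beta>: "\<beta> > 0" using b by (simp add: \<beta>_def)
  have v: "\<bar>v\<bar> \<le> 1" using s unfolding in_cell_lo_hi v_def by (simp add: abs_le_iff field_simps)
  have v2: "v\<^sup>2 \<le> 1" "0 \<le> v\<^sup>2" using v by (auto simp: abs_square_le_1)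
  show "\<bar>cutoff k \<kappa> s\<bar> \<le> 1"
    unfolding cutoff_def v_def[symmetric] using v2 by (simp add: power_le_one)
  have "\<bar>cutoff1 k \<kappa> s\<bar> = 4 * \<bar>v\<bar> * \<bar>1 - v\<^sup>2\<bar> * (2 / 3 * \<beta>)"
    unfolding cutoff1_def Let_def v_def[symmetric] \<beta>_def[symmetric] using \<beta> by (simp add: abs_mult)
  also have "\<dots> \<le> 4 * 1 * 1 * (2 / 3 * \<beta>)"
    using v v2 \<beta> by (intro mult_right_mono mult_mono) auto
  also have "\<dots> \<le> 3 * \<beta>" using \<beta> by simp
  finally show "\<bar>cutoff1 k \<kappa> s\<bar> \<le> 3 * (2 ^ k / b t)" by (simp add: \<beta>_def)
  have "\<bar>cutoff2 k \<kappa> s\<bar> = \<bar>12 * v\<^sup>2 - 4\<bar> * (2 / 3 * \<beta>)\<^sup>2"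
    unfolding cutoff2_def Let_def v_def[symmetric] \<beta>_def[symmetric] by (simp add: abs_mult)
  also have "\<dots> \<le> 8 * (2 / 3 * \<beta>)\<^sup>2"
  proof (rule mult_right_mono)
    show "\<bar>12 * v\<^sup>2 - 4\<bar> \<le> 8" using v2 by (simp only: abs_le_iff) linarith
  qed simp
  also have "\<dots> \<le> 4 * \<beta>\<^sup>2" by (simp add: power_mult_distrib power2_eq_square)
  finally show "\<bar>cutoff2 k \<kappa> s\<bar> \<le> 4 * (2 ^ k / b t)\<^sup>2" by (simp add: \<beta>_def)
qed

lemma cutoff_ends:
  assumes "s = cell_lo k \<kappa> \<or> s = cell_hi k \<kappa>"
  shows "cutoff k \<kappa> s = 0" "cutoff1 k \<kappa> s = 0"
proof -
  define v where "v = 2 / 3 * (pos_in_grid k t s - real (\<kappa> t) - 1 / 2)"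
  have "pos_in_grid k t (cell_lo k \<kappa>) = real (\<kappa> t) - 1" "pos_in_grid k t (cell_hi k \<kappa>) = real (\<kappa> t) + 2"
    using b[of t] by (auto simp: pos_in_grid_def cell_lo_def cell_hi_def)
  then have "v = - 1 \<or> v = 1" using assms by (auto simp: v_def)
  then have "v\<^sup>2 = 1" by auto
  then show "cutoff k \<kappa> s = 0" "cutoff1 k \<kappa> s = 0"
    unfolding cutoff_def cutoff1_def Let_def v_def[symmetric] by auto
qed

lemma cutoff_ge_half:
  assumes "s \<in> cell k \<kappa> t" shows "cutoff k \<kappa> s \<ge> 1 / 2"
proof -
  define v where "v = 2 / 3 * (pos_in_grid k t s - real (\<kappa> t) - 1 / 2)"
  have "\<bar>v\<bar> \<le> 1 / 3" using assms unfolding cell_def v_def by (simp add: abs_le_iff field_simps)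
  then have "v\<^sup>2 \<le> (1 / 3)\<^sup>2" by (metis abs_ge_zero power2_abs power_mono)
  then have "1 - v\<^sup>2 \<ge> 8 / 9" by (simp add: power2_eq_square)
  then have "(1 - v\<^sup>2)\<^sup>2 \<ge> (8 / 9)\<^sup>2" by (intro power_mono) auto
  then show ?thesis unfolding cutoff_def v_def[symmetric] by (simp add: power2_eq_square)
qed

section \<open>Phase and amplitude on a star\<close>

lemma vec_in_U: "good k \<kappa> \<Longrightarrow> in_star k \<kappa> z \<Longrightarrow> vec z \<in> U"
  using suppU unfolding good_def by auto

text \<open>The t-derivatives stand innermost. Prepending a coordinate to \<open>l\<close> is then
  literally one more partial derivative, and for empty \<open>l\<close> so is raising n.\<close>

definition phase :: "nat \<Rightarrow> 'n list \<Rightarrow> ('n \<Rightarrow> real) \<Rightarrow> real" where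
  "phase n l z = iter_partial (l @ replicate n t) S (vec z)"

text \<open>The t-derivatives are moved outwards to meet the bounds for \<open>Dd S\<close>. These
  hold with 1 / b t and are weakened to 2 ^ k / b t, the rate at which the cutoff varies.\<close>

lemma phase_bounds_cell:
  assumes g: "good k \<kappa>"
  shows "phase_bounds (cell k \<kappa>) t (cell_lo k \<kappa>) (cell_hi k \<kappa>) \<mu> C2 (2 ^ k / b t) js phase"
proof -
  have der: "((\<lambda>s. iter_partial l S (vec (z(j := s)))) has_real_derivative iter_partial (j # l) S (vec z)) (at (z j) within A)"
    if "in_star k \<kappa> z" for l z j A
  proof -
    have "((\<lambda>h. iter_partial l S ((\<chi> i. (z(j := z j)) i) + h *\<^sub>R axis j 1)) has_vector_derivative partial j (iter_partial l S) (vec z)) (at 0)"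
      unfolding fun_upd_triv vec_def[symmetric]
      by (rule real_analytic_has_partial[OF real_analytic_iter_partial[OF analytic] vec_in_U[OF g that]])
    from has_vector_derivative_along_axis[OF this, of A]
    show ?thesis by (simp only: vec_def[symmetric] has_real_derivative_iff_has_vector_derivative iter_partial.simps)
  qed
  have in_t: "in_star k \<kappa> (z(t := s))" if "in_star k \<kappa> z" "s \<in> {cell_lo k \<kappa>..cell_hi k \<kappa>}" for z s
    using that js_facts(1) unfolding in_box_def by (metis fun_upd_other fun_upd_same)
  have mset3: "iter_partial (js @ replicate n t) S x = iter_partial (replicate n t @ js) S x" if "x \<in> U" for x n
    by (rule iter_partial_mset[OF analytic that]) simp
  have \<beta>1: "1 / b t \<le> 2 ^ k / b t" using b[of t] by (intro divide_right_mono) auto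
  show ?thesis unfolding phase_bounds_def
  proof (intro conjI allI impI)
    fix l1 i l2 n and z assume "js = l1 @ i # l2" "n \<in> {1, 2, 3::nat}" "in_star k \<kappa> z"
    then show "((\<lambda>s. phase n l2 (z(i := s))) has_real_derivative phase n (i # l2) z) (at (z i) within cell k \<kappa> i)"
      using der[of z "l2 @ replicate n t" i] by (simp add: phase_def)
  next
    fix n and z assume z: "n < (3::nat)" "in_star k \<kappa> z"
    show "((\<lambda>s. phase n [] (z(t := s))) has_real_derivative phase (Suc n) [] z) (at (z t) within {cell_lo k \<kappa>..cell_hi k \<kappa>})"
      using der[OF z(2), of "replicate n t" t] by (simp add: phase_def)
  next
    fix z assume z: "in_star k \<kappa> z"
    show "continuous_on {cell_lo k \<kappa>..cell_hi k \<kappa>} (\<lambda>s. phase 3 [] (z(t := s)))"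
    proof (rule DERIV_continuous_on)
      fix s assume s: "s \<in> {cell_lo k \<kappa>..cell_hi k \<kappa>}"
      have "((\<lambda>s'. phase 3 [] ((z(t := s))(t := s'))) has_real_derivative phase 4 [] (z(t := s))) (at ((z(t := s)) t) within {cell_lo k \<kappa>..cell_hi k \<kappa>})"
        using der[OF in_t[OF z s], of "replicate 3 t" t] by (simp add: phase_def eval_nat_numeral)
      then show "((\<lambda>s. phase 3 [] (z(t := s))) has_real_derivative phase 4 [] (z(t := s))) (at s within {cell_lo k \<kappa>..cell_hi k \<kappa>})"
        unfolding fun_upd_upd fun_upd_same .
    qed
    have x: "vec z \<in> tsupport \<psi>" "vec z \<in> U" using g z vec_in_U[OF g z] by (auto simp: good_def)
    show "\<mu> \<le> \<bar>phase 1 js z\<bar>"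
      using D_bound(1)[OF x(1)] unfolding phase_def mset3[OF x(2)] Dd_eq by simp
    have "\<bar>phase 2 js z\<bar> = \<bar>partial t (Dd S) (vec z)\<bar>"
      unfolding phase_def mset3[OF x(2)] Dd_eq by (simp add: numeral_2_eq_2)
    also have "\<dots> \<le> C2 * \<mu> * (1 / b t)" using D_bound(2)[OF x(1)] by simp
    also have "\<dots> \<le> C2 * \<mu> * (2 ^ k / b t)" using \<beta>1 C2 \<mu> by (intro mult_left_mono) auto
    finally show "\<bar>phase 2 js z\<bar> \<le> C2 * \<mu> * (2 ^ k / b t)" .
    have "\<bar>phase 3 js z\<bar> = \<bar>partial_pow t 2 (Dd S) (vec z)\<bar>"
      unfolding phase_def mset3[OF x(2)] Dd_eq partial_pow_def by (simp add: eval_nat_numeral)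
    also have "\<dots> \<le> C2 * \<mu> * (1 / b t)\<^sup>2" using D_bound(3)[OF x(1)] by (simp add: power_divide)
    also have "\<dots> \<le> C2 * \<mu> * (2 ^ k / b t)\<^sup>2" using \<beta>1 C2 \<mu> b[of t] by (intro mult_left_mono power_mono) auto
    finally show "\<bar>phase 3 js z\<bar> \<le> C2 * \<mu> * (2 ^ k / b t)\<^sup>2" .
  qed
qed

definition amp :: "nat \<Rightarrow> ('n \<Rightarrow> nat) \<Rightarrow> nat \<Rightarrow> ('n \<Rightarrow> real) \<Rightarrow> complex" where
  "amp k \<kappa> n z = (if n = 0 then cutoff k \<kappa> (z t) *\<^sub>R \<psi> (vec z)
     else if n = 1 then cutoff k \<kappa> (z t) *\<^sub>R iter_partial [t] \<psi> (vec z) + cutoff1 k \<kappa> (z t) *\<^sub>R \<psi> (vec z)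
     else (cutoff k \<kappa> (z t) *\<^sub>R iter_partial [t, t] \<psi> (vec z) + cutoff1 k \<kappa> (z t) *\<^sub>R iter_partial [t] \<psi> (vec z))
       + (cutoff1 k \<kappa> (z t) *\<^sub>R iter_partial [t] \<psi> (vec z) + cutoff2 k \<kappa> (z t) *\<^sub>R \<psi> (vec z)))"

text \<open>Undifferentiated, \<psi> is small by \<open>\<psi>_small\<close>. A derivative of \<psi>
  costs 1 / b t, smaller by 2 ^ k than the admissible \<beta> = 2 ^ k / b t, and this discrepancy
  supplies the factor 1 / 2 ^ k. In the second derivative the cutoff bounds 1, 3 and 4 add up to 1 +
  3 + 3 + 4 = 11.\<close>

lemma amplitude_bounds_cell:
  assumes w: "whitney k \<kappa>"
  shows "amplitude_bounds (cell k \<kappa>) t (cell_lo k \<kappa>) (cell_hi k \<kappa>) (11 * (c1 / 2 ^ k)) (2 ^ k / b t) js (amp k \<kappa>)"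
proof -
  define \<beta> where "\<beta> = 2 ^ k / b t"
  define c where "c = c1 / 2 ^ k"
  have \<beta>: "\<beta> > 0" using b by (simp add: \<beta>_def)
  have c: "c > 0" using c1 by (simp add: c_def)
  have der: "((\<lambda>s. iter_partial l \<psi> (vec (z(t := s)))) has_vector_derivative iter_partial (t # l) \<psi> (vec (z(t := s)))) (at s within A)" for l z s A
    unfolding vec_def by (rule has_vector_derivative_along_axis[OF \<psi>_partial])
  have amp0: "amp k \<kappa> 0 (z(t := s)) = cutoff k \<kappa> s *\<^sub>R iter_partial [] \<psi> (vec (z(t := s)))"
    and amp1: "amp k \<kappa> 1 (z(t := s)) = cutoff k \<kappa> s *\<^sub>R iter_partial [t] \<psi> (vec (z(t := s))) + cutoff1 k \<kappa> s *\<^sub>R iter_partial [] \<psi> (vec (z(t := s)))"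
    and amp2: "amp k \<kappa> 2 (z(t := s)) = (cutoff k \<kappa> s *\<^sub>R iter_partial [t, t] \<psi> (vec (z(t := s))) + cutoff1 k \<kappa> s *\<^sub>R iter_partial [t] \<psi> (vec (z(t := s))))
       + (cutoff1 k \<kappa> s *\<^sub>R iter_partial [t] \<psi> (vec (z(t := s))) + cutoff2 k \<kappa> s *\<^sub>R iter_partial [] \<psi> (vec (z(t := s))))" for z s
    unfolding amp_def by (auto simp only: fun_upd_same iter_partial.simps(1) if_True if_False zero_neq_one one_neq_zero simp_thms) auto
  have D0: "((\<lambda>s. amp k \<kappa> 0 (z(t := s))) has_vector_derivative amp k \<kappa> 1 (z(t := s))) (at s within A)" for z s A
    unfolding amp0 amp1 by (rule has_vector_derivative_scaleR[OF cutoff_deriv(1) der])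
  have D1: "((\<lambda>s. amp k \<kappa> 1 (z(t := s))) has_vector_derivative amp k \<kappa> 2 (z(t := s))) (at s within A)" for z s A
    unfolding amp1 amp2 by (intro has_vector_derivative_add has_vector_derivative_scaleR[OF cutoff_deriv(1) der] has_vector_derivative_scaleR[OF cutoff_deriv(2) der])
  have upd: "z(t := z t) = z" for z :: "'n \<Rightarrow> real" by simp
  have \<beta>1: "1 / b t = \<beta> * (1 / 2 ^ k)" by (simp add: \<beta>_def)
  have p1: "norm (iter_partial [t] \<psi> x) \<le> c * \<beta>" for x
  proof -
    have "norm (iter_partial [t] \<psi> x) \<le> C1 * (1 / b t)" using \<psi>_bounds(2)[of t x] by simp
    also have "\<dots> \<le> c1 * (1 / b t)" using c1 b[of t] by (intro mult_right_mono) auto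
    finally show ?thesis by (simp add: \<beta>1 c_def mult_ac)
  qed
  have p2: "norm (iter_partial [t, t] \<psi> x) \<le> c * \<beta>\<^sup>2" for x
  proof -
    have "norm (iter_partial [t, t] \<psi> x) \<le> C1 * ((1 / b t) * (1 / b t))" using \<psi>_bounds(3)[of t x] by (simp add: power2_eq_square)
    also have "\<dots> \<le> c1 * ((1 / b t) * \<beta>)"
      using c1 C1 b[of t] by (intro mult_mono) (auto simp: \<beta>_def divide_right_mono)
    finally show ?thesis by (simp add: \<beta>1 c_def power2_eq_square mult_ac)
  qed
  have p0: "norm (\<psi> (vec z)) \<le> c" if "in_star k \<kappa> z" for z unfolding c_def by (rule \<psi>_small[OF w that])
  show ?thesis unfolding amplitude_bounds_def \<beta>_def[symmetric] c_def[symmetric]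
  proof (intro conjI allI impI)
    fix n :: nat and z assume "n < 2"
    then have "n = 0 \<or> n = 1" by auto
    then show "((\<lambda>s. amp k \<kappa> n (z(t := s))) has_vector_derivative amp k \<kappa> (Suc n) z) (at (z t) within {cell_lo k \<kappa>..cell_hi k \<kappa>})"
    proof
      assume "n = 0" then show ?thesis using D0[of z "z t"] unfolding upd by simp
    next
      assume "n = 1" then show ?thesis using D1[of z "z t"] unfolding upd by (simp add: numeral_2_eq_2)
    qed
  next
    fix z
    have cc: "continuous_on A (cutoff k \<kappa>)" "continuous_on A (cutoff1 k \<kappa>)" "continuous_on A (cutoff2 k \<kappa>)" for A
      unfolding cutoff_def[abs_def] cutoff1_def[abs_def] cutoff2_def[abs_def] Let_def pos_in_grid_def using b[of t]
      by (auto intro!: continuous_intros)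
    have cp: "continuous_on A (\<lambda>s. iter_partial l \<psi> (vec (z(t := s))))" for A l
      by (rule continuous_on_vector_derivative[OF der])
    show "continuous_on {cell_lo k \<kappa>..cell_hi k \<kappa>} (\<lambda>s. amp k \<kappa> 2 (z(t := s)))"
      unfolding amp2 by (intro continuous_intros cc cp)
  next
    fix n :: nat and z assume n: "n \<le> 2" and z: "in_star k \<kappa> z"
    then have zt: "z t \<in> {cell_lo k \<kappa>..cell_hi k \<kappa>}" by (simp add: in_box_def)
    note cb = cutoff_bounds[OF zt, folded \<beta>_def]
    consider "n = 0" | "n = 1" | "n = 2" using n by linarith
    then show "norm (amp k \<kappa> n z) \<le> 11 * c * \<beta> ^ n"
    proof cases
      case 1
      have "norm (amp k \<kappa> 0 z) \<le> 1 * c"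
        unfolding amp0[of z "z t", unfolded upd iter_partial.simps(1)] norm_scaleR
        by (intro mult_mono cb p0[OF z]) (use c in auto)
      then show ?thesis using 1 c by simp
    next
      case 2
      have "norm (amp k \<kappa> 1 z) \<le> \<bar>cutoff k \<kappa> (z t)\<bar> * norm (iter_partial [t] \<psi> (vec z)) + \<bar>cutoff1 k \<kappa> (z t)\<bar> * norm (\<psi> (vec z))"
        unfolding norm_scaleR[symmetric] amp1[of z "z t", unfolded upd iter_partial.simps(1)] by (rule norm_triangle_ineq)
      also have "\<dots> \<le> 1 * (c * \<beta>) + 3 * \<beta> * c"
        using c \<beta> by (intro add_mono mult_mono cb p0[OF z] p1) auto
      also have "\<dots> = 4 * (c * \<beta>)" by (simp add: algebra_simps)
      also have "\<dots> \<le> 11 * c * \<beta>" using mult_pos_pos[OF c \<beta>] by linarith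
      finally show ?thesis using 2 by simp
    next
      case 3
      have "norm (amp k \<kappa> 2 z) \<le> (\<bar>cutoff k \<kappa> (z t)\<bar> * norm (iter_partial [t, t] \<psi> (vec z)) + \<bar>cutoff1 k \<kappa> (z t)\<bar> * norm (iter_partial [t] \<psi> (vec z)))
         + (\<bar>cutoff1 k \<kappa> (z t)\<bar> * norm (iter_partial [t] \<psi> (vec z)) + \<bar>cutoff2 k \<kappa> (z t)\<bar> * norm (\<psi> (vec z)))"
        unfolding norm_scaleR[symmetric] amp2[of z "z t", unfolded upd iter_partial.simps(1)]
        by (intro order.trans[OF norm_triangle_ineq] add_mono norm_triangle_ineq order.refl)
      also have "\<dots> \<le> (1 * (c * \<beta>\<^sup>2) + 3 * \<beta> * (c * \<beta>)) + (3 * \<beta> * (c * \<beta>) + 4 * \<beta>\<^sup>2 * c)"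
        using c \<beta> by (intro add_mono mult_mono cb p0[OF z] p1 p2) auto
      also have "\<dots> = 11 * c * \<beta>\<^sup>2" by (simp add: power2_eq_square algebra_simps)
      finally show ?thesis using 3 by simp
    qed
  next
    fix n :: nat and z assume "n < 2" and e: "z t = cell_lo k \<kappa> \<or> z t = cell_hi k \<kappa>"
    then have "n = 0 \<or> n = 1" by auto
    then show "amp k \<kappa> n z = 0" using cutoff_ends[OF e] by (auto simp: amp_def)
  qed
qed


section \<open>Measurability and the integral over one variable\<close>

lemma sets_PiM_M: "sets (PiM J M) = sets (PiM J (\<lambda>_. lborel))"
  by (intro sets_PiM_cong) (auto simp: M_def interval_lborel_def)

lemma component_measurable [measurable]: "i \<in> J \<Longrightarrow> (\<lambda>z. z i) \<in> borel_measurable (PiM J M)"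
  using measurable_component_singleton[of i J M] by (simp cong: measurable_cong_sets add: sets_M)

lemma \<psi>_continuous: "continuous_on A \<psi>"
proof -
  have "continuous_on UNIV (iter_partial [] \<psi>)" using smooth unfolding smooth_on_def by blast
  then show ?thesis by (auto intro: continuous_on_subset)
qed

text \<open>S is arbitrary outside U, so continuity is checked on two open sets that cover the
  space: U itself, and the complement of the support, where the kernel is zero.\<close>

lemma kernel_measurable:
  "(\<lambda>x. exp (\<i> * of_real (lam * S x)) * \<psi> x) \<in> borel_measurable borel" "kernel \<in> borel_measurable (PiM UNIV M)"
proof -
  let ?e = "\<lambda>x. exp (\<i> * of_real (lam * S x)) * \<psi> x"
  have op: "open U" using analytic by (simp add: real_analytic_on_def)
  have cl: "closed (tsupport \<psi>)" by (simp add: tsupport_def)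
  have "continuous_on U ?e"
    by (intro continuous_intros real_analytic_continuous_on[OF analytic] \<psi>_continuous)
  moreover have "continuous_on (- tsupport \<psi>) ?e"
    by (rule continuous_on_eq[where f = "\<lambda>_. 0"]) (auto simp: \<psi>_zero)
  ultimately have "continuous_on (U \<union> - tsupport \<psi>) ?e"
    using op cl by (intro continuous_on_open_Un) auto
  moreover have "U \<union> - tsupport \<psi> = UNIV" using suppU by auto
  ultimately show e: "?e \<in> borel_measurable borel" by (intro borel_measurable_continuous_onI) simp
  have "(\<lambda>z. ?e (\<chi> i. z i)) \<in> borel_measurable (PiM UNIV (\<lambda>_. lborel))"
    using measurable_compose[OF measurable_vec e] .
  moreover have "(\<lambda>z. ?e (\<chi> i. z i)) = kernel" by (auto simp: kernel_def vec_def)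
  ultimately show "kernel \<in> borel_measurable (PiM UNIV M)" by (simp cong: measurable_cong_sets add: sets_PiM_M)
qed

lemma norm_kernel: "norm (kernel z) = norm (\<psi> (vec z))"
  unfolding kernel_def norm_mult by simp

lemma in_cell_measurable [measurable]: "Measurable.pred (PiM J M) (\<lambda>v. in_cell J k \<kappa> v)"
proof -
  have "{v \<in> space (PiM J M). \<forall>i\<in>J. v i \<in> cell k \<kappa> i} \<in> sets (PiM J M)"
  proof (rule sets.sets_Collect_finite_All)
    fix i assume [measurable]: "i \<in> J"
    show "{v \<in> space (PiM J M). v i \<in> cell k \<kappa> i} \<in> sets (PiM J M)"
      unfolding cell_def pos_in_grid_def by measurable
  qed simp
  then show ?thesis unfolding in_cell_def pred_def .
qed

lemma in_star_measurable [measurable]: "Measurable.pred (PiM UNIV M) (\<lambda>z. in_star k \<kappa> z)"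
proof -
  have "{z \<in> space (PiM UNIV M). \<forall>i\<in>set js. z i \<in> cell k \<kappa> i} \<in> sets (PiM UNIV M)"
  proof (rule sets.sets_Collect_finite_All)
    fix i show "{v \<in> space (PiM UNIV M). v i \<in> cell k \<kappa> i} \<in> sets (PiM UNIV M)"
      unfolding cell_def pos_in_grid_def by measurable
  qed simp
  then have [measurable]: "Measurable.pred (PiM UNIV M) (\<lambda>z. \<forall>i\<in>set js. z i \<in> cell k \<kappa> i)" unfolding pred_def .
  show ?thesis unfolding in_box_def by measurable
qed

lemma in_cell_imp_in_star: "in_cell UNIV k \<kappa> z \<Longrightarrow> in_star k \<kappa> z"
  unfolding in_cell_def in_box_def using subsetD[OF cell_subset[of k \<kappa>], of "z t"] by blast

text \<open>A good star lies in the support and hence in the strip of width b t. The measure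
  \<open>M t\<close> is Lebesgue measure on that strip, so integrals over the enlarged interval lose
  nothing.\<close>

lemma good_star_range:
  assumes "good k \<kappa>"
  shows "lo t \<le> cell_lo k \<kappa>" "cell_hi k \<kappa> \<le> lo t + b t"
proof -
  define z where "z s = (\<lambda>i. if i = t then s else lo i + real (\<kappa> i) * (b i / 2 ^ k))" for s
  have pg: "pos_in_grid k i (lo i + real (\<kappa> i) * (b i / 2 ^ k)) = real (\<kappa> i)" for i
    using b[of i] by (simp add: pos_in_grid_def)
  have star: "in_star k \<kappa> (z s)" if "s \<in> {cell_lo k \<kappa>..cell_hi k \<kappa>}" for s
    unfolding in_box_def
  proof (intro conjI ballI)
    show "z s t \<in> {cell_lo k \<kappa>..cell_hi k \<kappa>}" using that by (simp add: z_def)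
    fix i assume "i \<in> set js"
    then have "z s i = lo i + real (\<kappa> i) * (b i / 2 ^ k)" using js_facts(1) by (auto simp: z_def)
    then show "z s i \<in> cell k \<kappa> i" unfolding cell_def by (simp only: mem_Collect_eq pg) simp
  qed
  have "vec (z s) \<in> tsupport \<psi>" if "s \<in> {cell_lo k \<kappa>..cell_hi k \<kappa>}" for s
    using assms star[OF that] unfolding good_def by blast
  then have "lo t \<le> s \<and> s \<le> lo t + b t" if "s \<in> {cell_lo k \<kappa>..cell_hi k \<kappa>}" for s
    using supp[of "vec (z s)" t] that by (auto simp: vec_def z_def)
  then show "lo t \<le> cell_lo k \<kappa>" "cell_hi k \<kappa> \<le> lo t + b t"
    using cell_lo_less_hi[of k \<kappa>] by auto
qed

lemma integral_M_interval:
  fixes h :: "real \<Rightarrow> complex"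
  assumes pq: "lo t \<le> p" "q \<le> lo t + b t" and h: "continuous_on {p..q} h"
  shows "(\<integral>s. (if s \<in> {p..q} then h s else 0) \<partial>M t) = integral {p..q} h"
proof -
  have si: "set_integrable lborel {p..q} h" by (rule borel_integrable_atLeastAtMost'[OF h])
  then have m: "(\<lambda>s. if s \<in> {p..q} then h s else 0) \<in> borel_measurable lborel"
    unfolding set_integrable_def by (auto simp: indicator_scaleR_eq_if dest!: borel_measurable_integrable)
  have Mt: "M t = density lborel (\<lambda>s. ennreal (indicator {lo t..lo t + b t} s))"
    unfolding M_def interval_lborel_def by (intro arg_cong2[where f = density] refl ext) (auto simp: indicator_def)
  have "(\<integral>s. (if s \<in> {p..q} then h s else 0) \<partial>M t) = (\<integral>s. indicator {lo t..lo t + b t} s *\<^sub>R (if s \<in> {p..q} then h s else 0) \<partial>lborel)"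
    unfolding Mt using m by (intro integral_density) auto
  also have "\<dots> = (\<integral>s. indicator {p..q} s *\<^sub>R h s \<partial>lborel)"
    using pq by (intro Bochner_Integration.integral_cong) (auto simp: indicator_def)
  also have "\<dots> = integral {p..q} h"
    using set_borel_integral_eq_integral(2)[OF si] by (simp add: set_lebesgue_integral_def)
  finally show ?thesis .
qed

text \<open>The leading 2 pays for the division by the cutoff. The power has the 3 cell sides that
  the enlarged interval is long, times the constant from integration by parts. The factor 44 * c1 is
  4 times the amplitude bound 11 * c1, without its 2 ^ k.\<close>

definition cell_const :: real where
  "cell_const = 2 * multilinear_const (CARD('n) - 2) * (3 * (1 + 4 * C2 + 3 * C2\<^sup>2)) powr (1 / 2 ^ (CARD('n) - 1)) * (44 * c1)"

definition decay :: real where "decay = (lam * \<mu>) powr (- (1 / 2 ^ (CARD('n) - 1)))"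

lemma cell_const_nonneg: "cell_const \<ge> 0" and decay_nonneg: "decay \<ge> 0"
  unfolding cell_const_def decay_def
  using multilinear_const_pos[of "CARD('n) - 2"] c1 by (auto intro!: mult_nonneg_nonneg less_imp_le)

definition P :: real where "P = p_exp CARD('n)"

text \<open>By the last identity d * (1 - (d - 1) / P) equals d / 2 ^ (d - 1), the exponent lost
  when the cells of one generation are added up.\<close>

lemma P_facts: "P > 0" "P > real (CARD('n) - 1)" "real (CARD('n) - 1) / P = 1 - 1 / 2 ^ (CARD('n) - 1)"
proof -
  define D where "D = (2::real) ^ (CARD('n) - 1)"
  have D: "D > 1" unfolding D_def using card3 by (intro one_less_power) auto
  have n: "real (CARD('n) - 1) > 0" using card3 by simp
  have P: "P = real (CARD('n) - 1) * D / (D - 1)" by (simp add: P_def p_exp_def D_def)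
  show "P > 0" using n D by (simp add: P)
  have "real (CARD('n) - 1) * (D - 1) < real (CARD('n) - 1) * D" using n by simp
  then show "P > real (CARD('n) - 1)" using n D by (simp add: P pos_less_divide_eq)
  show "real (CARD('n) - 1) / P = 1 - 1 / 2 ^ (CARD('n) - 1)"
    using n D unfolding P D_def[symmetric] by (simp add: diff_divide_distrib)
qed

text \<open>A sharp restriction of the kernel to the cell in x_t would ruin the integration by
  parts. So the kernel is taken on the star with the smooth cutoff, and the restriction to the cell
  as well as the reciprocal of the cutoff are shifted into the functions, which need only be bounded
  and measurable.\<close>

lemma cell_estimate:
  fixes f :: "'n \<Rightarrow> ('n \<Rightarrow> real) \<Rightarrow> complex"
  assumes w: "whitney k \<kappa>"
    and f: "\<And>j. f j \<in> borel_measurable (PiM (UNIV - {j}) M)" and fL: "\<And>j v. norm (f j v) \<le> L"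
  shows "norm (\<integral>z. (if in_cell UNIV k \<kappa> z then kernel z * (\<Prod>j\<in>UNIV. f j (restrict z (UNIV - {j}))) else 0) \<partial>PiM UNIV M)
    \<le> cell_const / 2 ^ k * decay *
      (\<Prod>j\<in>UNIV. (\<integral>v. (if in_cell (UNIV - {j}) k \<kappa> v then norm (f j v) powr P else 0) \<partial>PiM (UNIV - {j}) M) powr (1 / P))"
proof -
  have g: "good k \<kappa>" using w by (simp add: whitney_def)
  define m where "m = CARD('n) - 2"
  have cm: "CARD('n) = Suc (Suc m)" using card3 by (simp add: m_def)
  have len: "length js = Suc m" using js_facts(3) cm by simp
  \<comment> \<open>The cutoff depends on x_t, so its reciprocal must go into a function that sees
    this variable, that is, one with index different from t.\<close>
  define j0 where "j0 = hd js"
  have j0: "j0 \<in> set js" using len by (cases js) (auto simp: j0_def)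
  then have j0t: "j0 \<noteq> t" using js_facts(1) by auto
  have L0: "0 \<le> L" using fL[of t undefined] norm_ge_zero order_trans by blast
  define \<beta> where "\<beta> = 2 ^ k / b t"
  define c where "c = 11 * (c1 / 2 ^ k)"
  have \<beta>: "\<beta> > 0" using b by (simp add: \<beta>_def)
  have c: "c > 0" using c1 by (simp add: c_def)
  define p q where "p = cell_lo k \<kappa>" and "q = cell_hi k \<kappa>"
  have qp: "q - p = 3 / \<beta>" unfolding p_def q_def cell_width \<beta>_def using b[of t] by simp
  define K where "K = (\<lambda>z. if in_star k \<kappa> z then exp (\<i> * of_real (lam * phase 0 [] z)) * amp k \<kappa> 0 z else 0)"
  have K_eq: "K z = (if in_star k \<kappa> z then cutoff k \<kappa> (z t) *\<^sub>R kernel z else 0)" for z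
    by (simp add: K_def phase_def amp_def kernel_def)
  have Km: "K \<in> borel_measurable (PiM UNIV M)"
  proof -
    note [measurable] = kernel_measurable(2)
    show ?thesis unfolding K_eq[abs_def] cutoff_def pos_in_grid_def by measurable
  qed
  have KB: "norm (K z) \<le> C1" for z
  proof (cases "in_star k \<kappa> z")
    case True
    then have "\<bar>cutoff k \<kappa> (z t)\<bar> \<le> 1" by (intro cutoff_bounds(1)) (simp add: in_box_def)
    then have "\<bar>cutoff k \<kappa> (z t)\<bar> * norm (\<psi> (vec z)) \<le> 1 * C1" by (intro mult_mono \<psi>_bounds) auto
    then show ?thesis using True by (simp add: K_eq norm_kernel)
  next
    case False then show ?thesis using C1 by (simp add: K_eq)
  qed
  define B where "B = (q - p) * (1 + 4 * C2 + 3 * C2\<^sup>2) * (4 * c) ^ 2 ^ length js"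
  define \<kappa>c where "\<kappa>c = 3 * (1 + 4 * C2 + 3 * C2\<^sup>2)"
  have \<kappa>c: "\<kappa>c > 0" using C2 by (simp add: \<kappa>c_def add_pos_pos)
  have B_eq: "B = \<kappa>c * (4 * c) ^ 2 ^ Suc m / \<beta>" unfolding B_def qp len \<kappa>c_def by simp
  have B: "B > 0" unfolding B_eq using \<kappa>c \<beta> c by simp
  define \<eta> where "\<eta> = lam * \<mu> / \<beta>"
  have \<eta>: "\<eta> > 0" using lam \<mu> \<beta> by (simp add: \<eta>_def)
  have dec: "box_decay M t B js \<eta> K"
    unfolding B_def \<eta>_def K_def p_def q_def
  proof (rule box_decay_oscillatory[OF cell_lo_less_hi is_interval_cell \<beta> less_imp_le[OF C2] lam _ js(1) \<mu> less_imp_le[OF c]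
        phase_bounds_cell[OF g, folded \<beta>_def] amplitude_bounds_cell[OF w, folded \<beta>_def c_def]])
    show "(\<integral>s. (if s \<in> {cell_lo k \<kappa>..cell_hi k \<kappa>} then h s else 0) \<partial>M t) = integral {cell_lo k \<kappa>..cell_hi k \<kappa>} h"
      if "continuous_on {cell_lo k \<kappa>..cell_hi k \<kappa>} h" for h :: "real \<Rightarrow> complex"
      by (rule integral_M_interval[OF good_star_range[OF g] that])
  qed
  define h where "h j v = (if in_cell (UNIV - {j}) k \<kappa> v then (if j = j0 then of_real (1 / cutoff k \<kappa> (v t)) else 1) * f j v else 0)" for j v
  define wt where "wt j = (if j = j0 then 2 else 1 :: real)" for j
  have hm: "h j \<in> borel_measurable (PiM (UNIV - {j}) M)" for j
  proof (cases "j = j0")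
    case True
    note [measurable] = f[of j]
    have [measurable]: "(\<lambda>v. v t) \<in> borel_measurable (PiM (UNIV - {j}) M)" using True j0t by (intro component_measurable) auto
    show ?thesis unfolding h_def[abs_def] cutoff_def pos_in_grid_def by measurable
  next
    case False
    note [measurable] = f[of j]
    have "h j = (\<lambda>v. if in_cell (UNIV - {j}) k \<kappa> v then f j v else 0)" using False by (simp add: h_def fun_eq_iff)
    then show ?thesis by simp
  qed
  have hb: "norm (h j v) \<le> (if in_cell (UNIV - {j}) k \<kappa> v then wt j * norm (f j v) else 0)" for j v
  proof (cases "in_cell (UNIV - {j}) k \<kappa> v \<and> j = j0")
    case True
    then have "v t \<in> cell k \<kappa> t" using j0t by (auto simp: in_cell_def)
    then have cu: "cutoff k \<kappa> (v t) \<ge> 1 / 2" by (rule cutoff_ge_half)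
    then have "norm (h j v) = 1 / cutoff k \<kappa> (v t) * norm (f j v)" using True by (auto simp: h_def norm_mult norm_divide)
    also have "\<dots> \<le> 2 * norm (f j v)" using cu by (intro mult_right_mono) (auto simp: field_simps)
    finally show ?thesis using True by (auto simp: wt_def)
  next
    case False then show ?thesis by (auto simp: h_def wt_def)
  qed
  have hL: "norm (h j v) \<le> 2 * L" for j v
  proof -
    have "(if in_cell (UNIV - {j}) k \<kappa> v then wt j * norm (f j v) else 0) \<le> 2 * norm (f j v)"
      by (auto simp: wt_def)
    then have "norm (h j v) \<le> 2 * norm (f j v)" using hb[of j v] by (rule order_trans[rotated])
    then show ?thesis using fL[of j v] by linarith
  qed
  have eq: "K z * (\<Prod>j\<in>UNIV. h j (restrict z (UNIV - {j}))) =
    (if in_cell UNIV k \<kappa> z then kernel z * (\<Prod>j\<in>UNIV. f j (restrict z (UNIV - {j}))) else 0)" for z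
  proof (cases "in_cell UNIV k \<kappa> z")
    case True
    have zc: "z t \<in> cell k \<kappa> t" using True by (simp add: in_cell_def)
    have cu: "cutoff k \<kappa> (z t) \<noteq> 0" using cutoff_ge_half[OF zc] by auto
    have "h j (restrict z (UNIV - {j})) = (if j = j0 then of_real (1 / cutoff k \<kappa> (z t)) else 1) * f j (restrict z (UNIV - {j}))" for j
    proof -
      have "in_cell (UNIV - {j}) k \<kappa> (restrict z (UNIV - {j}))" using True by (simp add: in_cell_def)
      moreover have "restrict z (UNIV - {j}) t = z t" if "j = j0" using that j0t by simp
      ultimately show ?thesis by (auto simp: h_def)
    qed
    then have "(\<Prod>j\<in>UNIV. h j (restrict z (UNIV - {j}))) =
      (\<Prod>j\<in>UNIV. if j = j0 then of_real (1 / cutoff k \<kappa> (z t)) else 1) * (\<Prod>j\<in>UNIV. f j (restrict z (UNIV - {j})))"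
      by (simp add: prod.distrib)
    also have "(\<Prod>j\<in>UNIV. if j = j0 then of_real (1 / cutoff k \<kappa> (z t)) else 1) = complex_of_real (1 / cutoff k \<kappa> (z t))"
      by (simp add: prod.delta)
    finally have e: "(\<Prod>j\<in>UNIV. h j (restrict z (UNIV - {j}))) =
      complex_of_real (1 / cutoff k \<kappa> (z t)) * (\<Prod>j\<in>UNIV. f j (restrict z (UNIV - {j})))" .
    have alg: "complex_of_real u * v * (of_real (1 / u) * w) = v * w" if "u \<noteq> 0" for u v w using that by simp
    have "K z = of_real (cutoff k \<kappa> (z t)) * kernel z"
      using in_cell_imp_in_star[OF True] by (simp add: K_eq scaleR_conv_of_real)
    then show ?thesis unfolding e using True by (simp only: if_True alg[OF cu])
  next
    case False
    then obtain i where i: "z i \<notin> cell k \<kappa> i" by (auto simp: in_cell_def)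
    \<comment> \<open>Each coordinate i is an argument of some \<open>h j\<close> with j \<noteq> i,
      which vanishes when that coordinate leaves the cell.\<close>
    define j where "j = (if i = t then j0 else t)"
    have j: "j \<noteq> i" using j0t by (simp add: j_def)
    have "h j (restrict z (UNIV - {j})) = 0" using i j by (auto simp: h_def in_cell_def)
    then have "(\<Prod>j\<in>UNIV. h j (restrict z (UNIV - {j}))) = 0" by (intro prod_zero) auto
    then show ?thesis using False by simp
  qed
  have pe: "p_exp (Suc (Suc m)) = P" by (simp add: P_def cm)
  have "norm (\<integral>z. (if in_cell UNIV k \<kappa> z then kernel z * (\<Prod>j\<in>UNIV. f j (restrict z (UNIV - {j}))) else 0) \<partial>PiM UNIV M)
    \<le> multilinear_const m * (B / \<eta>) powr (1 / 2 ^ Suc m) * (\<Prod>j\<in>UNIV. (\<integral>v. norm (h j v) powr P \<partial>PiM (UNIV - {j}) M) powr (1 / P))"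
    unfolding eq[symmetric]
    using multilinear_bound_bounded[OF js(1) len js_facts(2)[symmetric] B \<eta> Km KB hm hL dec] unfolding pe .
  also have "\<dots> \<le> multilinear_const m * (B / \<eta>) powr (1 / 2 ^ Suc m) *
     (\<Prod>j\<in>UNIV. wt j * (\<integral>v. (if in_cell (UNIV - {j}) k \<kappa> v then norm (f j v) powr P else 0) \<partial>PiM (UNIV - {j}) M) powr (1 / P))"
  proof (intro mult_left_mono prod_mono conjI)
    fix j :: 'n
    let ?N = "PiM (UNIV - {j}) M"
    let ?I = "\<integral>v. (if in_cell (UNIV - {j}) k \<kappa> v then norm (f j v) powr P else 0) \<partial>?N"
    note [measurable] = f[of j] hm[of j]
    have wt1: "wt j \<ge> 1" by (simp add: wt_def)
    have "(\<integral>v. norm (h j v) powr P \<partial>?N) \<le> (\<integral>v. wt j powr P * (if in_cell (UNIV - {j}) k \<kappa> v then norm (f j v) powr P else 0) \<partial>?N)"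
    proof (rule integral_mono)
      show "integrable ?N (\<lambda>v. norm (h j v) powr P)"
        using hL P_facts(1) by (intro integrable_PiM_bounded[where B = "(2 * L) powr P"]) (auto intro!: powr_mono2)
      show "integrable ?N (\<lambda>v. wt j powr P * (if in_cell (UNIV - {j}) k \<kappa> v then norm (f j v) powr P else 0))"
        using fL P_facts(1) by (intro integrable_mult_right integrable_PiM_bounded[where B = "L powr P"]) (auto intro!: powr_mono2)
      fix v
      have "norm (h j v) powr P \<le> (if in_cell (UNIV - {j}) k \<kappa> v then wt j * norm (f j v) else 0) powr P"
        using hb P_facts(1) by (intro powr_mono2) auto
      also have "\<dots> = wt j powr P * (if in_cell (UNIV - {j}) k \<kappa> v then norm (f j v) powr P else 0)"
        using wt1 by (simp add: powr_mult)
      finally show "norm (h j v) powr P \<le> \<dots>" .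
    qed
    then have "(\<integral>v. norm (h j v) powr P \<partial>?N) powr (1 / P) \<le> (wt j powr P * ?I) powr (1 / P)"
      using P_facts(1) by (intro powr_mono2) (auto intro!: integral_nonneg_AE)
    also have "\<dots> = wt j * ?I powr (1 / P)"
      using P_facts(1) wt1 by (simp add: powr_mult powr_powr)
    finally show "(\<integral>v. norm (h j v) powr P \<partial>?N) powr (1 / P) \<le> wt j * ?I powr (1 / P)" .
  qed (use multilinear_const_pos[of m] in auto)
  also have "\<dots> = (2 * multilinear_const m * (B / \<eta>) powr (1 / 2 ^ Suc m)) *
     (\<Prod>j\<in>UNIV. (\<integral>v. (if in_cell (UNIV - {j}) k \<kappa> v then norm (f j v) powr P else 0) \<partial>PiM (UNIV - {j}) M) powr (1 / P))"
    unfolding prod.distrib by (simp add: wt_def prod.delta)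
  also have "2 * multilinear_const m * (B / \<eta>) powr (1 / 2 ^ Suc m) = cell_const / 2 ^ k * decay"
  proof -
    \<comment> \<open>\<beta> cancels between \<open>B\<close> and \<eta>, and the root of order 2 ^
      Suc m turns (4 * c) ^ 2 ^ Suc m into 4 * c, so that the gain 1 / 2 ^ k is kept in
      full.\<close>
    define D where "D = (2::nat) ^ Suc m"
    have D: "D > 0" by (simp add: D_def)
    have Dr: "(2::real) ^ Suc m = real D" by (simp add: D_def)
    have "B / \<eta> = \<kappa>c * (4 * c) ^ D / (lam * \<mu>)"
      unfolding B_eq \<eta>_def D_def using \<beta> lam \<mu> by simp
    also have "\<dots> = \<kappa>c * (4 * c) powr real D / (lam * \<mu>)" using c by (simp add: powr_realpow)
    finally have "(B / \<eta>) powr (1 / real D) = \<kappa>c powr (1 / real D) * (4 * c) / (lam * \<mu>) powr (1 / real D)"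
      using D c by (simp add: powr_divide powr_mult powr_powr)
    then have "(B / \<eta>) powr (1 / 2 ^ Suc m) = \<kappa>c powr (1 / 2 ^ Suc m) * (4 * c) * (lam * \<mu>) powr (- (1 / 2 ^ Suc m))"
      unfolding Dr by (simp add: powr_minus_divide)
    moreover have "CARD('n) - 1 = Suc m" "CARD('n) - 2 = m" using cm by auto
    ultimately show ?thesis unfolding cell_const_def decay_def c_def \<kappa>c_def by simp
  qed
  finally show ?thesis .
qed

section \<open>Summation over one generation\<close>

abbreviation grid :: "nat \<Rightarrow> 'n set \<Rightarrow> ('n \<Rightarrow> nat) set" where
  "grid k J \<equiv> Pi\<^sub>E J (\<lambda>_. {..<2 ^ k})"

lemma in_cell_unique:
  assumes "in_cell J k \<kappa> z" "in_cell J k \<kappa>' z" "i \<in> J"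
  shows "\<kappa> i = \<kappa>' i"
proof -
  have "real (\<kappa> i) < real (\<kappa>' i) + 1" "real (\<kappa>' i) < real (\<kappa> i) + 1"
    using assms unfolding in_cell_def cell_def by fastforce+
  then show ?thesis by linarith
qed

text \<open>For each j the cells of the projected grid are disjoint, so the P-th powers of the local
  norms of \<open>f j\<close> add up to at most that of the global norm. The discrete Loomis-Whitney
  inequality then sums the products, and its loss is outweighed by the factor 1 / 2 ^ k.\<close>

lemma layer_estimate:
  fixes f :: "'n \<Rightarrow> ('n \<Rightarrow> real) \<Rightarrow> complex"
  assumes f: "\<And>j. f j \<in> borel_measurable (PiM (UNIV - {j}) M)" and fL: "\<And>j v. norm (f j v) \<le> L"
  shows "(\<Sum>\<kappa>\<in>{\<kappa>\<in>grid k UNIV. whitney k \<kappa>}.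
      norm (\<integral>z. (if in_cell UNIV k \<kappa> z then kernel z * (\<Prod>j\<in>UNIV. f j (restrict z (UNIV - {j}))) else 0) \<partial>PiM UNIV M))
    \<le> cell_const * decay * (\<Prod>j\<in>UNIV. (\<integral>v. norm (f j v) powr P \<partial>PiM (UNIV - {j}) M) powr (1 / P)) * (2 powr (- (1 / 4))) ^ k"
proof -
  define N where "N j \<kappa> = (\<integral>v. (if in_cell (UNIV - {j}) k \<kappa> v then norm (f j v) powr P else 0) \<partial>PiM (UNIV - {j}) M) powr (1 / P)" for j \<kappa>
  define A where "A j = (\<integral>v. norm (f j v) powr P \<partial>PiM (UNIV - {j}) M) powr (1 / P)" for j
  have N0: "N j v \<ge> 0" and A0: "A j \<ge> 0" for j v by (auto simp: N_def A_def)
  have fin: "finite (grid k J)" for J by (intro finite_PiE) auto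
  have N_res: "N j \<kappa> = N j (restrict \<kappa> (UNIV - {j}))" for j \<kappa>
  proof -
    have "in_cell (UNIV - {j}) k \<kappa> v = in_cell (UNIV - {j}) k (restrict \<kappa> (UNIV - {j})) v" for v
      by (auto simp: in_cell_def cell_def)
    then show ?thesis by (simp add: N_def)
  qed
  have ic: "integrable (PiM (UNIV - {j}) M) (\<lambda>v. if in_cell (UNIV - {j}) k \<kappa> v then norm (f j v) powr P else 0)" for j \<kappa>
  proof -
    note [measurable] = f[of j]
    show ?thesis using fL P_facts(1) by (intro integrable_PiM_bounded[where B = "L powr P"]) (auto intro!: powr_mono2)
  qed
  have NA: "(\<Sum>v\<in>grid k (UNIV - {j}). N j v powr P) \<le> A j powr P" for j
  proof -
    let ?N = "PiM (UNIV - {j}) M"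
    let ?g = "\<lambda>\<kappa> v. if in_cell (UNIV - {j}) k \<kappa> v then norm (f j v) powr P else 0"
    note [measurable] = f[of j]
    have "N j \<kappa> powr P = (\<integral>v. ?g \<kappa> v \<partial>?N)" for \<kappa>
      unfolding N_def powr_powr using P_facts(1) by (simp add: integral_nonneg_AE)
    then have "(\<Sum>\<kappa>\<in>grid k (UNIV - {j}). N j \<kappa> powr P) = (\<integral>v. (\<Sum>\<kappa>\<in>grid k (UNIV - {j}). ?g \<kappa> v) \<partial>?N)"
      by (simp add: Bochner_Integration.integral_sum ic)
    also have "\<dots> \<le> (\<integral>v. norm (f j v) powr P \<partial>?N)"
    proof (rule integral_mono)
      show "integrable ?N (\<lambda>v. \<Sum>\<kappa>\<in>grid k (UNIV - {j}). ?g \<kappa> v)" using ic by auto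
      show "integrable ?N (\<lambda>v. norm (f j v) powr P)"
        using fL P_facts(1) by (intro integrable_PiM_bounded[where B = "L powr P"]) (auto intro!: powr_mono2)
      fix v
      show "(\<Sum>\<kappa>\<in>grid k (UNIV - {j}). ?g \<kappa> v) \<le> norm (f j v) powr P"
      proof (cases "\<exists>\<kappa>\<in>grid k (UNIV - {j}). in_cell (UNIV - {j}) k \<kappa> v")
        case True
        then obtain \<kappa>0 where \<kappa>0: "\<kappa>0 \<in> grid k (UNIV - {j})" "in_cell (UNIV - {j}) k \<kappa>0 v" by blast
        have "?g \<kappa> v = (if \<kappa> = \<kappa>0 then norm (f j v) powr P else 0)" if "\<kappa> \<in> grid k (UNIV - {j})" for \<kappa>
        proof -
          note \<kappa> = that
          show ?thesis
          proof (cases "in_cell (UNIV - {j}) k \<kappa> v")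
            case True
            have "\<kappa> = \<kappa>0" by (rule PiE_ext[OF \<kappa> \<kappa>0(1) in_cell_unique[OF True \<kappa>0(2)]])
            then show ?thesis using True by simp
          next
            case False
            then have "\<kappa> \<noteq> \<kappa>0" using \<kappa>0(2) by blast
            then show ?thesis using False by simp
          qed
        qed
        then have "(\<Sum>\<kappa>\<in>grid k (UNIV - {j}). ?g \<kappa> v) = (\<Sum>\<kappa>\<in>grid k (UNIV - {j}). if \<kappa> = \<kappa>0 then norm (f j v) powr P else 0)"
          by (rule sum.cong[OF refl])
        also have "\<dots> = norm (f j v) powr P" using \<kappa>0(1) fin by (simp add: sum.delta)
        finally show ?thesis by simp
      next
        case False
        then have "(\<Sum>\<kappa>\<in>grid k (UNIV - {j}). ?g \<kappa> v) = 0" by (intro sum.neutral ballI) simp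
        then show ?thesis by simp
      qed
    qed
    also have "\<dots> = A j powr P" unfolding A_def powr_powr using P_facts(1) by (simp add: integral_nonneg_AE)
    finally show ?thesis .
  qed
  have cd: "0 \<le> cell_const / 2 ^ k * decay" using cell_const_nonneg decay_nonneg by simp
  have "(\<Sum>\<kappa>\<in>{\<kappa>\<in>grid k UNIV. whitney k \<kappa>}.
      norm (\<integral>z. (if in_cell UNIV k \<kappa> z then kernel z * (\<Prod>j\<in>UNIV. f j (restrict z (UNIV - {j}))) else 0) \<partial>PiM UNIV M))
    \<le> (\<Sum>\<kappa>\<in>{\<kappa>\<in>grid k UNIV. whitney k \<kappa>}. cell_const / 2 ^ k * decay * (\<Prod>j\<in>UNIV. N j (restrict \<kappa> (UNIV - {j}))))"
    unfolding N_res[symmetric] unfolding N_def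
    by (rule sum_mono) (rule cell_estimate[OF _ f fL], simp)
  also have "\<dots> \<le> (\<Sum>\<kappa>\<in>grid k UNIV. cell_const / 2 ^ k * decay * (\<Prod>j\<in>UNIV. N j (restrict \<kappa> (UNIV - {j}))))"
    by (intro sum_mono2 mult_nonneg_nonneg[OF cd] prod_nonneg) (use fin N0 in auto)
  also have "\<dots> = cell_const / 2 ^ k * decay * (\<Sum>\<kappa>\<in>grid k UNIV. \<Prod>j\<in>UNIV. N j (restrict \<kappa> (UNIV - {j})))"
    by (simp only: sum_distrib_left)
  also have "\<dots> \<le> cell_const / 2 ^ k * decay * (real (2 ^ k) powr (real CARD('n) * (1 - real (CARD('n) - 1) / P)) * (\<Prod>j\<in>UNIV. A j))"
    using card3 by (intro mult_left_mono[OF _ cd] discrete_Loomis_Whitney P_facts(2) N0 A0 NA) auto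
  also have "\<dots> \<le> cell_const / 2 ^ k * decay * (real (2 ^ k) powr (3 / 4) * (\<Prod>j\<in>UNIV. A j))"
  proof (intro mult_left_mono[OF _ cd] mult_right_mono powr_mono)
    \<comment> \<open>Here the dimension has to be at least 3, with equality at 3. The net factor
      per generation is then 2 powr (3 / 4 - 1).\<close>
    have "4 * CARD('n) \<le> 3 * 2 ^ (CARD('n) - 1)"
    proof -
      have "4 * (n + 3) \<le> 3 * 2 ^ (n + 3 - 1)" for n :: nat by (induction n) (simp_all add: power_add)
      moreover obtain n where "CARD('n) = n + 3" using card3 by (metis add.commute le_Suc_ex)
      ultimately show ?thesis by (simp only:)
    qed
    then have "real (4 * CARD('n)) \<le> real (3 * 2 ^ (CARD('n) - 1))" by (simp only: of_nat_le_iff)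
    then have "real CARD('n) * (1 / 2 ^ (CARD('n) - 1)) \<le> 3 / 4" by (simp add: field_simps)
    then show "real CARD('n) * (1 - real (CARD('n) - 1) / P) \<le> 3 / 4" unfolding P_facts(3) by simp
    show "0 \<le> (\<Prod>j\<in>UNIV. A j)" using A0 by (intro prod_nonneg) auto
  qed auto
  also have "\<dots> = cell_const * decay * (\<Prod>j\<in>UNIV. A j) * (real (2 ^ k) powr (3 / 4) / 2 ^ k)" by simp
  also have "real (2 ^ k) powr (3 / 4) / 2 ^ k = (2 powr (- (1 / 4))) ^ k"
  proof -
    have "real (2 ^ k) powr (3 / 4) / 2 ^ k = 2 powr (real k * (3 / 4)) / 2 powr real k"
      by (simp add: powr_realpow[symmetric] powr_powr)
    also have "\<dots> = 2 powr (real k * (3 / 4) - real k)" by (simp only: powr_diff)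
    also have "real k * (3 / 4) - real k = (- (1 / 4)) * real k" by simp
    also have "2 powr ((- (1 / 4)) * real k) = (2 powr (- (1 / 4))) powr real k" by (simp only: powr_powr)
    also have "\<dots> = (2 powr (- (1 / 4))) ^ k" by (rule powr_realpow) simp
    finally show ?thesis .
  qed
  finally show ?thesis unfolding A_def .
qed


text \<open>The only candidate for a cell of generation k containing z. \<open>nat\<close> sends
  negative values to 0, so for z outside the box this need not be such a cell.\<close>

definition cell_index :: "nat \<Rightarrow> ('n \<Rightarrow> real) \<Rightarrow> 'n \<Rightarrow> nat" where
  "cell_index k z i = nat \<lfloor>pos_in_grid k i (z i)\<rfloor>"

lemma in_cell_index: "in_cell UNIV k \<kappa> z \<Longrightarrow> \<kappa> = cell_index k z"
proof
  fix i assume "in_cell UNIV k \<kappa> z"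
  then have "real (\<kappa> i) \<le> pos_in_grid k i (z i)" "pos_in_grid k i (z i) < real (\<kappa> i) + 1"
    by (auto simp: in_cell_def cell_def)
  then have "\<lfloor>pos_in_grid k i (z i)\<rfloor> = int (\<kappa> i)" by (simp add: floor_unique)
  then show "\<kappa> i = cell_index k z i" by (simp add: cell_index_def)
qed

text \<open>Floors commute with halving, so the cell containing a point is a child of the cell
  containing it one generation earlier.\<close>

lemma cell_index_half: "cell_index k z = (\<lambda>i. cell_index (Suc k) z i div 2)"
proof
  fix i
  have "pos_in_grid k i (z i) = pos_in_grid (Suc k) i (z i) / 2" by (simp add: pos_in_grid_def)
  then have "\<lfloor>pos_in_grid k i (z i)\<rfloor> = \<lfloor>pos_in_grid (Suc k) i (z i)\<rfloor> div 2"
    by (simp only: floor_divide_real_eq_div[of 2 "pos_in_grid (Suc k) i (z i)", simplified])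
  then show "cell_index k z i = cell_index (Suc k) z i div 2" by (simp add: cell_index_def nat_div_distrib')
qed

text \<open>Half-open like the cells, so that in every generation it is exactly partitioned by the
  cells of the grid.\<close>

definition in_open_box :: "('n \<Rightarrow> real) \<Rightarrow> bool" where
  "in_open_box z \<longleftrightarrow> (\<forall>i. lo i \<le> z i \<and> z i < lo i + b i)"

lemma cell_index_in_grid:
  assumes "in_open_box z"
  shows "cell_index k z \<in> grid k UNIV" "in_cell UNIV k (cell_index k z) z"
proof -
  have y: "0 \<le> pos_in_grid k i (z i)" "pos_in_grid k i (z i) < 2 ^ k" for i
  proof -
    have "0 \<le> (z i - lo i) / b i" "(z i - lo i) / b i < 1"
      using assms b[of i] by (auto simp: in_open_box_def field_simps)
    then have "0 \<le> 2 ^ k * ((z i - lo i) / b i)" "2 ^ k * ((z i - lo i) / b i) < 2 ^ k * 1"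
      by (intro mult_nonneg_nonneg mult_strict_left_mono; simp)+
    then show "0 \<le> pos_in_grid k i (z i)" "pos_in_grid k i (z i) < 2 ^ k" by (simp_all add: pos_in_grid_def)
  qed
  show "in_cell UNIV k (cell_index k z) z"
    unfolding in_cell_def cell_def cell_index_def using y(1) by (auto simp: of_nat_nat)
  have "cell_index k z i < 2 ^ k" for i
  proof -
    have "\<lfloor>pos_in_grid k i (z i)\<rfloor> < 2 ^ k" using y(2)[of i] by (simp add: floor_less_iff)
    then show ?thesis using y(1)[of i] by (simp add: cell_index_def nat_less_iff)
  qed
  then show "cell_index k z \<in> grid k UNIV" by auto
qed

lemma \<psi>_nonzero:
  assumes "\<psi> (vec z) \<noteq> 0"
  obtains r where "r > 0" "ball (vec z) r \<subseteq> tsupport \<psi>"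
proof -
  have "open {x. \<psi> x \<noteq> 0}"
    by (rule open_Collect_neq[OF \<psi>_continuous continuous_on_const])
  moreover have "vec z \<in> {x. \<psi> x \<noteq> 0}" using assms by simp
  ultimately obtain r where "r > 0" "ball (vec z) r \<subseteq> {x. \<psi> x \<noteq> 0}" by (rule openE)
  then show ?thesis using that closure_subset[of "{x. \<psi> x \<noteq> 0}"] unfolding tsupport_def by blast
qed

text \<open>Where \<psi> is nonzero a whole ball lies in the support; moving by half its radius
  along an axis makes the upper inequality strict.\<close>

lemma \<psi>_nonzero_in_box:
  assumes "\<psi> (vec z) \<noteq> 0" shows "in_open_box z"
  unfolding in_open_box_def
proof
  fix i
  obtain r where r: "r > 0" "ball (vec z) r \<subseteq> tsupport \<psi>" using \<psi>_nonzero[OF assms] .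
  have "vec z \<in> tsupport \<psi>" using r by auto
  then have 1: "lo i \<le> z i" using supp[of "vec z" i] by (simp add: vec_def)
  have "vec z + (r / 2) *\<^sub>R axis i 1 \<in> ball (vec z) r" using r(1) by (simp add: dist_norm)
  then have "vec z + (r / 2) *\<^sub>R axis i 1 \<in> tsupport \<psi>" using r(2) by blast
  from supp[OF this, of i] have "z i + r / 2 \<le> lo i + b i" by (simp add: vec_def axis_def)
  with 1 r(1) show "lo i \<le> z i \<and> z i < lo i + b i" by linarith
qed

text \<open>The stars around a fixed point shrink to it, and the point has a ball inside the
  support.\<close>

lemma eventually_good:
  assumes "\<psi> (vec z) \<noteq> 0"
  shows "eventually (\<lambda>k. good k (cell_index k z)) sequentially"
proof -
  obtain r where r: "r > 0" "ball (vec z) r \<subseteq> tsupport \<psi>" using \<psi>_nonzero[OF assms] .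
  \<comment> \<open>A point of the star is at most two grid units away from z in every direction, as
    z lies in the cell and the star exceeds the cell by one unit at each end.\<close>
  define R where "R = (\<Sum>i\<in>UNIV. 2 * b i)"
  have "(\<lambda>k. R * (1 / 2) ^ k) \<longlonglongrightarrow> R * 0" by (intro tendsto_intros LIMSEQ_power_zero) auto
  then have "eventually (\<lambda>k. R * (1 / 2) ^ k < r) sequentially" using r(1) by (auto dest: order_tendstoD)
  then show ?thesis
  proof eventually_elim
    case (elim k)
    note cz = cell_index_in_grid(2)[OF \<psi>_nonzero_in_box[OF assms], of k]
    show ?case unfolding good_def
    proof (intro allI impI)
      fix z' assume z': "in_star k (cell_index k z) z'"
      have "\<bar>z' i - z i\<bar> \<le> 2 * b i * (1 / 2) ^ k" for i
      proof -
        let ?\<kappa> = "cell_index k z i"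
        have "real ?\<kappa> \<le> pos_in_grid k i (z i)" "pos_in_grid k i (z i) < real ?\<kappa> + 1"
          using cz by (auto simp: in_cell_def cell_def)
        moreover have "real ?\<kappa> - 1 \<le> pos_in_grid k i (z' i) \<and> pos_in_grid k i (z' i) \<le> real ?\<kappa> + 2"
        proof (cases "i = t")
          case True
          then show ?thesis using z' unfolding in_box_def in_cell_lo_hi by auto
        next
          case False
          then have "i \<in> set js" using js_facts(2) by auto
          then have "z' i \<in> cell k (cell_index k z) i" using z' unfolding in_box_def by auto
          then show ?thesis by (auto simp: cell_def)
        qed
        ultimately have "\<bar>pos_in_grid k i (z' i) - pos_in_grid k i (z i)\<bar> \<le> 2"
          by (simp only: abs_le_iff) linarith
        moreover have "pos_in_grid k i (z' i) - pos_in_grid k i (z i) = (z' i - z i) * (2 ^ k / b i)"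
          unfolding pos_in_grid_def by (simp add: diff_divide_distrib[symmetric] right_diff_distrib[symmetric])
        ultimately have "\<bar>z' i - z i\<bar> * (2 ^ k / b i) \<le> 2" using b[of i] by (simp add: abs_mult)
        then show ?thesis using b[of i] by (simp add: field_simps)
      qed
      then have "(\<Sum>i\<in>UNIV. \<bar>(vec z' - vec z) $ i\<bar>) \<le> (\<Sum>i\<in>UNIV. 2 * b i * (1 / 2) ^ k)"
        by (intro sum_mono) (simp add: vec_def)
      then have "norm (vec z' - vec z) \<le> R * (1 / 2) ^ k"
        unfolding R_def sum_distrib_right by (rule order_trans[OF norm_le_l1_cart])
      then have "vec z' \<in> ball (vec z) r" using elim by (simp add: dist_norm norm_minus_commute)
      then show "vec z' \<in> tsupport \<psi>" using r(2) by blast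
    qed
  qed
qed

section \<open>Recovering the integrand from its Whitney pieces\<close>

definition integrand :: "('n \<Rightarrow> ('n \<Rightarrow> real) \<Rightarrow> complex) \<Rightarrow> ('n \<Rightarrow> real) \<Rightarrow> complex" where
  "integrand f z = kernel z * (\<Prod>j\<in>UNIV. f j (restrict z (UNIV - {j})))"

lemma integrand_zero: "\<psi> (vec z) = 0 \<Longrightarrow> integrand f z = 0"
  by (simp add: integrand_def kernel_def)

lemma integrand_measurable:
  assumes "\<And>j. f j \<in> borel_measurable (PiM (UNIV - {j}) M)"
  shows "integrand f \<in> borel_measurable (PiM UNIV M)"
  unfolding integrand_def[abs_def]
  by (intro borel_measurable_times borel_measurable_prod kernel_measurable measurable_restrict_fun assms)

definition partial_integrand :: "('n \<Rightarrow> ('n \<Rightarrow> real) \<Rightarrow> complex) \<Rightarrow> nat \<Rightarrow> ('n \<Rightarrow> real) \<Rightarrow> complex" where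
  "partial_integrand f n z = (\<Sum>k\<le>n. \<Sum>\<kappa>\<in>{\<kappa>\<in>grid k UNIV. whitney k \<kappa>}. if in_cell UNIV k \<kappa> z then integrand f z else 0)"

text \<open>The sum telescopes. Along the chain of cells containing z goodness persists once
  attained, so there is exactly one Whitney cell among generations up to n if the last of these
  cells is good, and none otherwise.\<close>

lemma partial_integrand_eq:
  assumes "in_open_box z"
  shows "partial_integrand f n z = (if good n (cell_index n z) then integrand f z else 0)"
proof -
  have fin: "finite (grid k J)" for k and J :: "'n set" by (intro finite_PiE) auto
  have layer: "(\<Sum>\<kappa>\<in>{\<kappa>\<in>grid k UNIV. whitney k \<kappa>}. if in_cell UNIV k \<kappa> z then integrand f z else 0)
     = (if whitney k (cell_index k z) then integrand f z else 0)" for k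
  proof -
    have iff: "in_cell UNIV k \<kappa> z \<longleftrightarrow> \<kappa> = cell_index k z" for \<kappa>
      using in_cell_index cell_index_in_grid(2)[OF assms] by metis
    have "(\<Sum>\<kappa>\<in>{\<kappa>\<in>grid k UNIV. whitney k \<kappa>}. if in_cell UNIV k \<kappa> z then integrand f z else 0) =
      (\<Sum>\<kappa>\<in>{\<kappa>\<in>grid k UNIV. whitney k \<kappa>}. if \<kappa> = cell_index k z then integrand f z else 0)"
      by (simp only: iff)
    also have "\<dots> = (if cell_index k z \<in> {\<kappa>\<in>grid k UNIV. whitney k \<kappa>} then integrand f z else 0)"
      by (rule sum.delta) (use fin in simp)
    also have "cell_index k z \<in> {\<kappa>\<in>grid k UNIV. whitney k \<kappa>} \<longleftrightarrow> whitney k (cell_index k z)"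
      using cell_index_in_grid(1)[OF assms, of k] by blast
    finally show ?thesis .
  qed
  show ?thesis unfolding partial_integrand_def layer
  proof (induction n)
    case 0 show ?case by (simp add: whitney_def)
  next
    case (Suc n)
    have w: "whitney (Suc n) (cell_index (Suc n) z) \<longleftrightarrow> good (Suc n) (cell_index (Suc n) z) \<and> \<not> good n (cell_index n z)"
      unfolding whitney_def cell_index_half[of n z] by simp
    have "good n (cell_index n z) \<Longrightarrow> good (Suc n) (cell_index (Suc n) z)"
      using good_child[of n "cell_index (Suc n) z"] cell_index_half[of n z] by simp
    then show ?case unfolding sum.atMost_Suc Suc.IH w by auto
  qed
qed

text \<open>The generations form a geometric series of ratio 2 powr (-1/4). The partial sums agree
  with the integrand from some generation on at every point where \<psi> does not vanish, and both
  are zero elsewhere, so dominated convergence gives the full integral.\<close>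

lemma bounded_estimate:
  fixes f :: "'n \<Rightarrow> ('n \<Rightarrow> real) \<Rightarrow> complex"
  assumes f: "\<And>j. f j \<in> borel_measurable (PiM (UNIV - {j}) M)" and fL: "\<And>j v. norm (f j v) \<le> L"
  shows "norm (\<integral>z. integrand f z \<partial>PiM UNIV M) \<le> cell_const * (1 / (1 - 2 powr (- (1 / 4)))) * decay *
    (\<Prod>j\<in>UNIV. (\<integral>v. norm (f j v) powr P \<partial>PiM (UNIV - {j}) M) powr (1 / P))"
proof -
  define A where "A = (\<Prod>j\<in>UNIV. (\<integral>v. norm (f j v) powr P \<partial>PiM (UNIV - {j}) M) powr (1 / P))"
  have A0: "A \<ge> 0" unfolding A_def by (intro prod_nonneg) auto
  define \<theta> where "\<theta> = (2::real) powr (- (1 / 4))"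
  have "\<theta> < 2 powr 0" unfolding \<theta>_def by (intro powr_less_mono) auto
  then have \<theta>: "0 < \<theta>" "\<theta> < 1" by (auto simp: \<theta>_def)
  note im [measurable] = integrand_measurable[OF f]
  have L0: "0 \<le> L" using fL[of t undefined] norm_ge_zero order_trans by blast
  define BF where "BF = C1 * L ^ CARD('n)"
  have FB: "norm (integrand f z) \<le> BF" for z
  proof -
    have "norm (integrand f z) = norm (\<psi> (vec z)) * (\<Prod>j\<in>UNIV. norm (f j (restrict z (UNIV - {j}))))"
      unfolding integrand_def norm_mult norm_kernel prod_norm ..
    also have "\<dots> \<le> C1 * (\<Prod>j\<in>(UNIV::'n set). L)"
      using C1 L0 fL by (intro mult_mono prod_mono \<psi>_bounds prod_nonneg) auto
    finally show ?thesis by (simp add: BF_def)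
  qed
  have cellm: "Measurable.pred (PiM UNIV M) (\<lambda>z. in_cell UNIV k \<kappa> z)" for k \<kappa> by (rule in_cell_measurable)
  have term_int: "integrable (PiM UNIV M) (\<lambda>z. if in_cell UNIV k \<kappa> z then integrand f z else 0)" for k \<kappa>
  proof (rule integrable_PiM_bounded[where B = BF])
    note [measurable] = cellm[of k \<kappa>]
    show "(\<lambda>z. if in_cell UNIV k \<kappa> z then integrand f z else 0) \<in> borel_measurable (PiM UNIV M)" by measurable
    show "norm (if in_cell UNIV k \<kappa> z then integrand f z else 0) \<le> BF" for z
      using FB[of z] order_trans[OF norm_ge_zero FB[of z]] by auto
  qed simp
  have bound: "norm (\<integral>z. partial_integrand f n z \<partial>PiM UNIV M) \<le> cell_const * (1 / (1 - \<theta>)) * decay * A" for n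
  proof -
    have "(\<integral>z. partial_integrand f n z \<partial>PiM UNIV M) = (\<Sum>k\<le>n. \<Sum>\<kappa>\<in>{\<kappa>\<in>grid k UNIV. whitney k \<kappa>}.
        \<integral>z. (if in_cell UNIV k \<kappa> z then integrand f z else 0) \<partial>PiM UNIV M)"
      unfolding partial_integrand_def using term_int
      by (subst Bochner_Integration.integral_sum, simp) (intro sum.cong refl Bochner_Integration.integral_sum, simp)
    then have "norm (\<integral>z. partial_integrand f n z \<partial>PiM UNIV M) \<le> (\<Sum>k\<le>n. \<Sum>\<kappa>\<in>{\<kappa>\<in>grid k UNIV. whitney k \<kappa>}.
        norm (\<integral>z. (if in_cell UNIV k \<kappa> z then integrand f z else 0) \<partial>PiM UNIV M))"
      by (simp only:) (intro order.trans[OF norm_sum] sum_mono norm_sum)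
    also have "\<dots> \<le> (\<Sum>k\<le>n. cell_const * decay * A * \<theta> ^ k)"
      unfolding A_def \<theta>_def integrand_def by (intro sum_mono layer_estimate[OF f fL])
    also have "\<dots> = cell_const * decay * A * (\<Sum>k\<le>n. \<theta> ^ k)" by (simp only: sum_distrib_left)
    also have "\<dots> \<le> cell_const * decay * A * (1 / (1 - \<theta>))"
    proof (rule mult_left_mono)
      have "(\<Sum>k\<le>n. \<theta> ^ k) \<le> (\<Sum>k. \<theta> ^ k)"
        using \<theta> by (intro sum_le_suminf summable_geometric) auto
      then show "(\<Sum>k\<le>n. \<theta> ^ k) \<le> 1 / (1 - \<theta>)" using \<theta> by (simp add: suminf_geometric)
      show "0 \<le> cell_const * decay * A" using A0 cell_const_nonneg decay_nonneg by simp
    qed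
    finally show ?thesis by (simp only: mult_ac)
  qed
  have "(\<lambda>n. \<integral>z. partial_integrand f n z \<partial>PiM UNIV M) \<longlonglongrightarrow> (\<integral>z. integrand f z \<partial>PiM UNIV M)"
  proof (rule integral_dominated_convergence[where w = "\<lambda>_. BF"])
    show "integrand f \<in> borel_measurable (PiM UNIV M)" by (rule im)
    show "partial_integrand f n \<in> borel_measurable (PiM UNIV M)" for n
      unfolding partial_integrand_def[abs_def] using term_int by (intro borel_measurable_sum) auto
    show "integrable (PiM UNIV M) (\<lambda>_. BF)" by (intro integrable_PiM_bounded[where B = "\<bar>BF\<bar>"]) auto
    show "AE z in PiM UNIV M. (\<lambda>n. partial_integrand f n z) \<longlonglongrightarrow> integrand f z"
    proof (rule AE_I2)
      fix z
      show "(\<lambda>n. partial_integrand f n z) \<longlonglongrightarrow> integrand f z"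
      proof (cases "\<psi> (vec z) = 0")
        case True
        have "partial_integrand f n z = 0" for n
          unfolding partial_integrand_def integrand_zero[OF True] by simp
        then show ?thesis using integrand_zero[OF True] by simp
      next
        case False
        have "eventually (\<lambda>n. partial_integrand f n z = integrand f z) sequentially"
          using eventually_good[OF False] by eventually_elim (simp add: partial_integrand_eq[OF \<psi>_nonzero_in_box[OF False]])
        then show ?thesis by (rule tendsto_eventually)
      qed
    qed
    show "AE z in PiM UNIV M. norm (partial_integrand f n z) \<le> BF" for n
    proof (rule AE_I2)
      fix z
      show "norm (partial_integrand f n z) \<le> BF"
      proof (cases "\<psi> (vec z) = 0")
        case True
        have "partial_integrand f n z = 0"
          unfolding partial_integrand_def integrand_zero[OF True] by simp
        then show ?thesis using order_trans[OF norm_ge_zero FB[of z]] by simp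
      next
        case False
        show ?thesis using FB[of z] order_trans[OF norm_ge_zero FB[of z]]
          by (simp add: partial_integrand_eq[OF \<psi>_nonzero_in_box[OF False]])
      qed
    qed
  qed
  then have "(\<lambda>n. norm (\<integral>z. partial_integrand f n z \<partial>PiM UNIV M)) \<longlonglongrightarrow> norm (\<integral>z. integrand f z \<partial>PiM UNIV M)"
    by (rule tendsto_norm)
  then show ?thesis unfolding A_def[symmetric] \<theta>_def[symmetric]
    by (rule LIMSEQ_le_const2) (use bound in auto)
qed

section \<open>From bounded functions on the box to general functions\<close>

lemma M_density: "finite J \<Longrightarrow> PiM J M = density (PiM J (\<lambda>_. lborel)) (\<lambda>z. ennreal (\<Prod>i\<in>J. indicator {lo i..lo i + b i} (z i)))"
  unfolding M_def using b
  by (subst PiM_interval_lborel) (auto intro!: arg_cong2[where f = density] simp: prod_ennreal[symmetric] indicator_def intro!: prod.cong)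

lemma indicator_box_measurable:
  "(\<lambda>z. \<Prod>i\<in>J. indicator {lo i..lo i + b i} (z i) :: real) \<in> borel_measurable (PiM J (\<lambda>_. lborel))"
  by (intro borel_measurable_prod) measurable

text \<open>Truncating the functions at height n gives bounded ones whose norms do not exceed the
  original norms. The truncated integrands are dominated by the full integrand and converge to it
  pointwise.\<close>

lemma general_estimate:
  fixes f :: "'n \<Rightarrow> ('n \<Rightarrow> real) \<Rightarrow> complex"
  assumes f: "\<And>j. f j \<in> borel_measurable (hyperplane_measure j)"
    and fi: "\<And>j. integrable (hyperplane_measure j) (\<lambda>v. norm (f j v) powr P)"
  shows "norm (Lambda_d lam S \<psi> f) \<le> cell_const * (1 / (1 - 2 powr (- (1 / 4)))) * decay *
    (\<Prod>j\<in>UNIV. Lp_norm (hyperplane_measure j) P (f j))"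
proof -
  define C where "C = cell_const * (1 / (1 - 2 powr (- (1 / 4)))) * decay"
  have "(2::real) powr (- (1 / 4)) < 2 powr 0" by (intro powr_less_mono) auto
  then have C0: "C \<ge> 0" unfolding C_def using cell_const_nonneg decay_nonneg by simp
  define R where "R = (\<Prod>j\<in>UNIV. Lp_norm (hyperplane_measure j) P (f j))"
  have R0: "R \<ge> 0" unfolding R_def Lp_norm_def by (intro prod_nonneg) auto
  have hm: "hyperplane_measure j = PiM (UNIV - {j}) (\<lambda>_. lborel)" for j :: 'n by (simp add: hyperplane_measure_def)
  have fM: "f j \<in> borel_measurable (PiM (UNIV - {j}) M)" for j
    using f[of j] by (simp add: hm cong: measurable_cong_sets add: sets_PiM_M)
  note im = integrand_measurable[OF fM]
  have imL: "integrand f \<in> borel_measurable (PiM UNIV (\<lambda>_. lborel))"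
    using im by (simp cong: measurable_cong_sets add: sets_PiM_M)
  have Lam: "Lambda_d lam S \<psi> f = (\<integral>z. integrand f z \<partial>PiM UNIV M)"
  proof -
    have proj: "proj_del j (\<chi> i. z i) = restrict z (UNIV - {j})" for j z
      by (auto simp: proj_del_def fun_eq_iff)
    have "(\<lambda>x. exp (\<i> * complex_of_real (lam * S x)) * \<psi> x * (\<Prod>j\<in>UNIV. f j (proj_del j x))) \<in> borel_measurable borel"
    proof (intro borel_measurable_times[OF kernel_measurable(1)] borel_measurable_prod)
      fix j :: 'n
      have "proj_del j \<in> (borel :: (real^'n) measure) \<rightarrow>\<^sub>M PiM (UNIV - {j}) (\<lambda>_. lborel)"
        unfolding proj_del_def[abs_def] by (rule measurable_restrict) (simp add: borel_measurable_continuous_onI continuous_on_component)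
      from measurable_compose[OF this f[of j, unfolded hm]]
      show "(\<lambda>x. f j (proj_del j x)) \<in> borel_measurable borel" .
    qed
    then have "Lambda_d lam S \<psi> f = (\<integral>z. integrand f z \<partial>PiM UNIV (\<lambda>_. lborel))"
      unfolding Lambda_d_def by (subst integral_lborel_vec) (simp_all add: integrand_def[abs_def] kernel_def vec_def proj)
    \<comment> \<open>The support of \<psi> lies in the box, so its indicator may be inserted to
      pass from Lebesgue measure to \<open>M\<close>.\<close>
    also have "\<dots> = (\<integral>z. (\<Prod>i\<in>UNIV. indicator {lo i..lo i + b i} (z i)) *\<^sub>R integrand f z \<partial>PiM UNIV (\<lambda>_. lborel))"
    proof (intro Bochner_Integration.integral_cong refl)
      fix z :: "'n \<Rightarrow> real"
      show "integrand f z = (\<Prod>i\<in>UNIV. indicator {lo i..lo i + b i} (z i)) *\<^sub>R integrand f z"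
      proof (cases "\<psi> (vec z) = 0")
        case True then show ?thesis by (simp add: integrand_zero)
      next
        case False
        then have "(\<Prod>i\<in>UNIV. indicator {lo i..lo i + b i} (z i) :: real) = 1"
          using \<psi>_nonzero_in_box[OF False] by (intro prod.neutral) (auto simp: in_open_box_def indicator_def less_imp_le)
        then show ?thesis by simp
      qed
    qed
    also have "\<dots> = (\<integral>z. integrand f z \<partial>PiM UNIV M)"
      unfolding M_density[OF finite_class.finite_UNIV]
      by (rule integral_density[symmetric, OF imL indicator_box_measurable]) (auto intro!: AE_I2 prod_nonneg)
    finally show ?thesis .
  qed
  show ?thesis unfolding Lam C_def[symmetric] R_def[symmetric]
  proof (cases "integrable (PiM UNIV M) (integrand f)")
    \<comment> \<open>Without integrability the Bochner integral is 0 and the bound holds trivially;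
      otherwise the integrand itself is available as a dominating function.\<close>
    case False
    then show "norm (\<integral>z. integrand f z \<partial>PiM UNIV M) \<le> C * R" using C0 R0 by (simp add: not_integrable_integral_eq)
  next
    case int: True
    define fL where "fL n j v = (if norm (f j v) \<le> real n then f j v else 0)" for n j v
    have fLm: "fL n j \<in> borel_measurable (PiM (UNIV - {j}) M)" for n j
      unfolding fL_def[abs_def] using fM[of j] by measurable
    have fLb: "norm (fL n j v) \<le> real n" "norm (fL n j v) \<le> norm (f j v)" for n j v by (auto simp: fL_def)
    have bound: "norm (\<integral>z. integrand (fL n) z \<partial>PiM UNIV M) \<le> C * R" for n
    proof -
      have "norm (\<integral>z. integrand (fL n) z \<partial>PiM UNIV M) \<le> C *
         (\<Prod>j\<in>UNIV. (\<integral>v. norm (fL n j v) powr P \<partial>PiM (UNIV - {j}) M) powr (1 / P))"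
        unfolding C_def by (rule bounded_estimate[OF fLm fLb(1)])
      also have "\<dots> \<le> C * R" unfolding R_def Lp_norm_def
      proof (intro mult_left_mono C0 prod_mono conjI powr_mono2)
        fix j :: 'n
        have m: "(\<lambda>v. norm (fL n j v) powr P) \<in> borel_measurable (PiM (UNIV - {j}) (\<lambda>_. lborel))"
          using fLm[of n j] by (intro powr_real_measurable borel_measurable_norm borel_measurable_const) (simp cong: measurable_cong_sets add: sets_PiM_M)
        have "(\<integral>v. norm (fL n j v) powr P \<partial>PiM (UNIV - {j}) M) =
          (\<integral>v. (\<Prod>i\<in>UNIV - {j}. indicator {lo i..lo i + b i} (v i)) *\<^sub>R (norm (fL n j v) powr P) \<partial>PiM (UNIV - {j}) (\<lambda>_. lborel))"
          unfolding M_density[OF finite]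
          by (rule integral_density[OF m indicator_box_measurable]) (auto intro!: AE_I2 prod_nonneg)
        also have "\<dots> \<le> (\<integral>v. norm (f j v) powr P \<partial>hyperplane_measure j)"
          unfolding hm
        proof (rule integral_mono')
          show "integrable (PiM (UNIV - {j}) (\<lambda>_. lborel)) (\<lambda>v. norm (f j v) powr P)" using fi[of j] by (simp add: hm)
          fix v
          have "(\<Prod>i\<in>UNIV - {j}. indicator {lo i..lo i + b i} (v i) :: real) \<le> 1" by (intro prod_le_1) auto
          moreover have "norm (fL n j v) powr P \<le> norm (f j v) powr P" using fLb(2) P_facts(1) by (intro powr_mono2) auto
          ultimately show "(\<Prod>i\<in>UNIV - {j}. indicator {lo i..lo i + b i} (v i)) *\<^sub>R (norm (fL n j v) powr P) \<le> norm (f j v) powr P"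
            using mult_mono[of "\<Prod>i\<in>UNIV - {j}. indicator {lo i..lo i + b i} (v i) :: real" 1 "norm (fL n j v) powr P" "norm (f j v) powr P"] by simp
        qed simp
        finally show "(\<integral>v. norm (fL n j v) powr P \<partial>PiM (UNIV - {j}) M) \<le> (\<integral>v. norm (f j v) powr P \<partial>hyperplane_measure j)" .
      qed (use P_facts(1) in \<open>auto intro!: integral_nonneg_AE\<close>)
      finally show ?thesis .
    qed
    have "(\<lambda>n. \<integral>z. integrand (fL n) z \<partial>PiM UNIV M) \<longlonglongrightarrow> (\<integral>z. integrand f z \<partial>PiM UNIV M)"
    proof (rule integral_dominated_convergence[where w = "\<lambda>z. norm (integrand f z)"])
      show "integrand f \<in> borel_measurable (PiM UNIV M)" by (rule im)
      show "integrand (fL n) \<in> borel_measurable (PiM UNIV M)" for n by (rule integrand_measurable[OF fLm])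
      show "integrable (PiM UNIV M) (\<lambda>z. norm (integrand f z))" using int by (rule integrable_norm)
      show "AE z in PiM UNIV M. (\<lambda>n. integrand (fL n) z) \<longlonglongrightarrow> integrand f z"
      proof (rule AE_I2)
        fix z
        have "(\<lambda>n. fL n j v) \<longlonglongrightarrow> f j v" for j v
        proof (rule tendsto_eventually)
          obtain n0 :: nat where "norm (f j v) \<le> real n0" using real_arch_simple by blast
          then show "eventually (\<lambda>n. fL n j v = f j v) sequentially"
            unfolding eventually_sequentially by (intro exI[of _ n0]) (auto simp: fL_def)
        qed
        then show "(\<lambda>n. integrand (fL n) z) \<longlonglongrightarrow> integrand f z"
          unfolding integrand_def by (intro tendsto_mult tendsto_const tendsto_prod)
      qed
      show "AE z in PiM UNIV M. norm (integrand (fL n) z) \<le> norm (integrand f z)" for n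
        unfolding integrand_def norm_mult prod_norm[symmetric]
        by (intro AE_I2 mult_left_mono prod_mono conjI fLb) auto
    qed
    then have "(\<lambda>n. norm (\<integral>z. integrand (fL n) z \<partial>PiM UNIV M)) \<longlonglongrightarrow> norm (\<integral>z. integrand f z \<partial>PiM UNIV M)"
      by (rule tendsto_norm)
    then show "norm (\<integral>z. integrand f z \<partial>PiM UNIV M) \<le> C * R"
      by (rule LIMSEQ_le_const2) (use bound in auto)
  qed
qed

end

theorem theorem4p2:
  fixes C1 C2 :: real
  assumes "CARD('n::finite) \<ge> 3"
  shows "\<exists>C. \<forall>(lam::real) (S :: real^'n \<Rightarrow> real) (\<psi> :: real^'n \<Rightarrow> complex) (\<mu>::real)
            (b :: 'n \<Rightarrow> real) (f :: 'n \<Rightarrow> ('n \<Rightarrow> real) \<Rightarrow> complex).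
     lam > 2 \<longrightarrow> C0_inf \<psi> \<longrightarrow>
     (\<exists>U. open U \<and> tsupport \<psi> \<subseteq> U \<and> real_analytic_on U S) \<longrightarrow>
     \<mu> > 0 \<longrightarrow>
     (\<forall>j. local_estimate_hyp S \<psi> j \<mu> (b j) C1 C2) \<longrightarrow>
     (\<forall>j. f j \<in> borel_measurable (hyperplane_measure j) \<and>
          integrable (hyperplane_measure j) (\<lambda>y. norm (f j y) powr p_exp CARD('n))) \<longrightarrow>
     norm (Lambda_d lam S \<psi> f)
       \<le> C * (lam * \<mu>) powr (- (1 / 2 ^ (CARD('n) - 1)))
           * (\<Prod>j\<in>UNIV. Lp_norm (hyperplane_measure j) (p_exp CARD('n)) (f j))"
proof -
  \<comment> \<open>The same choice term as in \<open>Dd\<close>, so that its head \<open>t\<close>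
    is the outermost derivative there.\<close>
  define js0 where "js0 = (SOME js. distinct js \<and> set js = (UNIV :: 'n set))"
  have ex: "\<exists>js. distinct js \<and> set js = (UNIV :: 'n set)" using finite_distinct_list[OF finite_class.finite_UNIV] by blast
  have "distinct js0 \<and> set js0 = UNIV" unfolding js0_def by (rule someI_ex[OF ex])
  then have js0: "distinct js0" "set js0 = UNIV" by simp_all
  then obtain t js where tjs: "js0 = t # js" by (cases js0) auto
  \<comment> \<open>This is \<open>cell_const\<close> times the sum of the geometric series, written
    out because it must be fixed before S, \<psi> and \<mu> are; it involves only the dimension, C1
    and C2.\<close>
  define C where "C = 2 * multilinear_const (CARD('n) - 2) * (3 * (1 + 4 * C2 + 3 * C2\<^sup>2)) powr (1 / 2 ^ (CARD('n) - 1)) *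
    (44 * (6 * real CARD('n) * C1)) * (1 / (1 - 2 powr (- (1 / 4))))"
  show ?thesis
  proof (intro exI[of _ C] allI impI)
    fix lam :: real and S :: "real^'n \<Rightarrow> real" and \<psi> :: "real^'n \<Rightarrow> complex" and \<mu> :: real
      and b :: "'n \<Rightarrow> real" and f :: "'n \<Rightarrow> ('n \<Rightarrow> real) \<Rightarrow> complex"
    assume lam: "lam > 2" and \<psi>: "C0_inf \<psi>" and an: "\<exists>U. open U \<and> tsupport \<psi> \<subseteq> U \<and> real_analytic_on U S"
      and \<mu>: "\<mu> > 0" and hyp: "\<forall>j. local_estimate_hyp S \<psi> j \<mu> (b j) C1 C2"
      and f: "\<forall>j. f j \<in> borel_measurable (hyperplane_measure j) \<and>
          integrable (hyperplane_measure j) (\<lambda>y. norm (f j y) powr p_exp CARD('n))"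
    obtain U where U: "tsupport \<psi> \<subseteq> U" "real_analytic_on U S" using an by blast
    note hyp' = hyp[unfolded local_estimate_hyp_def, rule_format]
    have "\<forall>j. \<exists>a. \<forall>x\<in>tsupport \<psi>. a \<le> x $ j \<and> x $ j \<le> a + b j" using hyp' by blast
    then obtain lo where lo: "\<And>j x. x \<in> tsupport \<psi> \<Longrightarrow> lo j \<le> x $ j \<and> x $ j \<le> lo j + b j" by metis
    have pos: "C1 > 0" "C2 > 0" "b j > 0" for j using hyp'[of j] by auto
    interpret oscillatory_form lam \<mu> C1 C2 S \<psi> b lo U t js
    proof
      show "norm (partial_pow j n \<psi> x) \<le> C1 / b j ^ n" if "n \<le> 2" for j n x
      proof -
        have "n \<in> {0, 1, 2}" using that by auto
        then have "norm (partial_pow j n \<psi> x) \<le> C1 * b j powr (- real n)" using hyp'[of j] by blast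
        also have "b j powr (- real n) = 1 / b j ^ n" using pos(3)[of j] by (simp add: powr_minus powr_realpow divide_inverse)
        finally show ?thesis by simp
      qed
      show "Dd S = iter_partial (t # js) S" unfolding Dd_def js0_def[symmetric] tjs ..
      show "smooth_on UNIV \<psi>" using \<psi> by (simp add: C0_inf_def)
    qed (use lam \<mu> pos U lo hyp' js0 assms tjs in auto)
    have "norm (Lambda_d lam S \<psi> f) \<le> cell_const * (1 / (1 - 2 powr (- (1 / 4)))) * decay *
      (\<Prod>j\<in>UNIV. Lp_norm (hyperplane_measure j) P (f j))"
      by (rule general_estimate) (use f in \<open>auto simp: P_def\<close>)
    also have "cell_const * (1 / (1 - 2 powr (- (1 / 4)))) * decay = C * (lam * \<mu>) powr (- (1 / 2 ^ (CARD('n) - 1)))"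
      unfolding cell_const_def decay_def c1_def C_def ..
    finally show "norm (Lambda_d lam S \<psi> f) \<le> C * (lam * \<mu>) powr (- (1 / 2 ^ (CARD('n) - 1)))
           * (\<Prod>j\<in>UNIV. Lp_norm (hyperplane_measure j) (p_exp CARD('n)) (f j))"
      unfolding P_def .
  qed
qed

end
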